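(* Let $n\ge 1$, $\sigma_1,\sigma_2>0$, and let $\eta:\mathbb{R}^n\to\mathbb{R}$ be a continuous function, positive on $\mathbb{R}^n\setminus\{0\}$, satisfying $$\eta(\xi)\sim |\xi|^{\sigma_1}\ \text{ as } |\xi|\to 0,\qquad \eta(\xi)\sim|\xi|^{-\sigma_2}\ \text{ as } |\xi|\to\infty .$$ Let $s,\varrho\in\mathbb{R}$ with $s+\varrho>0$, let $1\le\alpha\le\infty$, let $1\le r\le 2$, and let $\ell\in\mathbb{R}$ satisfy $\ell>n\left(\frac1r-\frac12\right)$ (in the case $r=2$, $\ell\ge 0$ is allowed). Then there is a constant $C>0$, independent of $f$ and $t$, such that for every $f\in\dot B^{s+\ell}_{r,\alpha}(\mathbb{R}^n)\cap\dot B^{-\varrho}_{2,\infty}(\mathbb{R}^n)$ and every $t\ge 0$, $$\Big\|2^{qs}\big\|\widehat{\dot\Delta_q f}\,e^{-\eta(\xi)t}\big\|_{L^2}\Big\|_{l^\alpha_q}\le C\Big[(1+t)^{-\frac{s+\varrho}{\sigma_1}}\|f\|_{\dot B^{-\varrho}_{2,\infty}}+(1+t)^{-\frac{\ell}{\sigma_2}+\gamma_{\sigma_2}(r,2)}\|f\|_{\dot B^{s+\ell}_{r,\alpha}}\Big],$$ where $\gamma_\sigma(r,p):=\frac n\sigma\left(\frac1r-\frac1p\right)$.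
   Context: Notation: $\eta(\xi)\sim g(\xi)$ as $|\xi|\to0$ (resp. $|\xi|\to\infty$) means that there are constants $0<c\le C$ with $c\,g(\xi)\le\eta(\xi)\le C\,g(\xi)$ for all sufficiently small $|\xi|>0$ (resp. all sufficiently large $|\xi|$). $\hat{\cdot}=\mathcal{F}$ is the Fourier transform in $x$, and the inner $L^2$ norm is taken in the frequency variable $\xi\in\mathbb{R}^n$; $\|\cdot\|_{l^\alpha_q}$ is the $l^\alpha$ norm over $q\in\mathbb{Z}$. Littlewood-Paley blocks: fix a smooth $\varphi:\mathbb{R}^n\to[0,1]$ supported in $\{\frac34\le|\xi|\le\frac83\}$ with $\sum_{k\in\mathbb{Z}}\varphi(2^{-k}\xi)=1$ for all $\xi\ne0$; set $\dot\Delta_q f=\mathcal{F}^{-1}(\varphi(2^{-q}\xi)\mathcal{F}f)$ for $q\in\mathbb{Z}$. For $s\in\mathbb{R}$, $1\le p,r\le\infty$, the homogeneous Besov space $\dot B^s_{p,r}$ is the set of $f\in\mathcal{S}'/\mathcal{P}$ (tempered distributions modulo polynomials) with $\|f\|_{\dot B^s_{p,r}}=\big\|2^{qs}\|\dot\Delta_qf\|_{L^p}\big\|_{l^r_q(\mathbb{Z})}<\infty$. *)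

theory Defs
  imports "HOL-Analysis.Analysis" "HOL-Probability.Essential_Supremum"
begin

section \<open>Smooth and Schwartz functions\<close>

fun partials :: "'a::real_normed_vector list \<Rightarrow> ('a \<Rightarrow> 'b::real_normed_vector) \<Rightarrow> 'a \<Rightarrow> 'b" where
  "partials [] f = f"
| "partials (u # us) f = (\<lambda>x. frechet_derivative (partials us f) (at x) u)"

text \<open>Every iterated partial derivative exists and is (totally) differentiable, hence
  continuous: this is \<open>C\<^sup>\<infinity>\<close>. A list of basis vectors plays the role of a multi-index.\<close>

definition smooth :: "('a::euclidean_space \<Rightarrow> 'b::real_normed_vector) \<Rightarrow> bool" where
  "smooth f \<longleftrightarrow> (\<forall>us. set us \<subseteq> Basis \<longrightarrow> (\<forall>x. partials us f differentiable (at x)))"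

definition schwartz :: "('a::euclidean_space \<Rightarrow> complex) set" where
  "schwartz = {\<psi>. smooth \<psi> \<and>
     (\<forall>us. set us \<subseteq> Basis \<longrightarrow> (\<forall>N. \<exists>B. \<forall>x. (1 + norm x) ^ N * norm (partials us \<psi> x) \<le> B))}"

definition schwartz_norm :: "nat \<Rightarrow> ('a::euclidean_space \<Rightarrow> complex) \<Rightarrow> real" where
  "schwartz_norm N \<psi> =
     (SUP us\<in>{us. set us \<subseteq> Basis \<and> length us \<le> N}. SUP x. (1 + norm x) ^ N * norm (partials us \<psi> x))"

section \<open>Fourier transform\<close>

definition fourier :: "('a::euclidean_space \<Rightarrow> complex) \<Rightarrow> 'a \<Rightarrow> complex" where
  "fourier f \<xi> = (LINT x|lborel. cis (- (x \<bullet> \<xi>)) * f x)"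

definition inv_fourier :: "('a::euclidean_space \<Rightarrow> complex) \<Rightarrow> 'a \<Rightarrow> complex" where
  "inv_fourier f x = of_real (1 / (2 * pi) ^ DIM('a)) * (LINT \<xi>|lborel. cis (x \<bullet> \<xi>) * f \<xi>)"

section \<open>Tempered distributions\<close>

text \<open>A distribution is a functional on all functions, of which only the values on
  \<^const>\<open>schwartz\<close> are meaningful.\<close>

type_synonym 'a distr = "('a \<Rightarrow> complex) \<Rightarrow> complex"

definition tempered :: "'a::euclidean_space distr \<Rightarrow> bool" where
  "tempered T \<longleftrightarrow>
     (\<forall>\<psi>\<in>schwartz. \<forall>\<theta>\<in>schwartz. \<forall>a b. T (\<lambda>x. a * \<psi> x + b * \<theta> x) = a * T \<psi> + b * T \<theta>) \<and>
     (\<exists>N C. \<forall>\<psi>\<in>schwartz. norm (T \<psi>) \<le> C * schwartz_norm N \<psi>)"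

definition distr_fourier :: "'a::euclidean_space distr \<Rightarrow> 'a distr" where
  "distr_fourier T \<psi> = T (fourier \<psi>)"

definition distr_inv_fourier :: "'a::euclidean_space distr \<Rightarrow> 'a distr" where
  "distr_inv_fourier T \<psi> = T (inv_fourier \<psi>)"

definition distr_mult :: "('a::euclidean_space \<Rightarrow> real) \<Rightarrow> 'a distr \<Rightarrow> 'a distr" where
  "distr_mult m T \<psi> = T (\<lambda>\<xi>. of_real (m \<xi>) * \<psi> \<xi>)"

definition represents :: "('a::euclidean_space \<Rightarrow> complex) \<Rightarrow> 'a distr \<Rightarrow> bool" where
  "represents g T \<longleftrightarrow> g \<in> borel_measurable borel \<and>
     (\<forall>\<psi>\<in>schwartz. integrable lborel (\<lambda>x. g x * \<psi> x) \<and> T \<psi> = (LINT x|lborel. g x * \<psi> x))"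

text \<open>A representing function is unique almost everywhere, so norms of
  \<open>distr_fun T\<close> do not depend on the choice made here.\<close>

definition distr_fun :: "'a::euclidean_space distr \<Rightarrow> 'a \<Rightarrow> complex" where
  "distr_fun T = (SOME g. represents g T)"

section \<open>\<open>L\<^sup>p\<close> and \<open>l\<^sup>p\<close> norms\<close>

text \<open>Only used with exponent \<open>a > 0\<close>.\<close>

definition ennpowr :: "ennreal \<Rightarrow> real \<Rightarrow> ennreal" where
  "ennpowr x a = (if x = \<infinity> then \<infinity> else ennreal (enn2real x powr a))"

definition Lp_norm :: "'x measure \<Rightarrow> ennreal \<Rightarrow> ('x \<Rightarrow> ennreal) \<Rightarrow> ennreal" where
  "Lp_norm M p u =
     (if p = \<infinity> then esssup M u
      else ennpowr (\<integral>\<^sup>+ x. ennpowr (u x) (enn2real p) \<partial>M) (1 / enn2real p))"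

definition lp_norm :: "ennreal \<Rightarrow> (int \<Rightarrow> ennreal) \<Rightarrow> ennreal" where
  "lp_norm p a = Lp_norm (count_space UNIV) p a"

text \<open>The norm of \<open>w T\<close> in \<open>L\<^sup>p\<close>, infinite if \<open>T\<close> is not a function. The weight \<open>w\<close> need
  not be smooth, so \<open>w T\<close> makes sense for functions \<open>T\<close> only.\<close>

definition distr_weighted_Lp_norm ::
    "ennreal \<Rightarrow> ('a::euclidean_space \<Rightarrow> real) \<Rightarrow> 'a distr \<Rightarrow> ennreal" where
  "distr_weighted_Lp_norm p w T =
     (if \<exists>g. represents g T
      then Lp_norm lborel p (\<lambda>x. ennreal (norm (distr_fun T x * of_real (w x)))) else \<infinity>)"

definition distr_Lp_norm :: "ennreal \<Rightarrow> 'a::euclidean_space distr \<Rightarrow> ennreal" where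
  "distr_Lp_norm p T = distr_weighted_Lp_norm p (\<lambda>_. 1) T"

section \<open>Tempered distributions modulo polynomials\<close>

definition poly_rel :: "('a::euclidean_space distr \<times> 'a distr) set" where
  "poly_rel = {(T, T'). tempered T \<and> tempered T' \<and>
     (\<exists>P. polynomial_function P \<and> (\<forall>\<psi>\<in>schwartz. T \<psi> - T' \<psi> = (LINT x|lborel. P x * \<psi> x)))}"

definition tempered_mod_poly :: "'a::euclidean_space distr set set" where
  "tempered_mod_poly = Collect tempered // poly_rel"

section \<open>Littlewood--Paley blocks and homogeneous Besov spaces\<close>

definition LP_cutoff :: "('a::euclidean_space \<Rightarrow> real) \<Rightarrow> bool" where
  "LP_cutoff \<phi> \<longleftrightarrow> smooth \<phi> \<and> (\<forall>\<xi>. 0 \<le> \<phi> \<xi> \<and> \<phi> \<xi> \<le> 1) \<and>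
     closure {\<xi>. \<phi> \<xi> \<noteq> 0} \<subseteq> {\<xi>. 3 / 4 \<le> norm \<xi> \<and> norm \<xi> \<le> 8 / 3} \<and>
     (\<forall>\<xi>. \<xi> \<noteq> 0 \<longrightarrow> ((\<lambda>k::int. \<phi> ((2 powi (- k)) *\<^sub>R \<xi>)) has_sum 1) UNIV)"

text \<open>The block of a class is the block of any representative: as \<open>\<phi> (2\<^sup>-\<^sup>q \<xi>)\<close> vanishes near
  the origin, where the Fourier transforms of polynomials are supported, the block (on
  \<^const>\<open>schwartz\<close>) does not depend on it. In particular it is a distribution, not a class.\<close>

definition LP_block :: "('a::euclidean_space \<Rightarrow> real) \<Rightarrow> int \<Rightarrow> 'a distr set \<Rightarrow> 'a distr" where
  "LP_block \<phi> q f =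
     distr_inv_fourier (distr_mult (\<lambda>\<xi>. \<phi> ((2 powi (- q)) *\<^sub>R \<xi>)) (distr_fourier (SOME T. T \<in> f)))"

definition besov_norm ::
    "('a::euclidean_space \<Rightarrow> real) \<Rightarrow> real \<Rightarrow> ennreal \<Rightarrow> ennreal \<Rightarrow> 'a distr set \<Rightarrow> ennreal" where
  "besov_norm \<phi> s p r f =
     lp_norm r (\<lambda>q. ennreal (2 powr (of_int q * s)) * distr_Lp_norm p (LP_block \<phi> q f))"

definition besov_space ::
    "('a::euclidean_space \<Rightarrow> real) \<Rightarrow> real \<Rightarrow> ennreal \<Rightarrow> ennreal \<Rightarrow> 'a distr set set" where
  "besov_space \<phi> s p r = {f \<in> tempered_mod_poly. besov_norm \<phi> s p r f < \<infinity>}"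

definition comparable :: "'a filter \<Rightarrow> ('a \<Rightarrow> real) \<Rightarrow> ('a \<Rightarrow> real) \<Rightarrow> bool" where
  "comparable F \<eta> g \<longleftrightarrow>
     (\<exists>c C. 0 < c \<and> c \<le> C \<and> (\<forall>\<^sub>F \<xi> in F. c * g \<xi> \<le> \<eta> \<xi> \<and> \<eta> \<xi> \<le> C * g \<xi>))"

definition gamma_exp :: "nat \<Rightarrow> real \<Rightarrow> real \<Rightarrow> real \<Rightarrow> real" where
  "gamma_exp n \<sigma> r p = real n / \<sigma> * (1 / r - 1 / p)"

end

(*
  Fix f and put g = Delta_q f. By the finiteness of the B^(-rho)_(2,infinity) norm, g is in L^2, so
  its Fourier transform G is in L^2 as well, and it lives on the annulus |xi| ~ 2^q, where eta is
  bounded below by c 2^(q sigma_1) for q <= 0 and by c 2^(-q sigma_2) for q > 0.  So the damped block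
  costs at most exp(-c 2^(q sigma_1) t) |g|_2 or exp(-c 2^(-q sigma_2) t) |g|_2.

  Low frequencies: 2^(qs) |g|_2 <= 2^(q (s + rho)) |f|, and the numbers
  2^(q (s + rho)) exp(-c 2^(q sigma_1) t) are (1 + t)^(-(s + rho) / sigma_1) times a two-sided
  geometric bump in q, whose l^alpha norm does not depend on where its peak is.

  High frequencies: by Bernstein's inequality |g|_2 <= C 2^(q n (1/r - 1/2)) |g|_r, and the factor
  2^(-q (l - n (1/r - 1/2))) exp(-c 2^(-q sigma_2) t) is bounded by the claimed power of 1 + t,
  uniformly in q, so no summation in q is needed.

  Bernstein's inequality is obtained without Young's inequality: Fourier inversion and
  Cauchy--Schwarz on the annulus give |g|_infinity <= C 2^(qn/2) |g|_2, and
  |g|_2^2 <= |g|_infinity^(2-r) |g|_r^r.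
*)

theory Submission
  imports Defs "HOL-Probability.Characteristic_Functions" "HOL-Probability.Sinc_Integral"
begin

section \<open>Schwartz functions and their multipliers\<close>

text \<open>The spaces consist of functionals on Schwartz functions, and all norms pass through
  \<open>distr_fun\<close>, an arbitrary representing function. Hence the L^2 theory of the Fourier
  transform below: the weight exp(-\<eta> t) is not smooth and can only multiply a function, so the
  transform of a block must be represented by one, with a norm bound, and representing functions
  must be unique almost everywhere. Gaussians are the regularizers, approximate identities and test
  functions throughout.

  The two frequency ranges differ in what has to be summed. For q <= 0 only a supremum over q is
  given while an l^\<alpha> norm is wanted, so summability must come from the scalar factors: s +
  \<rho> > 0 gives the decay left of the peak, the exponential the decay right of it. For q > 0 the
  Besov norm is already an l^\<alpha> norm. Bernstein spends n (1/r - 1/2) of the l derivatives,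
  which is the origin of the \<gamma> term. The interpolation behind it has |g|_2 on both sides;
  finiteness of the norm with index -\<rho> allows the division.\<close>

lemma partials_append: "partials us (partials vs f) = partials (us @ vs) f"
  by (induction us) auto

lemma partials_single_eq:
  assumes "(f has_derivative f') (at x)"
  shows "partials [u] f x = f' u"
  using frechet_derivative_at[OF assms] by simp

lemma partials_closed:
  assumes "f \<in> X" "\<And>f u. f \<in> X \<Longrightarrow> u \<in> Basis \<Longrightarrow> partials [u] f \<in> X" "set us \<subseteq> Basis"
  shows "partials us f \<in> X"
  using assms(3)
proof (induction us)
  case (Cons u us)
  then have "partials [u] (partials us f) \<in> X" using assms(2) by simp
  then show ?case by simp
qed (use assms(1) in simp)

text \<open>The decay condition of \<open>schwartz\<close> for the empty list of derivatives.
  Separating it from smoothness allows derivatives to be treated one at a time.\<close>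

definition rapid_decay :: "('a::euclidean_space \<Rightarrow> complex) \<Rightarrow> bool" where
  "rapid_decay f \<longleftrightarrow> (\<forall>N. \<exists>B. \<forall>x. (1 + norm x) ^ N * norm (f x) \<le> B)"

lemma rapid_decay_bound:
  assumes "rapid_decay f" "\<And>x. norm (g x) \<le> c * (1 + norm x) ^ k * norm (f x)" "0 \<le> c"
  shows "rapid_decay g"
  unfolding rapid_decay_def
proof
  fix N
  obtain B where B: "\<And>x. (1 + norm x) ^ (N + k) * norm (f x) \<le> B"
    using assms(1) unfolding rapid_decay_def by blast
  have "(1 + norm x) ^ N * norm (g x) \<le> c * B" for x
  proof -
    have "(1 + norm x) ^ N * norm (g x) \<le> (1 + norm x) ^ N * (c * (1 + norm x) ^ k * norm (f x))"
      using assms(2)[of x] by (intro mult_left_mono) auto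
    also have "\<dots> = c * ((1 + norm x) ^ (N + k) * norm (f x))"
      by (simp add: power_add algebra_simps)
    also have "\<dots> \<le> c * B"
      using B assms(3) by (intro mult_left_mono) auto
    finally show ?thesis .
  qed
  then show "\<exists>B. \<forall>x. (1 + norm x) ^ N * norm (g x) \<le> B" by blast
qed

lemma rapid_decay_add:
  assumes "rapid_decay f" "rapid_decay g"
  shows "rapid_decay (\<lambda>x. f x + g x)"
  unfolding rapid_decay_def
proof
  fix N
  obtain B C where B: "\<And>x. (1 + norm x) ^ N * norm (f x) \<le> B"
      and C: "\<And>x. (1 + norm x) ^ N * norm (g x) \<le> C"
    using assms unfolding rapid_decay_def by blast
  have "(1 + norm x) ^ N * norm (f x + g x) \<le> B + C" for x
  proof -
    have "(1 + norm x) ^ N * norm (f x + g x) \<le> (1 + norm x) ^ N * (norm (f x) + norm (g x))"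
      by (intro mult_left_mono norm_triangle_ineq) auto
    also have "\<dots> \<le> B + C"
      using B[of x] C[of x] by (simp add: distrib_left)
    finally show ?thesis .
  qed
  then show "\<exists>B. \<forall>x. (1 + norm x) ^ N * norm (f x + g x) \<le> B" by blast
qed

lemma rapid_decay_mult_coord:
  assumes "rapid_decay f"
  shows "rapid_decay (\<lambda>x. of_real (x \<bullet> u) * f x)"
proof (rule rapid_decay_bound[OF assms, where c="norm u" and k=1])
  fix x
  have "\<bar>x \<bullet> u\<bar> \<le> norm u * (1 + norm x)"
    using Cauchy_Schwarz_ineq2[of x u] norm_ge_zero[of u] by (simp add: algebra_simps add_increasing)
  then show "norm (of_real (x \<bullet> u) * f x) \<le> norm u * (1 + norm x) ^ 1 * norm (f x)"
    by (simp add: norm_mult mult_right_mono)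
qed auto

lemma rapid_decay_mult_bounded:
  assumes "rapid_decay f" "\<And>x. norm (m x) \<le> c"
  shows "rapid_decay (\<lambda>x. m x * f x)"
proof (rule rapid_decay_bound[OF assms(1), where c=c and k=0])
  show "0 \<le> c" using assms(2)[of undefined] norm_ge_zero order_trans by blast
qed (auto simp: norm_mult intro: mult_right_mono assms)

text \<open>Induction over the list of directions keeps every iterated partial inside
  \<open>X\<close>, so conditions on all orders reduce to first-order conditions on a suitable
  invariant set.\<close>

lemma schwartz_coinduct:
  assumes "f \<in> X"
    and "\<And>f x. f \<in> X \<Longrightarrow> f differentiable at x"
    and "\<And>f. f \<in> X \<Longrightarrow> rapid_decay f"
    and "\<And>f u. f \<in> X \<Longrightarrow> u \<in> Basis \<Longrightarrow> partials [u] f \<in> X"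
  shows "f \<in> schwartz"
  unfolding schwartz_def smooth_def
  using partials_closed[OF assms(1,4)] assms(2,3) by (auto simp: rapid_decay_def)

lemma schwartz_differentiable: "f \<in> schwartz \<Longrightarrow> f differentiable at x"
  unfolding schwartz_def smooth_def by (auto dest: spec[of _ "[]"])

lemma schwartz_has_derivative:
  "f \<in> schwartz \<Longrightarrow> (f has_derivative (\<lambda>u. partials [u] f x)) (at x)"
  using schwartz_differentiable[of f x] by (simp add: frechet_derivative_works)

lemma schwartz_rapid_decay: "f \<in> schwartz \<Longrightarrow> rapid_decay f"
  unfolding schwartz_def rapid_decay_def by (auto dest: spec[of _ "[]"])

lemma schwartz_partials: "f \<in> schwartz \<Longrightarrow> set vs \<subseteq> Basis \<Longrightarrow> partials vs f \<in> schwartz"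
  unfolding schwartz_def smooth_def by (simp add: partials_append)

lemma schwartz_continuous: "f \<in> schwartz \<Longrightarrow> continuous_on A f"
  by (meson continuous_at_imp_continuous_on differentiable_imp_continuous_within
      schwartz_differentiable)

lemma schwartz_borel: "f \<in> schwartz \<Longrightarrow> f \<in> borel_measurable borel"
  by (intro borel_measurable_continuous_onI schwartz_continuous)

text \<open>The multiplier class for \<open>schwartz\<close>: closed under partials and under
  dilations, and it contains the cutoffs.\<close>

definition smooth_bounded :: "('a::euclidean_space \<Rightarrow> real) set" where
  "smooth_bounded = {m. smooth m \<and> (\<forall>us. set us \<subseteq> Basis \<longrightarrow> bounded (range (partials us m)))}"

lemma smooth_bounded_coinduct:
  assumes "f \<in> X"
    and "\<And>f x. f \<in> X \<Longrightarrow> f differentiable at x"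
    and "\<And>f. f \<in> X \<Longrightarrow> bounded (range f)"
    and "\<And>f u. f \<in> X \<Longrightarrow> u \<in> Basis \<Longrightarrow> partials [u] f \<in> X"
  shows "f \<in> smooth_bounded"
  unfolding smooth_bounded_def smooth_def
  using partials_closed[OF assms(1,4)] assms(2,3) by auto

lemma smooth_bounded_differentiable: "f \<in> smooth_bounded \<Longrightarrow> f differentiable at x"
  unfolding smooth_bounded_def smooth_def by (auto dest: spec[of _ "[]"])

lemma smooth_bounded_has_derivative:
  "f \<in> smooth_bounded \<Longrightarrow> (f has_derivative (\<lambda>u. partials [u] f x)) (at x)"
  using smooth_bounded_differentiable[of f x] by (simp add: frechet_derivative_works)

lemma smooth_bounded_bounded: "f \<in> smooth_bounded \<Longrightarrow> bounded (range f)"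
  unfolding smooth_bounded_def by (auto dest: spec[of _ "[]"])

lemma smooth_bounded_partials:
  "f \<in> smooth_bounded \<Longrightarrow> set vs \<subseteq> Basis \<Longrightarrow> partials vs f \<in> smooth_bounded"
  unfolding smooth_bounded_def smooth_def by (simp add: partials_append)

lemma smooth_bounded_scaleR_arg:
  assumes "m \<in> smooth_bounded"
  shows "(\<lambda>x. m (a *\<^sub>R x)) \<in> smooth_bounded"
proof (rule smooth_bounded_coinduct)
  \<comment> \<open>Each differentiation produces a factor \<open>a\<close> by the chain rule; the
    free constant \<open>c\<close> absorbs these factors and makes the set invariant.\<close>
  let ?X = "{\<lambda>x. c * m (a *\<^sub>R x) | c m. m \<in> smooth_bounded} :: ('a \<Rightarrow> real) set"
  show "(\<lambda>x. m (a *\<^sub>R x)) \<in> ?X"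
    using assms by (auto intro!: exI[of _ 1])
  have der: "((\<lambda>x. c * m (a *\<^sub>R x)) has_derivative (\<lambda>u. (c * a) * partials [u] m (a *\<^sub>R x))) (at x)"
    if "m \<in> smooth_bounded" for c and m :: "'a \<Rightarrow> real" and x
  proof -
    have *: "((\<lambda>x. a *\<^sub>R x) has_derivative (\<lambda>u. a *\<^sub>R u)) (at x)"
      by (auto intro!: derivative_eq_intros)
    have "((\<lambda>x. m (a *\<^sub>R x)) has_derivative (\<lambda>u. partials [a *\<^sub>R u] m (a *\<^sub>R x))) (at x)"
      using has_derivative_compose[OF * smooth_bounded_has_derivative[OF that, of "a *\<^sub>R x"]] .
    moreover have "partials [a *\<^sub>R u] m y = a * partials [u] m y" for u y
      using linear_scale[OF has_derivative_linear[OF smooth_bounded_has_derivative[OF that]], of a u]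
      by (simp del: partials.simps)
    ultimately have "((\<lambda>x. m (a *\<^sub>R x)) has_derivative (\<lambda>u. a * partials [u] m (a *\<^sub>R x))) (at x)"
      by simp
    from has_derivative_mult_right[OF this, of c] show ?thesis
      by (simp add: mult.assoc)
  qed
  show "f differentiable at x" if f: "f \<in> ?X" for f x
  proof -
    obtain c m where "f = (\<lambda>x. c * m (a *\<^sub>R x))" "m \<in> smooth_bounded"
      using f by auto
    then show ?thesis using der[of m c x] differentiableI by blast
  qed
  show "bounded (range f)" if f: "f \<in> ?X" for f
  proof -
    obtain c m where feq: "f = (\<lambda>x. c * m (a *\<^sub>R x))" and m: "m \<in> smooth_bounded"
      using f by auto
    have "bounded ((\<lambda>y. c *\<^sub>R y) ` range m)"
      using smooth_bounded_bounded[OF m] by (rule bounded_scaling)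
    then show ?thesis
      unfolding feq by (rule bounded_subset) auto
  qed
  show "partials [u] f \<in> ?X" if f: "f \<in> ?X" and u: "u \<in> Basis" for f u
  proof -
    obtain c m where feq: "f = (\<lambda>x. c * m (a *\<^sub>R x))" and m: "m \<in> smooth_bounded"
      using f by auto
    have "partials [u] f = (\<lambda>x. (c * a) * partials [u] m (a *\<^sub>R x))"
      unfolding feq by (intro ext partials_single_eq[OF der[OF m]])
    then show ?thesis
      using smooth_bounded_partials[OF m, of "[u]"] u by auto
  qed
qed

text \<open>Vanishing on the open complement of the closed support passes to all partials; on the
  compact support they are bounded by continuity.\<close>

lemma smooth_bounded_compact_support:
  fixes m :: "'a::euclidean_space \<Rightarrow> real"
  assumes "smooth m" "bounded {x. m x \<noteq> 0}"
  shows "m \<in> smooth_bounded"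
proof -
  let ?K = "closure {x. m x \<noteq> 0}"
  have K: "compact ?K" using assms(2) by simp
  have diff: "partials us m differentiable at x" if "set us \<subseteq> Basis" for us x
    using assms(1) that unfolding smooth_def by blast
  have zero: "partials us m x = 0" if "set us \<subseteq> Basis" "x \<notin> ?K" for us x
    using that
  proof (induction us arbitrary: x)
    case Nil
    then show ?case using closure_subset[of "{x. m x \<noteq> 0}"] by auto
  next
    case (Cons u us)
    have "(partials us m has_derivative (\<lambda>_. 0)) (at x)"
    proof (rule has_derivative_transform_within_open[where f="\<lambda>_. 0" and s="- ?K"])
      show "0 = partials us m y" if "y \<in> - ?K" for y
        using Cons that by simp
    qed (use Cons in auto)
    then have "partials [u] (partials us m) x = 0"
      by (rule partials_single_eq)
    then show ?case by simp
  qed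
  have "bounded (range (partials us m))" if us: "set us \<subseteq> Basis" for us
  proof -
    have "continuous_on ?K (partials us m)"
      using diff[OF us] by (meson continuous_at_imp_continuous_on differentiable_imp_continuous_within)
    then have "bounded (partials us m ` ?K)"
      using K compact_continuous_image compact_imp_bounded by blast
    then have "bounded (insert 0 (partials us m ` ?K))" by simp
    then show ?thesis
      by (rule bounded_subset) (use zero[OF us] in auto)
  qed
  then show ?thesis using assms(1) unfolding smooth_bounded_def by simp
qed

text \<open>The operations are exactly those that the product rule creates when polynomials and
  bounded smooth factors multiply a generator. Thus one differentiation stays in the module as soon
  as it does so for the generators, and no Leibniz formula of higher order is written out. It is
  used with the whole Schwartz class and with a single Gaussian as generators.\<close>

inductive_set schwartz_module ::
    "('a::euclidean_space \<Rightarrow> complex) set \<Rightarrow> ('a \<Rightarrow> complex) set" for S where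
  base: "f \<in> S \<Longrightarrow> f \<in> schwartz_module S"
| add: "f \<in> schwartz_module S \<Longrightarrow> g \<in> schwartz_module S \<Longrightarrow> (\<lambda>x. f x + g x) \<in> schwartz_module S"
| scale: "f \<in> schwartz_module S \<Longrightarrow> (\<lambda>x. c * f x) \<in> schwartz_module S"
| coord: "f \<in> schwartz_module S \<Longrightarrow> (\<lambda>x. of_real (x \<bullet> u) * f x) \<in> schwartz_module S"
| mult: "f \<in> schwartz_module S \<Longrightarrow> m \<in> smooth_bounded \<Longrightarrow>
    (\<lambda>x. of_real (m x) * f x) \<in> schwartz_module S"

lemma has_derivative_of_real_complex:
  assumes "(g has_derivative g') F"
  shows "((\<lambda>x. complex_of_real (g x)) has_derivative (\<lambda>u. complex_of_real (g' u))) F"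
  using assms by (rule bounded_linear.has_derivative[OF bounded_linear_of_real])

text \<open>Induction on the generation of the element: each constructor is differentiated once, and
  the two terms of the product rule are again built by constructors from the induction
  hypothesis.\<close>

lemma schwartz_module_step:
  assumes diff: "\<And>f x. f \<in> S \<Longrightarrow> f differentiable at x"
    and rapid: "\<And>f. f \<in> S \<Longrightarrow> rapid_decay f"
    and part: "\<And>f u. f \<in> S \<Longrightarrow> u \<in> Basis \<Longrightarrow> partials [u] f \<in> schwartz_module S"
    and "f \<in> schwartz_module S"
  shows "(\<forall>x. f differentiable at x) \<and> rapid_decay f \<and>
    (\<forall>u\<in>Basis. partials [u] f \<in> schwartz_module S)"
  using assms(4)
proof induction
  case (base f)
  then show ?case using diff rapid part by blast
next
  case (add f g)
  have der: "((\<lambda>x. f x + g x) has_derivative (\<lambda>u. partials [u] f x + partials [u] g x)) (at x)" for x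
    using add(3,4) by (auto simp: frechet_derivative_works intro!: has_derivative_add)
  have "partials [u] (\<lambda>x. f x + g x) = (\<lambda>x. partials [u] f x + partials [u] g x)" for u
    by (intro ext partials_single_eq[OF der])
  moreover have "(\<lambda>x. f x + g x) differentiable at x" for x
    unfolding differentiable_def by (rule exI, rule der)
  ultimately show ?case
    using add by (auto simp del: partials.simps intro: rapid_decay_add schwartz_module.add)
next
  case (scale f c)
  have der: "((\<lambda>x. c * f x) has_derivative (\<lambda>u. c * partials [u] f x)) (at x)" for x
    using scale(2) by (auto simp: frechet_derivative_works intro!: has_derivative_mult_right)
  have "partials [u] (\<lambda>x. c * f x) = (\<lambda>x. c * partials [u] f x)" for u
    by (intro ext partials_single_eq[OF der])
  moreover have "(\<lambda>x. c * f x) differentiable at x" for x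
    unfolding differentiable_def by (rule exI, rule der)
  ultimately show ?case
    using scale rapid_decay_mult_bounded[of f "\<lambda>_. c" "norm c"]
    by (auto simp del: partials.simps intro: schwartz_module.scale)
next
  case (coord f v)
  have der: "((\<lambda>x. of_real (x \<bullet> v) * f x) has_derivative
      (\<lambda>u. of_real (x \<bullet> v) * partials [u] f x + of_real (u \<bullet> v) * f x)) (at x)" for x
  proof (rule has_derivative_mult)
    show "((\<lambda>x. complex_of_real (x \<bullet> v)) has_derivative (\<lambda>x. complex_of_real (x \<bullet> v))) (at x)"
      by (rule has_derivative_of_real_complex) (auto intro!: derivative_eq_intros)
    show "(f has_derivative (\<lambda>u. partials [u] f x)) (at x)"
      using coord(2) by (auto simp: frechet_derivative_works)
  qed
  have eq: "partials [u] (\<lambda>x. of_real (x \<bullet> v) * f x) =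
      (\<lambda>x. of_real (x \<bullet> v) * partials [u] f x + of_real (u \<bullet> v) * f x)" for u
    by (intro ext partials_single_eq[OF der])
  have "partials [u] (\<lambda>x. of_real (x \<bullet> v) * f x) \<in> schwartz_module S" if "u \<in> Basis" for u
    unfolding eq
    by (intro schwartz_module.add schwartz_module.coord schwartz_module.scale)
      (use coord that in auto)
  moreover have "(\<lambda>x. of_real (x \<bullet> v) * f x) differentiable at x" for x
    unfolding differentiable_def by (rule exI, rule der)
  ultimately show ?case
    using coord rapid_decay_mult_coord by blast
next
  case (mult f m)
  have der: "((\<lambda>x. of_real (m x) * f x) has_derivative
      (\<lambda>u. of_real (m x) * partials [u] f x + of_real (partials [u] m x) * f x)) (at x)" for x
  proof (rule has_derivative_mult)
    show "((\<lambda>x. complex_of_real (m x)) has_derivative (\<lambda>u. complex_of_real (partials [u] m x))) (at x)"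
      by (intro has_derivative_of_real_complex smooth_bounded_has_derivative mult)
    show "(f has_derivative (\<lambda>u. partials [u] f x)) (at x)"
      using mult(3) by (auto simp: frechet_derivative_works)
  qed
  have eq: "partials [u] (\<lambda>x. of_real (m x) * f x) =
      (\<lambda>x. of_real (m x) * partials [u] f x + of_real (partials [u] m x) * f x)" for u
    by (intro ext partials_single_eq[OF der])
  have "partials [u] (\<lambda>x. of_real (m x) * f x) \<in> schwartz_module S" if "u \<in> Basis" for u
    unfolding eq
    by (intro schwartz_module.add schwartz_module.mult smooth_bounded_partials)
      (use mult that in auto)
  moreover have "rapid_decay (\<lambda>x. of_real (m x) * f x)"
  proof -
    obtain c where "\<And>x. norm (m x) \<le> c"
      using smooth_bounded_bounded[OF mult(2)] by (auto simp: bounded_iff)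
    then show ?thesis
      using rapid_decay_mult_bounded[of f "\<lambda>x. of_real (m x)" c] mult(3) by simp
  qed
  moreover have "(\<lambda>x. of_real (m x) * f x) differentiable at x" for x
    unfolding differentiable_def by (rule exI, rule der)
  ultimately show ?case by blast
qed

lemma schwartz_module_subset:
  assumes "\<And>f x. f \<in> S \<Longrightarrow> f differentiable at x"
    and "\<And>f. f \<in> S \<Longrightarrow> rapid_decay f"
    and "\<And>f u. f \<in> S \<Longrightarrow> u \<in> Basis \<Longrightarrow> partials [u] f \<in> schwartz_module S"
  shows "schwartz_module S \<subseteq> schwartz"
proof
  fix f assume "f \<in> schwartz_module S"
  then show "f \<in> schwartz"
    by (rule schwartz_coinduct) (use schwartz_module_step[OF assms] in auto)
qed

lemma schwartz_module_schwartz: "schwartz_module schwartz = schwartz"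
proof
  show "schwartz_module schwartz \<subseteq> schwartz"
    by (intro schwartz_module_subset schwartz_module.base schwartz_differentiable
        schwartz_rapid_decay schwartz_partials) auto
qed (auto intro: schwartz_module.base)

lemmas schwartz_add = schwartz_module.add[of _ schwartz, unfolded schwartz_module_schwartz]
  and schwartz_scale = schwartz_module.scale[of _ schwartz, unfolded schwartz_module_schwartz]
  and schwartz_coord = schwartz_module.coord[of _ schwartz, unfolded schwartz_module_schwartz]
  and schwartz_mult = schwartz_module.mult[of _ schwartz, unfolded schwartz_module_schwartz]

text \<open>A partial of \<open>g\<close> is an affine function times \<open>g\<close>, so the
  singleton \<open>{g}\<close> generates an invariant module. The linear term \<open>b\<close> and
  the constant \<open>c\<close> are included because the product of a centred Gaussian with a
  shifted one has this form.\<close>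

lemma gaussian_schwartz:
  fixes b :: "'a::euclidean_space"
  assumes "a > 0"
  shows "(\<lambda>x. complex_of_real (exp (- a * (norm x)\<^sup>2 + x \<bullet> b + c))) \<in> schwartz"
proof -
  define g where "g = (\<lambda>x. complex_of_real (exp (- a * (norm x)\<^sup>2 + x \<bullet> b + c)))"
  have der: "(g has_derivative (\<lambda>u. of_real (-2 * a) * (of_real (x \<bullet> u) * g x) + of_real (u \<bullet> b) * g x)) (at x)" for x
  proof -
    have "((\<lambda>x. exp (- a * (x \<bullet> x) + x \<bullet> b + c)) has_derivative
        (\<lambda>u. (-2 * a * (x \<bullet> u) + u \<bullet> b) * exp (- a * (x \<bullet> x) + x \<bullet> b + c))) (at x)"
      by (auto intro!: derivative_eq_intros simp: algebra_simps inner_commute)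
    from has_derivative_of_real_complex[OF this] show ?thesis
      unfolding g_def by (simp add: dot_square_norm algebra_simps)
  qed
  have part: "partials [u] g = (\<lambda>x. of_real (-2 * a) * (of_real (x \<bullet> u) * g x) + of_real (u \<bullet> b) * g x)" for u
    by (intro ext partials_single_eq[OF der])
  have rapid: "rapid_decay g"
    unfolding rapid_decay_def
  proof
    fix N :: nat
    \<comment> \<open>With 1 + |x| <= exp |x| the exponent is at most \<beta> |x| - a |x|^2 + c,
      whose maximum, at |x| = \<beta> / (2 a), is \<beta>^2 / (4 a) + c.\<close>
    define \<beta> where "\<beta> = N + norm b"
    have "(1 + norm x) ^ N * norm (g x) \<le> exp (\<beta>\<^sup>2 / (4 * a) + c)" for x
    proof -
      have "(1 + norm x) ^ N \<le> exp (norm x) ^ N"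
        by (intro power_mono exp_ge_add_one_self) auto
      also have "\<dots> = exp (N * norm x)"
        by (rule exp_of_nat_mult [symmetric])
      finally have "(1 + norm x) ^ N * norm (g x) \<le>
          exp (N * norm x) * exp (- a * (norm x)\<^sup>2 + x \<bullet> b + c)"
        by (simp add: g_def mult_right_mono)
      also have "\<dots> = exp (N * norm x - a * (norm x)\<^sup>2 + x \<bullet> b + c)"
        by (simp flip: exp_add add: algebra_simps)
      also have "\<dots> \<le> exp (\<beta>\<^sup>2 / (4 * a) + c)"
      proof -
        have "x \<bullet> b \<le> norm x * norm b" by (rule norm_cauchy_schwarz)
        moreover have "\<beta> * norm x - a * (norm x)\<^sup>2 \<le> \<beta>\<^sup>2 / (4 * a)"
        proof -
          have "0 \<le> (2 * a * norm x - \<beta>)\<^sup>2" by simp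
          then show ?thesis using assms by (simp add: field_simps power2_eq_square)
        qed
        ultimately have "N * norm x - a * (norm x)\<^sup>2 + x \<bullet> b + c \<le> \<beta>\<^sup>2 / (4 * a) + c"
          by (simp add: \<beta>_def algebra_simps)
        then show ?thesis by simp
      qed
      finally show ?thesis .
    qed
    then show "\<exists>B. \<forall>x. (1 + norm x) ^ N * norm (g x) \<le> B" by blast
  qed
  have "schwartz_module {g} \<subseteq> schwartz"
  proof (rule schwartz_module_subset)
    show "f differentiable at x" if "f \<in> {g}" for f x
      using that der unfolding differentiable_def by auto
    show "partials [u] f \<in> schwartz_module {g}" if "f \<in> {g}" for f u
    proof -
      have "partials [u] g \<in> schwartz_module {g}"
        unfolding part
        by (intro schwartz_module.add schwartz_module.scale schwartz_module.coord
            schwartz_module.base) simp_all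
      then show ?thesis using that by simp
    qed
  qed (use rapid in simp)
  then show ?thesis
    unfolding g_def using schwartz_module.base by blast
qed

section \<open>Gaussians and the Fourier transform\<close>

lemma borel_measurable_cis [measurable]: "cis \<in> borel_measurable borel"
  by (intro borel_measurable_continuous_onI continuous_intros)

lemma
  fixes f :: "'a::euclidean_space \<Rightarrow> 'b::{banach, second_countable_topology}"
  assumes [measurable]: "f \<in> borel_measurable borel" and c: "c \<noteq> 0"
  shows lborel_integrable_affine: "integrable lborel (\<lambda>x. f (t + c *\<^sub>R x)) \<longleftrightarrow> integrable lborel f"
    and lborel_integral_affine:
      "(LINT x|lborel. f x) = \<bar>c\<bar> ^ DIM('a) *\<^sub>R (LINT x|lborel. f (t + c *\<^sub>R x))"
proof -
  have *: "lborel = density (distr lborel borel (\<lambda>x. t + c *\<^sub>R x)) (\<lambda>_. ennreal (\<bar>c\<bar> ^ DIM('a)))"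
    using lborel_affine[OF c, of t] by (simp add: ennreal_power)
  show "integrable lborel (\<lambda>x. f (t + c *\<^sub>R x)) \<longleftrightarrow> integrable lborel f"
  proof -
    have "integrable lborel (\<lambda>x. \<bar>c\<bar> ^ DIM('a) *\<^sub>R f (t + c *\<^sub>R x)) \<longleftrightarrow>
        integrable lborel (\<lambda>x. f (t + c *\<^sub>R x))"
      using c integrable_scaleR_right[of "\<bar>c\<bar> ^ DIM('a)" lborel "\<lambda>x. f (t + c *\<^sub>R x)"]
        integrable_scaleR_right[of "inverse (\<bar>c\<bar> ^ DIM('a))" lborel "\<lambda>x. \<bar>c\<bar> ^ DIM('a) *\<^sub>R f (t + c *\<^sub>R x)"]
      by auto
    then show ?thesis
      by (subst (2) *) (simp add: integrable_density integrable_distr_eq)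
  qed
  show "(LINT x|lborel. f x) = \<bar>c\<bar> ^ DIM('a) *\<^sub>R (LINT x|lborel. f (t + c *\<^sub>R x))"
    by (subst *) (simp add: integral_density integral_distr)
qed

text \<open>The integrand is dominated by c |f(x)| |g(y)|, which is integrable on the product. With
  oscillating or Gaussian kernels this is the common source of the exchanges of integrals for
  Bochner integrals below.\<close>

lemma bounded_kernel_Fubini:
  fixes f :: "'a::euclidean_space \<Rightarrow> complex" and g :: "'b::euclidean_space \<Rightarrow> complex"
  assumes f: "integrable lborel f" and g: "integrable lborel g"
    and [measurable]: "(\<lambda>(x, y). k x y) \<in> borel_measurable (borel \<Otimes>\<^sub>M borel)"
    and k: "\<And>x y. norm (k x y) \<le> c"
  shows "(LINT x|lborel. f x * (LINT y|lborel. k x y * g y)) =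
    (LINT y|lborel. (LINT x|lborel. f x * k x y) * g y)"
proof -
  have [measurable]: "f \<in> borel_measurable borel" "g \<in> borel_measurable borel"
    using f g by auto
  have c: "0 \<le> c" using k norm_ge_zero order_trans by blast
  have bd: "norm (f x * (k x y * g y)) \<le> norm (c * norm (f x) * norm (g y))" for x y
  proof -
    have "norm (f x * (k x y * g y)) = norm (k x y) * (norm (f x) * norm (g y))"
      by (simp add: norm_mult)
    also have "\<dots> \<le> c * (norm (f x) * norm (g y))" 
      by (intro mult_right_mono k) auto
    finally show ?thesis using c by (simp add: abs_mult mult.assoc)
  qed
  have gy: "integrable lborel (\<lambda>y. f x * (k x y * g y))" for x
  proof (rule Bochner_Integration.integrable_bound[where f="\<lambda>y. c * norm (f x) * norm (g y)"])
    show "integrable lborel (\<lambda>y. c * norm (f x) * norm (g y))"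
      using g by (intro integrable_mult_right integrable_norm)
  qed (use bd in auto)
  have int: "integrable (lborel \<Otimes>\<^sub>M lborel) (\<lambda>(x, y). f x * (k x y * g y))"
  proof (rule lborel_pair.Fubini_integrable)
    have "integrable lborel (\<lambda>x. (c * (LINT y|lborel. norm (g y))) * norm (f x))"
      using f by (intro integrable_mult_right integrable_norm)
    then show "integrable lborel (\<lambda>x. LINT y|lborel. norm (case (x, y) of (x, y) \<Rightarrow> f x * (k x y * g y)))"
    proof (rule Bochner_Integration.integrable_bound)
      show "AE x in lborel. norm (LINT y|lborel. norm (case (x, y) of (x, y) \<Rightarrow> f x * (k x y * g y)))
        \<le> norm ((c * (LINT y|lborel. norm (g y))) * norm (f x))"
      proof (rule AE_I2)
        fix x
        have "(LINT y|lborel. norm (f x * (k x y * g y))) \<le> (LINT y|lborel. c * norm (f x) * norm (g y))"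
        proof (rule integral_mono)
          show "norm (f x * (k x y * g y)) \<le> c * norm (f x) * norm (g y)" for y
            using bd[of x y] c by simp
        qed (use g gy in \<open>auto intro!: integrable_mult_right\<close>)
        then show "norm (LINT y|lborel. norm (case (x, y) of (x, y) \<Rightarrow> f x * (k x y * g y)))
        \<le> norm ((c * (LINT y|lborel. norm (g y))) * norm (f x))"
          using c by (simp add: mult_ac)
      qed
    qed simp
  qed (use gy in auto)
  have "(LINT x|lborel. f x * (LINT y|lborel. k x y * g y)) = (LINT x|lborel. (LINT y|lborel. f x * (k x y * g y)))"
    by simp
  also have "\<dots> = (LINT y|lborel. (LINT x|lborel. f x * (k x y * g y)))"
    using lborel_pair.Fubini_integral[OF int] by simp
  also have "\<dots> = (LINT y|lborel. (LINT x|lborel. f x * k x y) * g y)"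
    by (simp flip: mult.assoc)
  finally show ?thesis .
qed

lemma borel_measurable_lborel_integral:
  fixes f :: "'a::euclidean_space \<Rightarrow> 'b::euclidean_space \<Rightarrow> complex"
  assumes "(\<lambda>(x, y). f x y) \<in> borel_measurable (borel \<Otimes>\<^sub>M borel)"
  shows "(\<lambda>x. LINT y|lborel. f x y) \<in> borel_measurable borel"
proof -
  have "measurable (borel \<Otimes>\<^sub>M lborel) borel = measurable (borel \<Otimes>\<^sub>M borel) borel"
    by (intro measurable_cong_sets sets_pair_measure_cong) auto
  then show ?thesis
    using assms by (intro lborel.borel_measurable_lebesgue_integral) simp
qed

lemma fourier_borel_measurable [measurable]:
  assumes [measurable]: "f \<in> borel_measurable borel"
  shows "fourier f \<in> borel_measurable borel"
  unfolding fourier_def[abs_def] by (intro borel_measurable_lborel_integral) measurable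

lemma integrable_cis_mult:
  fixes f :: "'a::euclidean_space \<Rightarrow> complex"
  assumes f: "integrable lborel f" and [measurable]: "h \<in> borel_measurable borel"
  shows "integrable lborel (\<lambda>x. cis (h x) * f x)"
proof (rule Bochner_Integration.integrable_bound[OF f])
  have [measurable]: "f \<in> borel_measurable borel" using f by auto
  show "(\<lambda>x. cis (h x) * f x) \<in> borel_measurable lborel" by simp
qed (auto simp: norm_mult)

lemma norm_fourier_le:
  "norm (fourier f \<xi>) \<le> (LINT x|lborel. norm (f x))"
  unfolding fourier_def by (rule order_trans[OF integral_norm_bound]) (simp add: norm_mult)

lemma fourier_multiplication:
  fixes f g :: "'a::euclidean_space \<Rightarrow> complex"
  assumes "integrable lborel f" "integrable lborel g"
  shows "(LINT \<xi>|lborel. fourier f \<xi> * g \<xi>) = (LINT x|lborel. f x * fourier g x)"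
proof -
  have k: "(\<lambda>(x::'a, y). cis (- (y \<bullet> x))) \<in> borel_measurable (borel \<Otimes>\<^sub>M borel)"
    by measurable
  have "(LINT x|lborel. f x * (LINT y|lborel. cis (- (y \<bullet> x)) * g y)) =
      (LINT y|lborel. (LINT x|lborel. f x * cis (- (y \<bullet> x))) * g y)"
    by (rule bounded_kernel_Fubini[OF assms k, where c=1]) simp
  then show ?thesis
    unfolding fourier_def by (simp add: mult.commute inner_commute)
qed

section \<open>Fourier transforms of Gaussians\<close>

lemma lborel_integral_prod:
  fixes f :: "'a::euclidean_space \<Rightarrow> real \<Rightarrow> complex"
  assumes int: "\<And>b. b \<in> Basis \<Longrightarrow> integrable lborel (f b)"
  shows "(LINT x|lborel. (\<Prod>b\<in>Basis. f b (x \<bullet> b))) = (\<Prod>b\<in>Basis. (LINT x|lborel. f b x))"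
proof -
  interpret product_sigma_finite "\<lambda>_::'a. lborel :: real measure" ..
  have [measurable]: "f b \<in> borel_measurable borel" if "b \<in> Basis" for b
    using int[OF that] by auto
  have "(LINT x|lborel. (\<Prod>b\<in>Basis. f b (x \<bullet> b))) =
      (LINT x|(\<Pi>\<^sub>M b\<in>Basis. lborel). (\<Prod>b\<in>Basis. f b ((\<Sum>i\<in>Basis. x i *\<^sub>R i) \<bullet> b)))"
    by (subst lborel_eq) (subst integral_distr, auto)
  also have "\<dots> = (LINT x|(\<Pi>\<^sub>M b\<in>Basis. lborel). (\<Prod>b\<in>Basis. f b (x b)))"
    by (intro Bochner_Integration.integral_cong prod.cong) auto
  also have "\<dots> = (\<Prod>b\<in>Basis. (LINT x|lborel. f b x))"
    by (intro product_integral_prod int) auto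
  finally show ?thesis .
qed

text \<open>This is the characteristic function of the standard normal law, with the normalization
  sqrt(2 pi) of its density moved to the other side.\<close>

lemma fourier_gaussian_real:
  fixes t :: real
  shows "integrable lborel (\<lambda>x. cis (- (x * t)) * of_real (exp (- x\<^sup>2 / 2)))"
    and "(LINT x|lborel. cis (- (x * t)) * of_real (exp (- x\<^sup>2 / 2))) = of_real (sqrt (2 * pi) * exp (- t\<^sup>2 / 2))"
proof -
  interpret real_distribution std_normal_distribution by (rule real_dist_normal_dist)
  have eq: "iexp (- t * x) = cis (- (x * t))" for x
    by (simp add: cis_conv_exp mult_ac)
  have s: "std_normal_density x *\<^sub>R cis (- (x * t)) =
      of_real (1 / sqrt (2 * pi)) * (cis (- (x * t)) * of_real (exp (- x\<^sup>2 / 2)))" for x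
    by (simp add: std_normal_density_def scaleR_conv_of_real)
  have "integrable std_normal_distribution (\<lambda>x. cis (- (x * t)))"
    by (rule integrable_const_bound[where B=1]) auto
  then have "integrable lborel (\<lambda>x. std_normal_density x *\<^sub>R cis (- (x * t)))"
    by (subst (asm) integrable_density) (auto simp: std_normal_density_def)
  then show "integrable lborel (\<lambda>x. cis (- (x * t)) * of_real (exp (- x\<^sup>2 / 2)))"
    using integrable_mult_right[of "of_real (sqrt (2 * pi))" lborel
        "\<lambda>x. std_normal_density x *\<^sub>R cis (- (x * t))"]
    unfolding s by (simp add: mult.assoc[symmetric] flip: of_real_mult)
  have "of_real (exp (- t\<^sup>2 / 2)) = char std_normal_distribution (- t)"
    by (simp add: char_std_normal_distribution)
  also have "\<dots> = (LINT x|lborel. std_normal_density x *\<^sub>R cis (- (x * t)))"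
    unfolding char_def eq by (subst integral_density) (auto simp: std_normal_density_def)
  also have "\<dots> = of_real (1 / sqrt (2 * pi)) * (LINT x|lborel. cis (- (x * t)) * of_real (exp (- x\<^sup>2 / 2)))"
    unfolding s by simp
  finally show "(LINT x|lborel. cis (- (x * t)) * of_real (exp (- x\<^sup>2 / 2))) =
      of_real (sqrt (2 * pi) * exp (- t\<^sup>2 / 2))"
    by (simp add: field_simps)
qed

lemma norm_sq_eq_sum_Basis: "(norm x)\<^sup>2 = (\<Sum>b\<in>Basis. (x \<bullet> b)\<^sup>2)"
  using euclidean_inner[of x x] by (simp add: power2_norm_eq_inner) (simp add: power2_eq_square)

lemma fourier_gaussian_unit:
  "fourier (\<lambda>x::'a::euclidean_space. of_real (exp (- (norm x)\<^sup>2 / 2))) \<xi> =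
    of_real (sqrt (2 * pi) ^ DIM('a) * exp (- (norm \<xi>)\<^sup>2 / 2))"
proof -
  have *: "of_real (exp (- (norm x)\<^sup>2 / 2)) = (\<Prod>b\<in>Basis. of_real (exp (- (x \<bullet> b)\<^sup>2 / 2)) :: complex)"
    for x :: 'a
    by (simp add: norm_sq_eq_sum_Basis exp_sum[symmetric] sum_divide_distrib sum_negf of_real_prod[symmetric]
        del: of_real_prod)
  have c: "cis (- (x \<bullet> \<xi>)) = (\<Prod>b\<in>Basis. cis (- ((x \<bullet> b) * (\<xi> \<bullet> b))))" for x
    by (subst euclidean_inner) (simp add: cis_conv_exp exp_sum[symmetric] sum_distrib_left sum_negf)
  have "fourier (\<lambda>x. of_real (exp (- (norm x)\<^sup>2 / 2))) \<xi> =
      (LINT x::'a|lborel. (\<Prod>b\<in>Basis. cis (- ((x \<bullet> b) * (\<xi> \<bullet> b))) * of_real (exp (- (x \<bullet> b)\<^sup>2 / 2))))"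
    unfolding fourier_def * c prod.distrib ..
  also have "\<dots> = (\<Prod>b\<in>(Basis::'a set). of_real (sqrt (2 * pi) * exp (- (\<xi> \<bullet> b)\<^sup>2 / 2)))"
    unfolding lborel_integral_prod[OF fourier_gaussian_real(1)] fourier_gaussian_real(2) ..
  also have "\<dots> = of_real (sqrt (2 * pi) ^ DIM('a) * (\<Prod>b\<in>Basis. exp (- (\<xi> \<bullet> b)\<^sup>2 / 2)))"
    by (simp add: prod.distrib)
  also have "(\<Prod>b\<in>Basis. exp (- (\<xi> \<bullet> b)\<^sup>2 / 2)) = exp (- (norm \<xi>)\<^sup>2 / 2)"
    by (simp add: norm_sq_eq_sum_Basis exp_sum[symmetric] sum_divide_distrib sum_negf)
  finally show ?thesis .
qed

text \<open>The Bochner integral of a function that is not integrable is 0 by convention, whereas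
  the transform at 0 has just been computed to be sqrt(2 pi)^n, which is not 0.\<close>

lemma integrable_gaussian_unit:
  "integrable lborel (\<lambda>x::'a::euclidean_space. exp (- (norm x)\<^sup>2 / 2))"
proof (rule ccontr)
  assume "\<not> integrable lborel (\<lambda>x::'a. exp (- (norm x)\<^sup>2 / 2))"
  then have "\<not> integrable lborel (\<lambda>x::'a. complex_of_real (exp (- (norm x)\<^sup>2 / 2)))"
    unfolding complex_of_real_integrable_eq .
  then have "fourier (\<lambda>x::'a. of_real (exp (- (norm x)\<^sup>2 / 2))) 0 = 0"
    unfolding fourier_def
    by (simp only: inner_zero_right minus_zero cis_zero mult_1_left) (rule not_integrable_integral_eq)
  then show False
    unfolding fourier_gaussian_unit by simp
qed

lemma integral_gaussian_unit:
  "(LINT x::'a::euclidean_space|lborel. exp (- (norm x)\<^sup>2 / 2)) = sqrt (2 * pi) ^ DIM('a)"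
proof -
  have "complex_of_real (LINT x::'a|lborel. exp (- (norm x)\<^sup>2 / 2)) =
      fourier (\<lambda>x::'a. of_real (exp (- (norm x)\<^sup>2 / 2))) 0"
    unfolding fourier_def by (simp del: of_real_exp)
  then show ?thesis
    unfolding fourier_gaussian_unit by (simp del: of_real_power of_real_mult)
qed

text \<open>A regularizing factor: it increases to 1 as \<epsilon> tends to 0 and makes integrals
  absolutely convergent meanwhile.\<close>

definition gauss :: "real \<Rightarrow> 'a::euclidean_space \<Rightarrow> real" where
  "gauss \<epsilon> x = exp (- (norm (\<epsilon> *\<^sub>R x))\<^sup>2 / 2)"

text \<open>The Fourier transform of \<open>gauss \<epsilon>\<close> in closed form: a positive even
  kernel of width \<epsilon> whose mass is (2 pi)^n for every \<epsilon>.\<close>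

definition gauss_hat :: "real \<Rightarrow> 'a::euclidean_space \<Rightarrow> real" where
  "gauss_hat \<epsilon> y = (sqrt (2 * pi) / \<epsilon>) ^ DIM('a) * gauss (1 / \<epsilon>) y"

lemma gauss_borel_measurable [measurable]: "gauss \<epsilon> \<in> borel_measurable borel"
  unfolding gauss_def[abs_def] by measurable

lemma gauss_hat_borel_measurable [measurable]: "gauss_hat \<epsilon> \<in> borel_measurable borel"
  unfolding gauss_hat_def[abs_def] by measurable

lemma gauss_pos: "0 < gauss \<epsilon> x"
  unfolding gauss_def by simp

lemma gauss_le_1: "gauss \<epsilon> x \<le> 1"
  unfolding gauss_def by simp

lemma gauss_tendsto_1:
  assumes "e \<longlonglongrightarrow> 0"
  shows "(\<lambda>k. gauss (e k) x) \<longlonglongrightarrow> 1"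
proof -
  have "(\<lambda>k. gauss (e k) x) \<longlonglongrightarrow> exp (- (norm (0 *\<^sub>R x))\<^sup>2 / 2)"
    unfolding gauss_def by (intro tendsto_intros assms) auto
  then show ?thesis by simp
qed

lemma gauss_hat_nonneg: "0 < \<epsilon> \<Longrightarrow> 0 \<le> gauss_hat \<epsilon> y"
  unfolding gauss_hat_def using less_imp_le[OF gauss_pos] by (intro mult_nonneg_nonneg) auto

lemma gauss_hat_minus: "gauss_hat \<epsilon> (- y) = gauss_hat \<epsilon> y"
  unfolding gauss_hat_def gauss_def by simp

lemma integrable_gauss:
  assumes "0 < \<epsilon>"
  shows "integrable lborel (gauss \<epsilon> :: 'a::euclidean_space \<Rightarrow> real)"
  using lborel_integrable_affine[of "\<lambda>x::'a. exp (- (norm x)\<^sup>2 / 2)" \<epsilon> 0] assms integrable_gaussian_unit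
  unfolding gauss_def[abs_def] by simp

lemma integral_gauss:
  assumes "0 < \<epsilon>"
  shows "(LINT x::'a::euclidean_space|lborel. gauss \<epsilon> x) = (sqrt (2 * pi) / \<epsilon>) ^ DIM('a)"
  using lborel_integral_affine[of "\<lambda>x::'a. exp (- (norm x)\<^sup>2 / 2)" \<epsilon> 0] assms integral_gaussian_unit[where 'a='a]
  unfolding gauss_def[abs_def] by (simp add: field_simps)

lemma integrable_gauss_hat:
  assumes "0 < \<epsilon>"
  shows "integrable lborel (gauss_hat \<epsilon> :: 'a::euclidean_space \<Rightarrow> real)"
  unfolding gauss_hat_def[abs_def] using assms by (intro integrable_mult_right integrable_gauss) simp

lemma integral_gauss_hat:
  assumes "0 < \<epsilon>"
  shows "(LINT x::'a::euclidean_space|lborel. gauss_hat \<epsilon> x) = (2 * pi) ^ DIM('a)"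
proof -
  have "(LINT x::'a|lborel. gauss_hat \<epsilon> x) = (sqrt (2 * pi) / \<epsilon>) ^ DIM('a) * (sqrt (2 * pi) / (1 / \<epsilon>)) ^ DIM('a)"
    unfolding gauss_hat_def[abs_def] using assms
    by (subst integral_mult_right_zero, subst integral_gauss) auto
  also have "\<dots> = (sqrt (2 * pi) / \<epsilon> * (sqrt (2 * pi) / (1 / \<epsilon>))) ^ DIM('a)"
    by (rule power_mult_distrib[symmetric])
  also have "sqrt (2 * pi) / \<epsilon> * (sqrt (2 * pi) / (1 / \<epsilon>)) = 2 * pi"
    using assms by simp
  finally show ?thesis .
qed

lemma fourier_gauss:
  assumes "0 < \<epsilon>"
  shows "fourier (\<lambda>x::'a::euclidean_space. of_real (gauss \<epsilon> x)) y = of_real (gauss_hat \<epsilon> y)"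
proof -
  have "(LINT x::'a|lborel. cis (- (x \<bullet> ((1 / \<epsilon>) *\<^sub>R y))) * of_real (exp (- (norm x)\<^sup>2 / 2))) =
      \<bar>\<epsilon>\<bar> ^ DIM('a) *\<^sub>R (LINT x::'a|lborel. cis (- ((0 + \<epsilon> *\<^sub>R x) \<bullet> ((1 / \<epsilon>) *\<^sub>R y))) *
        of_real (exp (- (norm (0 + \<epsilon> *\<^sub>R x))\<^sup>2 / 2)))"
    using assms by (intro lborel_integral_affine) auto
  also have "\<dots> = of_real (\<epsilon> ^ DIM('a)) * fourier (\<lambda>x. of_real (gauss \<epsilon> x)) y"
    using assms by (simp add: fourier_def gauss_def scaleR_conv_of_real)
  finally have "of_real (\<epsilon> ^ DIM('a)) * fourier (\<lambda>x. of_real (gauss \<epsilon> x)) y =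
      of_real (sqrt (2 * pi) ^ DIM('a) * gauss (1 / \<epsilon>) y)"
    using fourier_gaussian_unit[of "(1 / \<epsilon>) *\<^sub>R y"] by (simp add: fourier_def gauss_def)
  then show ?thesis
    using assms by (simp add: gauss_hat_def field_simps power_divide)
qed

lemma gauss_hat_approximate_identity:
  fixes g :: "'a::euclidean_space \<Rightarrow> complex"
  assumes [measurable]: "g \<in> borel_measurable borel" and g: "\<And>y. norm (g y) \<le> B"
    and cont: "isCont g x" and e: "e \<longlonglongrightarrow> 0" "\<And>k. 0 < e k"
  shows "(\<lambda>k. LINT y|lborel. of_real (gauss_hat (e k) (y - x)) * g y) \<longlonglongrightarrow> of_real ((2 * pi) ^ DIM('a)) * g x"
proof -
  let ?J = "\<lambda>k. LINT z|lborel. of_real (gauss_hat 1 z) * g (x + e k *\<^sub>R z)"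
  have eq: "(LINT y|lborel. of_real (gauss_hat (e k) (y - x)) * g y) =
      ?J k" for k
  proof -
    have 1: "gauss_hat (e k) (e k *\<^sub>R z) = inverse (e k ^ DIM('a)) * gauss_hat 1 z" for z :: 'a
    proof -
      have "gauss (1 / e k) (e k *\<^sub>R z) = gauss 1 z"
        using e(2)[of k] by (simp add: gauss_def)
      moreover have "(sqrt (2 * pi) / e k) ^ DIM('a) = inverse (e k ^ DIM('a)) * sqrt (2 * pi) ^ DIM('a)"
        by (simp only: power_divide) (simp add: field_simps)
      ultimately show ?thesis by (simp only: gauss_hat_def) simp
    qed
    have "(LINT y|lborel. of_real (gauss_hat (e k) (y - x)) * g y) =
        \<bar>e k\<bar> ^ DIM('a) *\<^sub>R (LINT z|lborel. of_real (gauss_hat (e k) (x + e k *\<^sub>R z - x)) * g (x + e k *\<^sub>R z))"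
      using e(2)[of k] by (intro lborel_integral_affine) auto
    also have "\<dots> = of_real (e k ^ DIM('a)) *
        (LINT z|lborel. of_real (inverse (e k ^ DIM('a))) * (of_real (gauss_hat 1 z) * g (x + e k *\<^sub>R z)))"
      using e(2)[of k] by (simp add: scaleR_conv_of_real 1 mult.assoc)
    also have "\<dots> = ?J k"
      using e(2)[of k] by (subst integral_mult_right_zero) (simp add: mult.assoc[symmetric] flip: of_real_mult)
    finally show ?thesis .
  qed
  have "?J \<longlonglongrightarrow> (LINT z::'a|lborel. of_real (gauss_hat 1 z) * g x)"
  proof (rule integral_dominated_convergence[where w="\<lambda>z::'a. gauss_hat 1 z * B"])
    show "integrable lborel (\<lambda>z::'a. gauss_hat 1 z * B)"
      by (intro integrable_mult_left integrable_gauss_hat) simp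
    show "AE z::'a in lborel. (\<lambda>k. of_real (gauss_hat 1 z) * g (x + e k *\<^sub>R z)) \<longlonglongrightarrow> of_real (gauss_hat 1 z) * g x"
    proof (intro AE_I2 tendsto_mult tendsto_const)
      fix z :: 'a
      have "(\<lambda>k. x + e k *\<^sub>R z) \<longlonglongrightarrow> x + 0 *\<^sub>R z"
        by (intro tendsto_intros e)
      then show "(\<lambda>k. g (x + e k *\<^sub>R z)) \<longlonglongrightarrow> g x"
        using isCont_tendsto_compose[OF cont] by simp
    qed
    show "AE z in lborel. norm (of_real (gauss_hat 1 z) * g (x + e k *\<^sub>R z)) \<le> gauss_hat 1 z * B" for k
      by (intro AE_I2) (simp add: norm_mult abs_of_nonneg gauss_hat_nonneg mult_left_mono g)
  qed simp_all
  moreover have "(LINT z::'a|lborel. of_real (gauss_hat 1 z) * g x) = of_real ((2 * pi) ^ DIM('a)) * g x"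
  proof -
    have "(LINT z::'a|lborel. of_real (gauss_hat 1 z) * g x) = of_real (LINT z::'a|lborel. gauss_hat 1 z) * g x"
      by simp
    then show ?thesis by (simp only: integral_gauss_hat zero_less_one)
  qed
  ultimately show ?thesis unfolding eq by (simp only:)
qed

text \<open>Since (1 + |x|)^2 >= 1 + (x . b)^2 for each basis vector b, the weight is below a
  product of n one-variable functions 1 / (1 + x^2); hence the exponent 2 n.\<close>

lemma integrable_weight:
  "integrable lborel (\<lambda>x::'a::euclidean_space. inverse ((1 + norm x) ^ (2 * DIM('a))))"
proof -
  let ?w = "\<lambda>x::'a. inverse ((1 + norm x) ^ (2 * DIM('a)))"
  have fin: "(\<integral>\<^sup>+x. ennreal (inverse (1 + x\<^sup>2)) \<partial>lborel) < \<infinity>"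
  proof -
    have "integrable lborel (\<lambda>x::real. inverse (1 + x\<^sup>2))"
      using integrable_inverse_1_plus_square unfolding set_integrable_def by (simp add: einterval_def)
    then show ?thesis
      unfolding integrable_iff_bounded by (simp add: abs_of_nonneg)
  qed
  show ?thesis
  proof (rule integrableI_bounded)
    have "(\<integral>\<^sup>+(x::'a). ennreal (norm (?w x)) \<partial>lborel)
        \<le> (\<integral>\<^sup>+(x::'a). (\<Prod>b\<in>Basis. ennreal (inverse (1 + (x \<bullet> b)\<^sup>2))) \<partial>lborel)"
    proof (rule nn_integral_mono)
      fix x :: 'a
      have "inverse ((1 + norm x)\<^sup>2) \<le> inverse (1 + (x \<bullet> b)\<^sup>2)" if "b \<in> Basis" for b
      proof (rule le_imp_inverse_le)
        have "(x \<bullet> b)\<^sup>2 \<le> (norm x)\<^sup>2"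
          using Basis_le_norm[OF that, of x] by (metis abs_le_square_iff abs_norm_cancel)
        moreover have "0 \<le> 2 * norm x" by simp
        ultimately show "1 + (x \<bullet> b)\<^sup>2 \<le> (1 + norm x)\<^sup>2"
          by (simp add: power2_sum add_increasing2)
      qed (simp add: add_pos_nonneg)
      then have "(\<Prod>b\<in>(Basis::'a set). inverse ((1 + norm x)\<^sup>2)) \<le> (\<Prod>b\<in>Basis. inverse (1 + (x \<bullet> b)\<^sup>2))"
        by (intro prod_mono) simp
      then show "ennreal (norm (?w x)) \<le>
          (\<Prod>b\<in>Basis. ennreal (inverse (1 + (x \<bullet> b)\<^sup>2)))"
        by (subst prod_ennreal) (auto simp: power_mult power_inverse intro!: ennreal_leI)
    qed
    also have "\<dots> = (\<Prod>b\<in>(Basis::'a set). \<integral>\<^sup>+x. ennreal (inverse (1 + x\<^sup>2)) \<partial>lborel)"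
      by (rule nn_integral_lborel_prod) auto
    also have "\<dots> < \<infinity>"
      using fin by (simp add: power_less_top_ennreal)
    finally show "(\<integral>\<^sup>+(x::'a). ennreal (norm (?w x)) \<partial>lborel) < \<infinity>" .
  qed simp
qed

lemma rapid_decay_integrable:
  fixes f :: "'a::euclidean_space \<Rightarrow> complex"
  assumes "rapid_decay f" "f \<in> borel_measurable borel"
  shows "integrable lborel f"
proof -
  obtain B where B: "\<And>x. (1 + norm x) ^ (2 * DIM('a)) * norm (f x) \<le> B"
    using assms(1) unfolding rapid_decay_def by blast
  have "norm (f x) \<le> norm (B * inverse ((1 + norm x) ^ (2 * DIM('a))))" for x
  proof -
    have "0 < (1 + norm x) ^ (2 * DIM('a))" by (simp add: add_pos_nonneg)
    then have "norm (f x) \<le> B * inverse ((1 + norm x) ^ (2 * DIM('a)))"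
      using B[of x] by (simp add: field_simps)
    then show ?thesis by simp
  qed
  then show ?thesis
    using assms(2) by (intro Bochner_Integration.integrable_bound[OF integrable_mult_right[OF integrable_weight]]) auto
qed

lemma schwartz_integrable: "f \<in> schwartz \<Longrightarrow> integrable lborel f"
  by (intro rapid_decay_integrable schwartz_rapid_decay schwartz_borel)

section \<open>The Fourier transform on Schwartz functions\<close>

lemma positive_null_sequence:
  obtains e :: "nat \<Rightarrow> real" where "\<And>k. 0 < e k" "\<And>k. e k \<le> 1" "e \<longlonglongrightarrow> 0"
proof
  show "(\<lambda>k. inverse (real (Suc k))) \<longlonglongrightarrow> 0" by (rule LIMSEQ_inverse_real_of_nat)
qed (auto intro!: inverse_le_1_iff[THEN iffD2])

lemma schwartz_integrable_power:
  assumes "f \<in> schwartz"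
  shows "integrable lborel (\<lambda>x. norm x ^ k * norm (f x))"
proof -
  have [measurable]: "f \<in> borel_measurable borel" using schwartz_borel assms .
  have "rapid_decay (\<lambda>x. of_real (norm x ^ k) * f x)"
  proof (rule rapid_decay_bound[OF schwartz_rapid_decay[OF assms], where c=1 and k=k])
    show "norm (of_real (norm x ^ k) * f x) \<le> 1 * (1 + norm x) ^ k * norm (f x)" for x
      by (simp add: norm_mult norm_power mult_right_mono power_mono)
  qed simp
  then have "integrable lborel (\<lambda>x. of_real (norm x ^ k) * f x)"
    by (rule rapid_decay_integrable) measurable
  from integrable_norm[OF this] show ?thesis
    by (simp add: norm_mult norm_power)
qed

lemma schwartz_coord_factor:
  assumes "f \<in> schwartz"
  shows "(\<lambda>x. c * of_real (x \<bullet> u) * f x) \<in> schwartz"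
  using schwartz_scale[OF schwartz_coord[OF assms, of u], of c] by (simp add: mult.assoc)

lemma fourier_add:
  assumes "integrable lborel f" "integrable lborel g"
  shows "fourier (\<lambda>x. f x + g x) \<xi> = fourier f \<xi> + fourier g \<xi>"
  unfolding fourier_def distrib_left
  by (intro Bochner_Integration.integral_add integrable_cis_mult assms) auto

lemma fourier_scale: "fourier (\<lambda>x. c * f x) \<xi> = c * fourier f \<xi>"
  unfolding fourier_def by (simp only: mult.left_commute[of _ c] integral_mult_right_zero)

lemma norm_cis_Taylor: "norm (cis t - 1 - \<i> * of_real t) \<le> t\<^sup>2"
proof -
  have "norm (cis t - 1 - \<i> * of_real t) \<le> \<bar>t\<bar>\<^sup>2 / 2"
    using iexp_approx1[of t 1] by (simp add: cis_conv_exp numeral_2_eq_2 diff_diff_eq)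
  then show ?thesis using norm_ge_zero[of "cis t - 1 - \<i> * of_real t"] unfolding power2_abs by linarith
qed

text \<open>The second-order bound on \<open>cis\<close> gives the explicit remainder |h|^2 times
  the integral of |x|^2 |f|, which proves differentiability under the integral sign
  directly.\<close>

lemma fourier_has_derivative:
  fixes f :: "'a::euclidean_space \<Rightarrow> complex"
  assumes f: "f \<in> schwartz"
  shows "(fourier f has_derivative (\<lambda>u. fourier (\<lambda>x. - \<i> * of_real (x \<bullet> u) * f x) \<xi>)) (at \<xi>)"
proof (rule has_derivativeI_sandwich[where e=1])
  let ?K = "LINT x|lborel. (norm x)\<^sup>2 * norm (f x)"
  have [measurable]: "f \<in> borel_measurable borel" using schwartz_borel f .
  note int = schwartz_integrable[OF f] schwartz_integrable[OF schwartz_coord_factor[OF f]]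
  show "bounded_linear (\<lambda>u. fourier (\<lambda>x. - \<i> * of_real (x \<bullet> u) * f x) \<xi>)"
    unfolding linear_conv_bounded_linear[symmetric]
  proof (rule linearI)
    fix u v :: 'a and a :: real
    show "fourier (\<lambda>x. - \<i> * of_real (x \<bullet> (u + v)) * f x) \<xi> =
      fourier (\<lambda>x. - \<i> * of_real (x \<bullet> u) * f x) \<xi> + fourier (\<lambda>x. - \<i> * of_real (x \<bullet> v) * f x) \<xi>"
      by (subst fourier_add[symmetric, OF int(2) int(2)]) (simp add: algebra_simps)
    show "fourier (\<lambda>x. - \<i> * of_real (x \<bullet> (a *\<^sub>R u)) * f x) \<xi> =
      a *\<^sub>R fourier (\<lambda>x. - \<i> * of_real (x \<bullet> u) * f x) \<xi>"
      unfolding scaleR_conv_of_real by (subst fourier_scale[symmetric]) (simp add: mult_ac)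
  qed
  show "((\<lambda>\<zeta>. ?K * norm (\<zeta> - \<xi>)) \<longlongrightarrow> 0) (at \<xi>)"
    by (auto intro!: tendsto_eq_intros)
  fix \<zeta> :: 'a assume "\<zeta> \<noteq> \<xi>"
  define h where "h = \<zeta> - \<xi>"
  let ?d = "\<lambda>x. cis (- (x \<bullet> \<zeta>)) * f x - cis (- (x \<bullet> \<xi>)) * f x
    - cis (- (x \<bullet> \<xi>)) * (- \<i> * of_real (x \<bullet> h) * f x)"
  have cis_int: "integrable lborel (\<lambda>x. cis (- (x \<bullet> \<omega>)) * g x)" if "integrable lborel g" for g \<omega>
    by (intro integrable_cis_mult that) measurable
  have "fourier f \<zeta> - fourier f \<xi> - fourier (\<lambda>x. - \<i> * of_real (x \<bullet> h) * f x) \<xi> = (LINT x|lborel. ?d x)"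
    unfolding fourier_def
    by (simp only: Bochner_Integration.integral_diff Bochner_Integration.integrable_diff cis_int int)
  also have "norm \<dots> \<le> (LINT x|lborel. (norm h)\<^sup>2 * ((norm x)\<^sup>2 * norm (f x)))"
  proof (rule Bochner_Integration.integral_norm_bound_integral)
    show "integrable lborel ?d"
      by (intro Bochner_Integration.integrable_diff cis_int int)
    show "integrable lborel (\<lambda>x. (norm h)\<^sup>2 * ((norm x)\<^sup>2 * norm (f x)))"
      by (intro integrable_mult_right schwartz_integrable_power f)
    fix x
    have z: "cis (- (x \<bullet> \<zeta>)) = cis (- (x \<bullet> \<xi>)) * cis (- (x \<bullet> h))"
      by (simp add: cis_mult h_def inner_diff_right)
    have "?d x = cis (- (x \<bullet> \<xi>)) * (cis (- (x \<bullet> h)) - 1 - \<i> * of_real (- (x \<bullet> h))) * f x"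
      unfolding z by (simp add: algebra_simps)
    also have "norm \<dots> \<le> (- (x \<bullet> h))\<^sup>2 * norm (f x)"
      using norm_cis_Taylor[of "- (x \<bullet> h)"] by (simp add: norm_mult mult_right_mono)
    also have "\<dots> \<le> (norm x * norm h)\<^sup>2 * norm (f x)"
      using Cauchy_Schwarz_ineq2[of x h]
      by (intro mult_right_mono) (auto simp: abs_le_square_iff[symmetric])
    finally show "norm (?d x) \<le> (norm h)\<^sup>2 * ((norm x)\<^sup>2 * norm (f x))"
      by (simp add: power_mult_distrib mult_ac)
  qed
  also have "\<dots> = ?K * norm h * norm h"
    by (simp add: power2_eq_square)
  finally show "norm (fourier f \<zeta> - fourier f \<xi> - fourier (\<lambda>x. - \<i> * of_real (x \<bullet> (\<zeta> - \<xi>)) * f x) \<xi>)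
      / norm (\<zeta> - \<xi>) \<le> ?K * norm (\<zeta> - \<xi>)"
    using \<open>\<zeta> \<noteq> \<xi>\<close> unfolding h_def by (simp add: divide_le_eq)
qed auto

lemma fourier_translate:
  assumes "f \<in> borel_measurable borel"
  shows "fourier (\<lambda>x. f (x + v)) \<xi> = cis (v \<bullet> \<xi>) * fourier f \<xi>"
proof -
  note [measurable] = assms
  have "fourier f \<xi> = (LINT x|lborel. cis (- ((v + 1 *\<^sub>R x) \<bullet> \<xi>)) * f (v + 1 *\<^sub>R x))"
    unfolding fourier_def by (subst lborel_integral_affine[of _ 1 v]) auto
  also have "\<dots> = (LINT x|lborel. cis (- (v \<bullet> \<xi>)) * (cis (- (x \<bullet> \<xi>)) * f (x + v)))"
    by (simp add: inner_add_left cis_mult add.commute flip: mult.assoc)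
  also have "\<dots> = cis (- (v \<bullet> \<xi>)) * fourier (\<lambda>x. f (x + v)) \<xi>"
    by (simp only: integral_mult_right_zero fourier_def)
  finally show ?thesis
    by (simp add: cis_mult flip: mult.assoc)
qed

text \<open>Translation invariance of the integral, applied to difference quotients, replaces integration
  by parts.\<close>

lemma fourier_partial:
  fixes f :: "'a::euclidean_space \<Rightarrow> complex"
  assumes f: "f \<in> schwartz" and u: "u \<in> Basis"
  shows "fourier (partials [u] f) \<xi> = \<i> * of_real (\<xi> \<bullet> u) * fourier f \<xi>"
proof -
  let ?d = "2 * DIM('a)"
  define f' where "f' = partials [u] f"
  have f': "f' \<in> schwartz"
    unfolding f'_def using f u by (intro schwartz_partials) auto
  have [measurable]: "f \<in> borel_measurable borel" "f' \<in> borel_measurable borel"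
    using schwartz_borel f f' by auto
  obtain e :: "nat \<Rightarrow> real" where e: "\<And>k. 0 < e k" "\<And>k. e k \<le> 1" and e0: "e \<longlonglongrightarrow> 0"
    using positive_null_sequence by metis
  then have e_at: "filterlim e (at 0) sequentially"
    using e(1) by (intro filterlim_atI) (auto simp: less_imp_neq[symmetric])
  define D where "D k x = (f (x + e k *\<^sub>R u) - f x) / of_real (e k)" for k x
  have line: "((\<lambda>t. f (x + t *\<^sub>R u)) has_derivative (\<lambda>t. t *\<^sub>R f' (x + s *\<^sub>R u))) (at s)" for x s
  proof -
    have "((\<lambda>t. x + t *\<^sub>R u) has_derivative (\<lambda>t. t *\<^sub>R u)) (at s)"
      by (auto intro!: derivative_eq_intros)
    from has_derivative_compose[OF this schwartz_has_derivative[OF f]]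
    have "((\<lambda>t. f (x + t *\<^sub>R u)) has_derivative (\<lambda>t. partials [t *\<^sub>R u] f (x + s *\<^sub>R u))) (at s)" .
    moreover have "partials [t *\<^sub>R u] f y = t *\<^sub>R f' y" for t y
      unfolding f'_def
      using linear_scale[OF has_derivative_linear[OF schwartz_has_derivative[OF f]], of t u] by simp
    ultimately show ?thesis by simp
  qed
  obtain B where B: "\<And>x. (1 + norm x) ^ ?d * norm (f' x) \<le> B"
    using schwartz_rapid_decay[OF f'] unfolding rapid_decay_def by blast
  \<comment> \<open>A majorant for all difference quotients at once. The mean value theorem
    evaluates f' at x + s u with 0 < s < 1, where 1 + |x| <= 2 (1 + |x + s u|); this is the factor
    2^(2 n).\<close>
  let ?w = "\<lambda>x::'a. 2 ^ ?d * B * inverse ((1 + norm x) ^ ?d)"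
  have bound: "norm (D k x) \<le> ?w x" for k x
  proof -
    have "\<exists>s\<in>{0<..<e k}. norm (f (x + e k *\<^sub>R u) - f (x + 0 *\<^sub>R u)) \<le> norm ((e k - 0) *\<^sub>R f' (x + s *\<^sub>R u))"
    proof (rule mvt_general)
      show "continuous_on {0..e k} (\<lambda>t. f (x + t *\<^sub>R u))"
        by (intro continuous_at_imp_continuous_on ballI has_derivative_continuous[OF line])
    qed (use e line in auto)
    then obtain s where s: "0 < s" "s < e k" and "norm (f (x + e k *\<^sub>R u) - f x) \<le> e k * norm (f' (x + s *\<^sub>R u))"
      using e(1)[of k] by auto
    then have "norm (D k x) \<le> norm (f' (x + s *\<^sub>R u))"
      using e(1)[of k] by (simp add: D_def norm_divide divide_le_eq mult.commute)
    let ?y = "x + s *\<^sub>R u"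
    have "(1 + norm x) ^ ?d * norm (f' (?y)) \<le> 2 ^ ?d * B"
    proof -
      have "norm (s *\<^sub>R u) \<le> 1"
        using s e(2)[of k] u by simp
      then have "1 + norm x \<le> 2 * (1 + norm (?y))"
        using norm_triangle_ineq4[of "?y" "s *\<^sub>R u", unfolded add_diff_cancel_right']
          norm_ge_zero[of "?y"] by argo
      then have "(1 + norm x) ^ ?d \<le> (2 * (1 + norm (?y))) ^ ?d"
        by (intro power_mono) auto
      then have "(1 + norm x) ^ ?d * norm (f' (?y))
          \<le> (2 * (1 + norm (?y))) ^ ?d * norm (f' (?y))"
        by (intro mult_right_mono) auto
      also have "\<dots> = 2 ^ ?d * ((1 + norm (?y)) ^ ?d * norm (f' (?y)))"
        by (simp only: power_mult_distrib mult.assoc)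
      also have "\<dots> \<le> 2 ^ ?d * B"
        using B by (intro mult_left_mono) auto
      finally show ?thesis .
    qed
    moreover have "0 < (1 + norm x) ^ ?d" by (simp add: add_pos_nonneg)
    ultimately have "norm (f' (?y)) \<le> ?w x"
      by (simp only: divide_inverse[symmetric] pos_le_divide_eq) (simp only: mult.commute)
    with \<open>norm (D k x) \<le> _\<close> show ?thesis by simp
  qed
  have lim: "(\<lambda>k. D k x) \<longlonglongrightarrow> f' x" for x
  proof -
    have "((\<lambda>t. norm (f (x + t *\<^sub>R u) - f x - t *\<^sub>R f' x) / norm t) \<longlongrightarrow> 0) (at 0)"
      using line[of x 0] by (simp add: has_derivative_at)
    from filterlim_compose[OF this e_at]
    have "(\<lambda>k. norm (f (x + e k *\<^sub>R u) - f x - e k *\<^sub>R f' x) / norm (e k)) \<longlonglongrightarrow> 0" .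
    moreover have "norm (f (x + e k *\<^sub>R u) - f x - e k *\<^sub>R f' x) / norm (e k) = norm (D k x - f' x)" for k
    proof -
      have "D k x - f' x = (f (x + e k *\<^sub>R u) - f x - e k *\<^sub>R f' x) / of_real (e k)"
        using e(1)[of k] by (simp add: D_def field_simps scaleR_conv_of_real)
      then show ?thesis by (simp add: norm_divide)
    qed
    ultimately show ?thesis
      by (simp add: tendsto_norm_zero_iff LIM_zero_iff)
  qed
  \<comment> \<open>The transform turns translation by e_k u into multiplication by a phase, so the
    difference quotient becomes multiplication by \<open>?q k\<close>, which tends to \<i> (u .
    \<xi>).\<close>
  let ?q = "\<lambda>k. (cis (e k * (u \<bullet> \<xi>)) - 1) / of_real (e k)"
  have "(\<lambda>k. fourier (D k) \<xi>) \<longlonglongrightarrow> fourier f' \<xi>"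
    unfolding fourier_def
  proof (rule integral_dominated_convergence[where w="?w"])
    show "integrable lborel ?w"
      by (intro integrable_mult_right integrable_weight)
    show "(\<lambda>x. cis (- (x \<bullet> \<xi>)) * D k x) \<in> borel_measurable lborel" for k
      unfolding D_def by simp
  qed (use bound in \<open>auto simp: norm_mult intro!: tendsto_mult lim\<close>)
  moreover have "fourier (D k) \<xi> = ?q k * fourier f \<xi>" for k
  proof -
    have "integrable lborel (\<lambda>x. f (x + e k *\<^sub>R u))"
      using lborel_integrable_affine[of f 1 "e k *\<^sub>R u"] schwartz_integrable[OF f] by (simp add: add.commute)
    moreover have "D k = (\<lambda>x. inverse (of_real (e k)) * (f (x + e k *\<^sub>R u) + (-1) * f x))"
      by (auto simp: D_def divide_inverse)
    ultimately show ?thesis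
      using schwartz_integrable[OF f]
      by (simp only: fourier_scale fourier_add integrable_mult_right
          fourier_translate[OF schwartz_borel[OF f]])
        (simp add: divide_inverse algebra_simps)
  qed
  moreover have "(\<lambda>k. ?q k * fourier f \<xi>) \<longlonglongrightarrow> \<i> * of_real (u \<bullet> \<xi>) * fourier f \<xi>"
  proof (intro tendsto_mult tendsto_const)
    have "norm (?q k - \<i> * of_real (u \<bullet> \<xi>)) \<le> e k * (u \<bullet> \<xi>)\<^sup>2" for k
    proof -
      have "?q k - \<i> * of_real (u \<bullet> \<xi>) =
          (cis (e k * (u \<bullet> \<xi>)) - 1 - \<i> * of_real (e k * (u \<bullet> \<xi>))) / of_real (e k)"
        using e(1)[of k] by (simp add: field_simps)
      then show ?thesis
        using norm_cis_Taylor[of "e k * (u \<bullet> \<xi>)"] e(1)[of k]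
        by (simp add: norm_divide field_simps power2_eq_square)
    qed
    moreover have "(\<lambda>k. e k * (u \<bullet> \<xi>)\<^sup>2) \<longlonglongrightarrow> 0"
      using tendsto_mult_left_zero[OF e0] .
    ultimately have "(\<lambda>k. ?q k - \<i> * of_real (u \<bullet> \<xi>)) \<longlonglongrightarrow> 0"
      by (rule Lim_null_comparison[OF always_eventually[OF allI]])
    then show "(\<lambda>k. ?q k) \<longlonglongrightarrow> \<i> * of_real (u \<bullet> \<xi>)"
      by (simp add: LIM_zero_iff)
  qed
  ultimately have "fourier f' \<xi> = \<i> * of_real (u \<bullet> \<xi>) * fourier f \<xi>"
    using LIMSEQ_unique by auto
  then show ?thesis by (simp add: f'_def inner_commute)
qed

text \<open>The set of all transforms is invariant under partials because differentiating a
  transform multiplies the original function by a coordinate, which preserves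
  \<open>schwartz\<close>.\<close>

lemma fourier_schwartz:
  fixes f :: "'a::euclidean_space \<Rightarrow> complex"
  assumes "f \<in> schwartz"
  shows "fourier f \<in> schwartz"
proof (rule schwartz_coinduct)
  let ?X = "fourier ` (schwartz :: ('a \<Rightarrow> complex) set)"
  show "fourier f \<in> ?X" using assms by blast
  show "F differentiable at \<xi>" if "F \<in> ?X" for F \<xi>
    using that fourier_has_derivative differentiableI by blast
  show "partials [u] F \<in> ?X" if F: "F \<in> ?X" and "u \<in> Basis" for F u
  proof -
    obtain f where f: "f \<in> schwartz" "F = fourier f" using F by blast
    then have "partials [u] F = fourier (\<lambda>x. - \<i> * of_real (x \<bullet> u) * f x)"
      using partials_single_eq[OF fourier_has_derivative] by blast
    then show ?thesis using schwartz_coord_factor[OF f(1)] by blast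
  qed
  show "rapid_decay F" if F: "F \<in> ?X" for F
  proof -
    \<comment> \<open>One more power of 1 + |\<xi>| costs at most 1 + sum_b |\<xi> . b|, and each
      coordinate is traded for a partial of f. The induction therefore has to speak about all
      Schwartz functions simultaneously.\<close>
    have "\<forall>f\<in>schwartz. \<exists>B. \<forall>\<xi>::'a. (1 + norm \<xi>) ^ N * norm (fourier f \<xi>) \<le> B" for N
    proof (induction N)
      case 0
      then show ?case using norm_fourier_le by auto
    next
      case (Suc N)
      show ?case
      proof
        fix f :: "'a \<Rightarrow> complex" assume f: "f \<in> schwartz"
        obtain B where B: "\<And>\<xi>. (1 + norm \<xi>) ^ N * norm (fourier f \<xi>) \<le> B"
          using Suc f by blast
        have "\<forall>b\<in>Basis. \<exists>C. \<forall>\<xi>. (1 + norm \<xi>) ^ N * norm (fourier (partials [b] f) \<xi>) \<le> C"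
          using Suc schwartz_partials[OF f] by (auto simp del: partials.simps)
        then obtain C where C: "\<And>b \<xi>. b \<in> Basis \<Longrightarrow>
            (1 + norm \<xi>) ^ N * norm (fourier (partials [b] f) \<xi>) \<le> C b"
          by metis
        have "(1 + norm \<xi>) ^ Suc N * norm (fourier f \<xi>) \<le> B + sum C Basis" for \<xi> :: 'a
        proof -
          let ?w = "(1 + norm \<xi>) ^ N"
          have "(1 + norm \<xi>) * norm (fourier f \<xi>) \<le>
              norm (fourier f \<xi>) + (\<Sum>b\<in>Basis. \<bar>\<xi> \<bullet> b\<bar>) * norm (fourier f \<xi>)"
            using norm_le_l1[of \<xi>] by (simp add: distrib_right mult_right_mono)
          also have "\<dots> = norm (fourier f \<xi>) + (\<Sum>b\<in>Basis. norm (fourier (partials [b] f) \<xi>))"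
            by (simp add: sum_distrib_right fourier_partial[OF f] norm_mult del: partials.simps)
          finally have "?w * ((1 + norm \<xi>) * norm (fourier f \<xi>)) \<le>
              ?w * (norm (fourier f \<xi>) + (\<Sum>b\<in>Basis. norm (fourier (partials [b] f) \<xi>)))"
            by (intro mult_left_mono) auto
          also have "\<dots> = ?w * norm (fourier f \<xi>) + (\<Sum>b\<in>Basis. ?w * norm (fourier (partials [b] f) \<xi>))"
            by (simp only: distrib_left sum_distrib_left)
          also have "\<dots> \<le> B + sum C Basis"
            using B C by (intro add_mono sum_mono) auto
          finally show ?thesis by (simp add: mult_ac)
        qed
        then show "\<exists>B. \<forall>\<xi>. (1 + norm \<xi>) ^ Suc N * norm (fourier f \<xi>) \<le> B" by blast
      qed
    qed
    then show ?thesis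
      using F unfolding rapid_decay_def by blast
  qed
qed

text \<open>With a factor \<open>gauss (e k)\<close> inserted, the multiplication formula turns the
  inversion integral into the pairing of f with an approximate identity centred at x. Both sides are
  then passed to the limit.\<close>

lemma fourier_inversion:
  fixes f :: "'a::euclidean_space \<Rightarrow> complex"
  assumes f: "f \<in> schwartz"
  shows "inv_fourier (fourier f) x = f x"
proof -
  obtain e :: "nat \<Rightarrow> real" where e: "\<And>k. 0 < e k" and e0: "e \<longlonglongrightarrow> 0"
    using positive_null_sequence by metis
  have [measurable]: "f \<in> borel_measurable borel" using schwartz_borel f .
  have "(\<lambda>k. LINT \<xi>|lborel. fourier f \<xi> * (cis (x \<bullet> \<xi>) * of_real (gauss (e k) \<xi>)))
      \<longlonglongrightarrow> (LINT \<xi>|lborel. fourier f \<xi> * (cis (x \<bullet> \<xi>) * 1))"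
  proof (rule integral_dominated_convergence[where w="\<lambda>\<xi>. norm (fourier f \<xi>)"])
    show "integrable lborel (\<lambda>\<xi>. norm (fourier f \<xi>))"
      by (intro integrable_norm schwartz_integrable fourier_schwartz f)
    have "(\<lambda>k. complex_of_real (gauss (e k) \<xi>)) \<longlonglongrightarrow> of_real 1" for \<xi> :: 'a
      by (intro tendsto_of_real gauss_tendsto_1 e0)
    then show "AE \<xi> in lborel. (\<lambda>k. fourier f \<xi> * (cis (x \<bullet> \<xi>) * of_real (gauss (e k) \<xi>)))
        \<longlonglongrightarrow> fourier f \<xi> * (cis (x \<bullet> \<xi>) * 1)"
      by (intro AE_I2 tendsto_mult tendsto_const) simp
    show "AE \<xi> in lborel. norm (fourier f \<xi> * (cis (x \<bullet> \<xi>) * of_real (gauss (e k) \<xi>))) \<le> norm (fourier f \<xi>)" for k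
      by (intro AE_I2) (simp add: norm_mult abs_of_pos gauss_pos gauss_le_1 mult_left_le)
  qed simp_all
  moreover have "(LINT \<xi>|lborel. fourier f \<xi> * (cis (x \<bullet> \<xi>) * of_real (gauss (e k) \<xi>))) =
      (LINT y|lborel. of_real (gauss_hat (e k) (y - x)) * f y)" for k
  proof -
    have "complex_integrable lborel (\<lambda>\<xi>::'a. of_real (gauss (e k) \<xi>))"
      using integrable_gauss[OF e] by (subst complex_of_real_integrable_eq)
    then have "(LINT \<xi>|lborel. fourier f \<xi> * (cis (x \<bullet> \<xi>) * of_real (gauss (e k) \<xi>))) =
      (LINT y|lborel. f y * fourier (\<lambda>\<xi>. cis (x \<bullet> \<xi>) * of_real (gauss (e k) \<xi>)) y)"
      by (intro fourier_multiplication schwartz_integrable[OF f] integrable_cis_mult) auto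
    moreover have "fourier (\<lambda>\<xi>. cis (x \<bullet> \<xi>) * of_real (gauss (e k) \<xi>)) y = of_real (gauss_hat (e k) (y - x))" for y
      unfolding fourier_gauss[OF e, symmetric] fourier_def
      by (simp add: cis_mult inner_diff_right inner_commute flip: mult.assoc)
    ultimately show ?thesis by (simp add: mult.commute)
  qed
  moreover have "(\<lambda>k. LINT y|lborel. of_real (gauss_hat (e k) (y - x)) * f y)
      \<longlonglongrightarrow> of_real ((2 * pi) ^ DIM('a)) * f x"
  proof -
    obtain B where "\<And>y. (1 + norm y) ^ 0 * norm (f y) \<le> B"
      using schwartz_rapid_decay[OF f] unfolding rapid_decay_def by blast
    then have "norm (f y) \<le> B" for y by simp
    moreover have "isCont f x"
      using schwartz_continuous[OF f, of UNIV] by (simp add: continuous_on_eq_continuous_at)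
    ultimately show ?thesis
      using e e0 by (intro gauss_hat_approximate_identity) auto
  qed
  ultimately have "(LINT \<xi>|lborel. fourier f \<xi> * (cis (x \<bullet> \<xi>) * 1)) = of_real ((2 * pi) ^ DIM('a)) * f x"
    using LIMSEQ_unique by auto
  then show ?thesis
    unfolding inv_fourier_def by (simp add: mult.commute)
qed

lemma inv_fourier_eq_fourier:
  fixes f :: "'a::euclidean_space \<Rightarrow> complex"
  shows "inv_fourier f x = of_real (1 / (2 * pi) ^ DIM('a)) * fourier f (- x)"
  unfolding inv_fourier_def fourier_def by (simp add: inner_commute)

lemma fourier_inv_fourier:
  fixes f :: "'a::euclidean_space \<Rightarrow> complex"
  assumes f: "f \<in> schwartz"
  shows "fourier (inv_fourier f) x = f x"
proof -
  let ?c = "of_real (1 / (2 * pi) ^ DIM('a)) :: complex"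
  have [measurable]: "f \<in> borel_measurable borel" using schwartz_borel f .
  have "fourier (inv_fourier f) x = ?c * fourier (\<lambda>y. fourier f (- y)) x"
    unfolding inv_fourier_eq_fourier[abs_def] by (rule fourier_scale)
  also have "fourier (\<lambda>y. fourier f (- y)) x = (LINT \<xi>|lborel. cis (x \<bullet> \<xi>) * fourier f \<xi>)"
    unfolding fourier_def[of "\<lambda>y. fourier f (- y)"]
    by (subst lborel_integral_affine[of _ "-1" 0]) (auto simp: inner_commute)
  also have "?c * \<dots> = inv_fourier (fourier f) x"
    unfolding inv_fourier_def ..
  finally show ?thesis using fourier_inversion[OF f] by simp
qed

text \<open>Applying the transform twice is reflection up to (2 pi)^n, so the inverse transform is a
  constant times the threefold transform and inherits closure from \<open>fourier\<close>.\<close>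

lemma inv_fourier_schwartz:
  fixes f :: "'a::euclidean_space \<Rightarrow> complex"
  assumes f: "f \<in> schwartz"
  shows "inv_fourier f \<in> schwartz"
proof -
  let ?c = "of_real (1 / (2 * pi) ^ DIM('a)) :: complex"
  have ff: "fourier (fourier g) x = of_real ((2 * pi) ^ DIM('a)) * g (- x)" if "g \<in> schwartz" for g :: "'a \<Rightarrow> complex" and x
    using fourier_inversion[OF that, of "- x"] by (simp add: inv_fourier_eq_fourier field_simps)
  have "inv_fourier f = (\<lambda>x. (?c * ?c) * fourier (fourier (fourier f)) x)"
    unfolding ff[OF fourier_schwartz[OF f]] inv_fourier_eq_fourier[abs_def] by simp
  then show ?thesis
    using schwartz_scale[of "fourier (fourier (fourier f))" "?c * ?c"] f
    by (simp only: fourier_schwartz)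
qed

section \<open>The Fourier transform of square-integrable functions\<close>

text \<open>The squared norm is kept as an extended nonnegative integral, so that monotonicity and
  Fatou apply before finiteness is known and no root is taken.\<close>

definition L2_sq :: "('a::euclidean_space \<Rightarrow> complex) \<Rightarrow> ennreal" where
  "L2_sq f = (\<integral>\<^sup>+x. ennreal ((norm (f x))\<^sup>2) \<partial>lborel)"

lemma norm_integral_le_nn_integral:
  fixes f :: "'a \<Rightarrow> 'b::{banach, second_countable_topology}"
  shows "ennreal (norm (integral\<^sup>L M f)) \<le> (\<integral>\<^sup>+x. norm (f x) \<partial>M)"
  using integral_norm_bound_ennreal[of M f] by (cases "integrable M f") (auto simp: not_integrable_integral_eq)

text \<open>Weighted AM-GM, from the square of c a - b. With weight 2^k it takes the place of
  Cauchy-Schwarz in the limit arguments: squared errors of size 4^(-k) are turned into errors of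
  size 2^(-k).\<close>

lemma mult_le_weighted_squares:
  fixes a b c :: real
  assumes "0 < c"
  shows "a * b \<le> c * a\<^sup>2 / 2 + b\<^sup>2 / (2 * c)"
proof -
  have "0 \<le> (c * a - b)\<^sup>2 / (2 * c)" using assms by simp
  also have "\<dots> = c * a\<^sup>2 / 2 + b\<^sup>2 / (2 * c) - a * b"
    using assms by (simp add: field_simps power2_eq_square)
  finally show ?thesis by simp
qed

lemma integrable_mult_L2:
  assumes [measurable]: "f \<in> borel_measurable borel" "g \<in> borel_measurable borel"
    and "L2_sq f < \<infinity>" "L2_sq g < \<infinity>"
  shows "integrable lborel (\<lambda>x. f x * g x)"
proof (rule integrableI_bounded)
  have "(\<integral>\<^sup>+x. ennreal (norm (f x * g x)) \<partial>lborel) \<le>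
      (\<integral>\<^sup>+x. ennreal ((norm (f x))\<^sup>2) + ennreal ((norm (g x))\<^sup>2) \<partial>lborel)"
  proof (rule nn_integral_mono)
    fix x
    have "norm (f x * g x) \<le> (norm (f x))\<^sup>2 + (norm (g x))\<^sup>2"
      using mult_le_weighted_squares[of 1 "norm (f x)" "norm (g x)"]
        zero_le_power2[of "norm (f x)"] zero_le_power2[of "norm (g x)"]
      unfolding norm_mult by linarith
    then show "ennreal (norm (f x * g x)) \<le> ennreal ((norm (f x))\<^sup>2) + ennreal ((norm (g x))\<^sup>2)"
      by (simp flip: ennreal_plus)
  qed
  also have "\<dots> = L2_sq f + L2_sq g"
    unfolding L2_sq_def by (rule nn_integral_add) auto
  also have "\<dots> < \<infinity>" using assms by simp
  finally show "(\<integral>\<^sup>+x. ennreal (norm (f x * g x)) \<partial>lborel) < \<infinity>" .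
qed simp

lemma schwartz_L2:
  assumes f: "f \<in> schwartz"
  shows "L2_sq f < \<infinity>"
proof -
  obtain B where "\<And>y. (1 + norm y) ^ 0 * norm (f y) \<le> B"
    using schwartz_rapid_decay[OF f] unfolding rapid_decay_def by blast
  then have "(norm (f y))\<^sup>2 \<le> norm (of_real B * f y)" for y
    by (simp add: norm_mult power2_eq_square) (meson abs_ge_self mult_right_mono norm_ge_zero order_trans)
  then have "L2_sq f \<le> (\<integral>\<^sup>+x. ennreal (norm (of_real B * f x)) \<partial>lborel)"
    unfolding L2_sq_def by (intro nn_integral_mono ennreal_leI)
  also have "\<dots> < \<infinity>"
    using schwartz_integrable[OF schwartz_scale[OF f]] unfolding integrable_iff_bounded by blast
  finally show ?thesis .
qed

lemma nn_integral_gauss_hat: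
  fixes y :: "'a::euclidean_space"
  assumes "0 < \<epsilon>"
  shows "(\<integral>\<^sup>+x. ennreal (gauss_hat \<epsilon> (x - y)) \<partial>lborel) = ennreal ((2 * pi) ^ DIM('a))"
proof -
  have int: "integrable lborel (\<lambda>x. gauss_hat \<epsilon> (x - y))"
    using lborel_integrable_affine[of "gauss_hat \<epsilon> :: 'a \<Rightarrow> real" 1 "- y"] integrable_gauss_hat[OF assms]
    by (simp add: add.commute)
  have "(LINT x|lborel. gauss_hat \<epsilon> (x - y)) = (2 * pi) ^ DIM('a)"
    using lborel_integral_affine[of "gauss_hat \<epsilon> :: 'a \<Rightarrow> real" 1 "- y"] integral_gauss_hat[OF assms, where 'a='a]
    by (simp add: add.commute)
  then show ?thesis
    using nn_integral_eq_integral[OF int AE_I2[OF gauss_hat_nonneg[OF assms]]] by simp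
qed

lemma gauss_hat_le:
  fixes y :: "'a::euclidean_space"
  assumes "0 < \<epsilon>"
  shows "gauss_hat \<epsilon> y \<le> (sqrt (2 * pi) / \<epsilon>) ^ DIM('a)"
  unfolding gauss_hat_def using assms
  by (intro mult_left_le gauss_le_1 zero_le_power) auto

lemma borel_measurable_cnj [measurable]: "cnj \<in> borel_measurable borel"
  by (intro borel_measurable_continuous_onI continuous_intros)

text \<open>A Gaussian factor makes all integrals absolutely convergent and turns the left-hand side into
  a quadratic form in \<open>f\<close> with a positive kernel of mass \<open>(2\<pi>)\<^sup>n\<close>, which AM-GM controls. Only
  this half of Plancherel's identity is needed.\<close>

lemma Plancherel_le:
  fixes f :: "'a::euclidean_space \<Rightarrow> complex"
  assumes f: "integrable lborel f" 
  shows "L2_sq (fourier f) \<le> ennreal ((2 * pi) ^ DIM('a)) * L2_sq f"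
proof -
  let ?F = "fourier f" and ?C = "ennreal ((2 * pi) ^ DIM('a))"
  let ?q = "\<lambda>\<epsilon> \<xi>. (norm (?F \<xi>))\<^sup>2 * gauss \<epsilon> \<xi>"
  have fm [measurable]: "f \<in> borel_measurable borel" using f by auto
  obtain M where M: "\<And>\<xi>. norm (?F \<xi>) \<le> M" using norm_fourier_le by blast
  have bound: "(\<integral>\<^sup>+\<xi>. ennreal (?q \<epsilon> \<xi>) \<partial>lborel) \<le> ?C * L2_sq f" if e: "0 < \<epsilon>" for \<epsilon>
  proof -
    \<comment> \<open>Chosen so that F w = |F|^2 times the Gaussian. As cnj F is itself an
      oscillatory integral of cnj f, the transform of \<open>w\<close> is the convolution of
      \<open>gauss_hat \<epsilon>\<close> with cnj f.\<close>
    define w where "w \<xi> = of_real (gauss \<epsilon> \<xi>) * cnj (?F \<xi>)" for \<xi>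
    have cnj_F: "cnj (?F \<xi>) = (LINT y|lborel. cis (\<xi> \<bullet> y) * cnj (f y))" for \<xi>
      unfolding fourier_def by (subst Bochner_Integration.integral_cnj[symmetric]) (simp add: cis_cnj inner_commute)
    have gint: "complex_integrable lborel (\<lambda>\<xi>::'a. of_real (gauss \<epsilon> \<xi>))"
      using integrable_gauss[OF e] by (subst complex_of_real_integrable_eq)
    have [measurable]: "w \<in> borel_measurable borel"
      unfolding w_def[abs_def] by measurable
    have wint: "integrable lborel w"
    proof (rule Bochner_Integration.integrable_bound[OF integrable_mult_left[OF gint, of "of_real M"]])
      show "AE \<xi> in lborel. norm (w \<xi>) \<le> norm (of_real (gauss \<epsilon> \<xi>) * complex_of_real M)"
        by (intro AE_I2) (auto simp: w_def norm_mult intro!: mult_left_mono intro: order_trans[OF M abs_ge_self])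
    qed simp
    let ?k = "\<lambda>x y. of_real (gauss_hat \<epsilon> (x - y)) * cnj (f y)"
    have w_hat: "fourier w x = (LINT y|lborel. ?k x y)" for x
    proof -
      have "fourier w x = (LINT \<xi>|lborel. (cis (- (\<xi> \<bullet> x)) * of_real (gauss \<epsilon> \<xi>)) *
          (LINT y|lborel. cis (\<xi> \<bullet> y) * cnj (f y)))"
        unfolding fourier_def w_def cnj_F[symmetric] by (simp add: mult.assoc)
      also have "\<dots> = (LINT y|lborel. (LINT \<xi>|lborel. (cis (- (\<xi> \<bullet> x)) * of_real (gauss \<epsilon> \<xi>)) * cis (\<xi> \<bullet> y)) * cnj (f y))"
      proof (rule bounded_kernel_Fubini[where c=1])
        show "integrable lborel (\<lambda>y. cnj (f y))" using f by simp
        show "integrable lborel (\<lambda>\<xi>. cis (- (\<xi> \<bullet> x)) * of_real (gauss \<epsilon> \<xi>))"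
          by (intro integrable_cis_mult gint) auto
      qed auto
      moreover have "(LINT \<xi>|lborel. (cis (- (\<xi> \<bullet> x)) * of_real (gauss \<epsilon> \<xi>)) * cis (\<xi> \<bullet> y)) = of_real (gauss_hat \<epsilon> (x - y))" for y
        unfolding fourier_gauss[OF e, symmetric] fourier_def
        by (intro Bochner_Integration.integral_cong refl) (simp add: cis_mult inner_diff_right mult_ac)
      ultimately show ?thesis by simp
    qed
    have Fw: "?F \<xi> * w \<xi> = of_real (?q \<epsilon> \<xi>)" for \<xi>
      by (simp only: w_def of_real_mult complex_norm_square mult_ac)
    have int: "integrable lborel (\<lambda>\<xi>. ?q \<epsilon> \<xi>)"
    proof (rule Bochner_Integration.integrable_bound[OF integrable_mult_right[OF integrable_gauss[OF e], of "M\<^sup>2"]])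
      show "AE \<xi> in lborel. norm (?q \<epsilon> \<xi>) \<le> norm (M\<^sup>2 * gauss \<epsilon> \<xi>)"
        using M by (intro AE_I2) (simp add: abs_mult mult_right_mono power_mono)
    qed simp
    have eq: "(\<integral>\<^sup>+\<xi>. ennreal (?q \<epsilon> \<xi>) \<partial>lborel) =
        ennreal (norm (LINT x|lborel. f x * fourier w x))"
    proof -
      have "0 \<le> (LINT \<xi>|lborel. ?q \<epsilon> \<xi>)"
        by (intro integral_nonneg_AE AE_I2) (simp add: less_imp_le[OF gauss_pos])
      moreover have "(LINT x|lborel. f x * fourier w x) = of_real (LINT \<xi>|lborel. ?q \<epsilon> \<xi>)"
        unfolding fourier_multiplication[OF f wint, symmetric] Fw by (rule integral_complex_of_real)
      ultimately show ?thesis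
        using nn_integral_eq_integral[OF int] by (simp add: less_imp_le[OF gauss_pos])
    qed
    define a where "a x = ennreal ((norm (f x))\<^sup>2 / 2)" for x
    define K where "K x y = ennreal (gauss_hat \<epsilon> (x - y))" for x y :: 'a
    have [measurable]: "a \<in> borel_measurable borel" unfolding a_def[abs_def] by measurable
    have [measurable]: "(\<lambda>(x, y). K x y) \<in> borel_measurable (borel \<Otimes>\<^sub>M borel)"
      unfolding K_def[abs_def] by measurable
    have "ennreal (norm (LINT x|lborel. f x * fourier w x)) \<le> (\<integral>\<^sup>+x. ennreal (norm (f x * fourier w x)) \<partial>lborel)"
      by (rule norm_integral_le_nn_integral)
    also have "\<dots> \<le> (\<integral>\<^sup>+x. (\<integral>\<^sup>+y. a x * K x y + a y * K x y \<partial>lborel) \<partial>lborel)"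
    proof (rule nn_integral_mono)
      fix x
      have "ennreal (norm (f x * fourier w x)) = ennreal (norm (f x)) * ennreal (norm (fourier w x))"
        by (simp add: norm_mult ennreal_mult)
      also have "\<dots> \<le> ennreal (norm (f x)) * (\<integral>\<^sup>+y. norm (?k x y) \<partial>lborel)"
        unfolding w_hat by (intro mult_left_mono norm_integral_le_nn_integral) auto
      also have "\<dots> = (\<integral>\<^sup>+y. ennreal (norm (f x)) * norm (?k x y) \<partial>lborel)"
        by (subst nn_integral_cmult) auto
      also have "\<dots> \<le> (\<integral>\<^sup>+y. a x * K x y + a y * K x y \<partial>lborel)"
      proof (rule nn_integral_mono)
        fix y
        have "norm (f x) * norm (?k x y) =
            gauss_hat \<epsilon> (x - y) * (norm (f x) * norm (f y))"
          using gauss_hat_nonneg[OF e, of "x - y"] by (simp add: norm_mult)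
        also have "\<dots> \<le> gauss_hat \<epsilon> (x - y) * ((norm (f x))\<^sup>2 / 2 + (norm (f y))\<^sup>2 / 2)"
          using mult_le_weighted_squares[of 1 "norm (f x)" "norm (f y)"] gauss_hat_nonneg[OF e, of "x - y"]
          by (intro mult_left_mono) auto
        finally have "ennreal (norm (f x) * norm (?k x y)) \<le>
            ennreal ((norm (f x))\<^sup>2 / 2 * gauss_hat \<epsilon> (x - y) + (norm (f y))\<^sup>2 / 2 * gauss_hat \<epsilon> (x - y))"
          by (intro ennreal_leI) (simp add: algebra_simps)
        then show "ennreal (norm (f x)) * norm (?k x y) \<le> a x * K x y + a y * K x y"
          unfolding a_def K_def using gauss_hat_nonneg[OF e, of "x - y"]
          by (simp add: ennreal_mult[symmetric] flip: ennreal_plus)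
      qed
      finally show "ennreal (norm (f x * fourier w x)) \<le> (\<integral>\<^sup>+y. a x * K x y + a y * K x y \<partial>lborel)" .
    qed
    also have "\<dots> = (\<integral>\<^sup>+x. (\<integral>\<^sup>+y. a x * K x y \<partial>lborel) + (\<integral>\<^sup>+y. a y * K x y \<partial>lborel) \<partial>lborel)"
      by (intro nn_integral_cong nn_integral_add) auto
    also have "\<dots> = (\<integral>\<^sup>+x. (\<integral>\<^sup>+y. a x * K x y \<partial>lborel) \<partial>lborel) + (\<integral>\<^sup>+x. (\<integral>\<^sup>+y. a y * K x y \<partial>lborel) \<partial>lborel)"
      by (rule nn_integral_add) auto
    \<comment> \<open>In the second half of the AM-GM bound the integrations are exchanged; then in
      both halves the inner integral is the mass of the even kernel.\<close>
    also have "(\<integral>\<^sup>+x. (\<integral>\<^sup>+y. a y * K x y \<partial>lborel) \<partial>lborel) = (\<integral>\<^sup>+y. (\<integral>\<^sup>+x. a y * K x y \<partial>lborel) \<partial>lborel)"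
      by (rule lborel_pair.Fubini') auto
    also have "(\<lambda>y. \<integral>\<^sup>+x. a y * K x y \<partial>lborel) = (\<lambda>y. a y * ?C)"
      unfolding K_def by (subst nn_integral_cmult) (auto simp: nn_integral_gauss_hat[OF e])
    also have "(\<lambda>x. \<integral>\<^sup>+y. a x * K x y \<partial>lborel) = (\<lambda>x. a x * ?C)"
    proof -
      have "K x = (\<lambda>y. ennreal (gauss_hat \<epsilon> (y - x)))" for x
        unfolding K_def using gauss_hat_minus[of \<epsilon> "x - _"] by fastforce
      then have "integral\<^sup>N lborel (K x) = ?C" for x
        by (simp only: nn_integral_gauss_hat[OF e])
      then show ?thesis by (subst nn_integral_cmult) auto
    qed
    also have "(\<integral>\<^sup>+x. a x * ?C \<partial>lborel) + (\<integral>\<^sup>+x. a x * ?C \<partial>lborel) = ?C * (\<integral>\<^sup>+x. a x + a x \<partial>lborel)"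
      by (simp add: nn_integral_multc nn_integral_add distrib_left distrib_right mult.commute)
    also have "(\<integral>\<^sup>+x. a x + a x \<partial>lborel) = L2_sq f"
      unfolding L2_sq_def a_def by (intro nn_integral_cong) (simp flip: ennreal_plus)
    finally show ?thesis unfolding eq .
  qed
  obtain e :: "nat \<Rightarrow> real" where e: "\<And>k. 0 < e k" and e0: "e \<longlonglongrightarrow> 0"
    using positive_null_sequence by metis
  have lim: "(\<lambda>k. ennreal (?q (e k) \<xi>)) \<longlonglongrightarrow> ennreal ((norm (?F \<xi>))\<^sup>2)" for \<xi>
    using tendsto_mult_left[OF gauss_tendsto_1[OF e0, of \<xi>], of "(norm (?F \<xi>))\<^sup>2"]
    by (intro tendsto_ennrealI) simp
  \<comment> \<open>The bound is the same for every \<open>e k\<close>, so Fatou removes the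
    Gaussian factor.\<close>
  have "L2_sq ?F = (\<integral>\<^sup>+\<xi>. liminf (\<lambda>k. ennreal (?q (e k) \<xi>)) \<partial>lborel)"
    unfolding L2_sq_def by (intro nn_integral_cong) (simp add: lim_imp_Liminf[OF _ lim])
  also have "\<dots> \<le> liminf (\<lambda>k. \<integral>\<^sup>+\<xi>. ennreal (?q (e k) \<xi>) \<partial>lborel)"
    by (rule nn_integral_liminf) auto
  also have "\<dots> \<le> ?C * L2_sq f"
    using Liminf_mono[OF always_eventually[OF allI[OF bound[OF e]]], of sequentially]
    by (simp add: Liminf_const)
  finally show ?thesis .
qed

section \<open>Limits in L^2 and the extension of the transform to L^2\<close>

lemma fourier_diff:
  assumes "integrable lborel f" "integrable lborel g"
  shows "fourier (\<lambda>x. f x - g x) \<xi> = fourier f \<xi> - fourier g \<xi>"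
  unfolding fourier_def right_diff_distrib
  by (intro Bochner_Integration.integral_diff integrable_cis_mult assms) auto

lemma L2_sq_cong_AE:
  assumes "AE x in lborel. f x = g x"
  shows "L2_sq f = L2_sq g"
  unfolding L2_sq_def using assms by (intro nn_integral_cong_AE) auto

text \<open>Fatou's lemma. It transfers both the norm bound and the Cauchy estimates to an almost
  everywhere limit.\<close>

lemma L2_sq_AE_limit_le:
  fixes h :: "nat \<Rightarrow> 'a::euclidean_space \<Rightarrow> complex"
  assumes [measurable]: "\<And>k. h k \<in> borel_measurable borel"
    and lim: "AE x in lborel. (\<lambda>k. h k x) \<longlonglongrightarrow> H x"
    and le: "\<forall>\<^sub>F k in sequentially. L2_sq (h k) \<le> c"
  shows "L2_sq H \<le> c"
proof -
  have "L2_sq H = (\<integral>\<^sup>+x. liminf (\<lambda>k. ennreal ((norm (h k x))\<^sup>2)) \<partial>lborel)"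
    unfolding L2_sq_def
  proof (rule nn_integral_cong_AE, use lim in eventually_elim)
    case (elim x)
    then have "(\<lambda>k. ennreal ((norm (h k x))\<^sup>2)) \<longlonglongrightarrow> ennreal ((norm (H x))\<^sup>2)"
      by (intro tendsto_intros)
    then show ?case by (intro lim_imp_Liminf[symmetric] trivial_limit_sequentially)
  qed
  also have "\<dots> \<le> liminf (\<lambda>k. L2_sq (h k))"
    unfolding L2_sq_def by (rule nn_integral_liminf) auto
  also have "\<dots> \<le> c"
    using Liminf_mono[OF le] by (simp add: Liminf_const)
  finally show ?thesis .
qed

lemma pow2_mult_div_pow4: "(2::real) ^ k * (c / 4 ^ k) = c * (1 / 2) ^ k"
  by (simp add: power_divide field_simps flip: power_mult_distrib)

text \<open>AM-GM with weight 2^k bounds the error of the pairing by 2^k c / 4^k plus 2^(-k) times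
  the squared norm of \<psi>, which is of order 2^(-k).\<close>

lemma L2_weak_limit:
  fixes h :: "nat \<Rightarrow> 'a::euclidean_space \<Rightarrow> complex"
  assumes [measurable]: "\<And>k. h k \<in> borel_measurable borel" "H \<in> borel_measurable borel"
      "\<psi> \<in> borel_measurable borel"
    and diff: "\<And>k. L2_sq (\<lambda>x. H x - h k x) \<le> ennreal (c / 4 ^ k)" and c: "0 \<le> c"
    and fin: "\<And>k. L2_sq (h k) < \<infinity>" "L2_sq H < \<infinity>" "L2_sq \<psi> < \<infinity>"
  shows "(\<lambda>k. LINT x|lborel. h k x * \<psi> x) \<longlonglongrightarrow> (LINT x|lborel. H x * \<psi> x)"
proof -
  define A where "A = enn2real (L2_sq \<psi>)"
  have A: "L2_sq \<psi> = ennreal A" "0 \<le> A"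
    using fin(3) by (auto simp: A_def)
  have bound: "norm ((LINT x|lborel. h k x * \<psi> x) - (LINT x|lborel. H x * \<psi> x)) \<le> (c + A) * (1 / 2) ^ k" for k
  proof -
    have "(LINT x|lborel. H x * \<psi> x) - (LINT x|lborel. h k x * \<psi> x) = (LINT x|lborel. (H x - h k x) * \<psi> x)"
      by (subst Bochner_Integration.integral_diff[symmetric]) (auto intro!: integrable_mult_L2 fin simp: left_diff_distrib)
    then have "ennreal (norm ((LINT x|lborel. H x * \<psi> x) - (LINT x|lborel. h k x * \<psi> x)))
        \<le> (\<integral>\<^sup>+x. norm ((H x - h k x) * \<psi> x) \<partial>lborel)"
      using norm_integral_le_nn_integral[of lborel "\<lambda>x. (H x - h k x) * \<psi> x"] by simp
    also have "\<dots> \<le> (\<integral>\<^sup>+x. ennreal (2 ^ k) * ennreal ((norm (H x - h k x))\<^sup>2) + ennreal (1 / 2 ^ k) * ennreal ((norm (\<psi> x))\<^sup>2) \<partial>lborel)"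
    proof (rule nn_integral_mono)
      fix x
      have "norm ((H x - h k x) * \<psi> x) \<le> 2 ^ k * (norm (H x - h k x))\<^sup>2 / 2 + (norm (\<psi> x))\<^sup>2 / (2 * 2 ^ k)"
        unfolding norm_mult by (rule mult_le_weighted_squares) simp
      also have "\<dots> \<le> 2 ^ k * (norm (H x - h k x))\<^sup>2 + 1 / 2 ^ k * (norm (\<psi> x))\<^sup>2"
        by (intro add_mono) (auto simp: field_simps)
      finally show "ennreal (norm ((H x - h k x) * \<psi> x)) \<le>
          ennreal (2 ^ k) * ennreal ((norm (H x - h k x))\<^sup>2) + ennreal (1 / 2 ^ k) * ennreal ((norm (\<psi> x))\<^sup>2)"
        by (simp add: ennreal_mult[symmetric] ennreal_leI flip: ennreal_plus)
    qed
    also have "\<dots> = ennreal (2 ^ k) * L2_sq (\<lambda>x. H x - h k x) + ennreal (1 / 2 ^ k) * L2_sq \<psi>"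
      unfolding L2_sq_def by (subst nn_integral_add) (auto simp: nn_integral_cmult)
    also have "\<dots> \<le> ennreal (2 ^ k) * ennreal (c / 4 ^ k) + ennreal (1 / 2 ^ k) * ennreal A"
      unfolding A(1) by (intro add_mono mult_left_mono diff) auto
    also have "\<dots> = ennreal ((c + A) * (1 / 2) ^ k)"
    proof -
      have "2 ^ k * (c / 4 ^ k) + 1 / 2 ^ k * A = (c + A) * (1 / 2) ^ k"
        unfolding pow2_mult_div_pow4 by (simp add: power_divide field_simps)
      then show ?thesis
        using c A(2) by (simp add: ennreal_mult[symmetric] flip: ennreal_plus)
    qed
    finally show ?thesis
      using c A(2) by (simp add: norm_minus_commute)
  qed
  have "(\<lambda>k. (c + A) * (1 / 2) ^ k) \<longlonglongrightarrow> 0"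
    using tendsto_mult_right_zero[OF LIMSEQ_power_zero[of "1 / 2 :: real"]] by simp
  then have "(\<lambda>k. (LINT x|lborel. h k x * \<psi> x) - (LINT x|lborel. H x * \<psi> x)) \<longlonglongrightarrow> 0"
    by (rule Lim_null_comparison[OF always_eventually[OF allI[OF bound]]])
  then show ?thesis by (simp add: LIM_zero_iff)
qed

lemma L2_truncation:
  fixes g :: "'a::euclidean_space \<Rightarrow> complex"
  assumes [measurable]: "g \<in> borel_measurable borel" and fin: "L2_sq g < \<infinity>" and e: "0 < e"
  shows "\<exists>N. L2_sq (\<lambda>x. indicator (- cball 0 (real N)) x * g x) \<le> ennreal e"
proof -
  let ?g = "\<lambda>N x. indicator (- cball 0 (real N)) x * g x"
  have "(\<lambda>N. \<integral>\<^sup>+x. ennreal ((norm (?g N x))\<^sup>2) \<partial>lborel)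
      \<longlonglongrightarrow> (\<integral>\<^sup>+x. ennreal ((norm (0 :: complex))\<^sup>2) \<partial>(lborel :: 'a measure))"
  proof (rule nn_integral_dominated_convergence[where w="\<lambda>x. ennreal ((norm (g x))\<^sup>2)"])
    show "(\<integral>\<^sup>+x. ennreal ((norm (g x))\<^sup>2) \<partial>lborel) < \<infinity>"
      using fin unfolding L2_sq_def .
    show "AE x in lborel. (\<lambda>N. ennreal ((norm (?g N x))\<^sup>2)) \<longlonglongrightarrow> ennreal ((norm (0 :: complex))\<^sup>2)"
    proof (intro AE_I2 tendsto_eventually)
      fix x :: 'a
      obtain n :: nat where n: "norm x \<le> real n" using real_arch_simple by blast
      show "\<forall>\<^sub>F N in sequentially. ennreal ((norm (?g N x))\<^sup>2) = ennreal ((norm (0 :: complex))\<^sup>2)"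
        using eventually_ge_at_top[of n] by eventually_elim (use n in \<open>auto simp: indicator_def\<close>)
    qed
  qed (auto simp: indicator_def intro!: AE_I2)
  then have "(\<lambda>N. L2_sq (?g N)) \<longlonglongrightarrow> 0"
    unfolding L2_sq_def by simp
  then have "\<forall>\<^sub>F N in sequentially. L2_sq (?g N) < ennreal e"
    using e by (intro order_tendstoD) auto
  then show ?thesis by (auto simp: eventually_sequentially intro: less_imp_le)
qed

lemma L2_bounded_support_integrable:
  fixes g :: "'a::euclidean_space \<Rightarrow> complex"
  assumes [measurable]: "g \<in> borel_measurable borel" "A \<in> sets borel" and fin: "L2_sq g < \<infinity>" and A: "emeasure lborel A < \<infinity>"
  shows "integrable lborel (\<lambda>x. indicator A x * g x)"
proof (rule integrable_mult_L2)
  have "L2_sq (indicator A :: 'a \<Rightarrow> complex) = (\<integral>\<^sup>+x. indicator A x \<partial>lborel)"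
    unfolding L2_sq_def by (intro nn_integral_cong) (auto simp: indicator_def)
  then show "L2_sq (indicator A :: 'a \<Rightarrow> complex) < \<infinity>" using A by simp
qed (use fin in auto)

text \<open>The increments \<open>d k\<close> satisfy \<open>norm (d k) \<le> 2\<^sup>k * (norm (d k))\<^sup>2 + 2\<^sup>-\<^sup>k\<close>, and the right-hand
  side is summable almost everywhere.\<close>

lemma L2_Cauchy_limit:
  fixes h :: "nat \<Rightarrow> 'a::euclidean_space \<Rightarrow> complex"
  assumes [measurable]: "\<And>k. h k \<in> borel_measurable borel"
    and Cauchy: "\<And>j k. k \<le> j \<Longrightarrow> L2_sq (\<lambda>x. h j x - h k x) \<le> ennreal (c / 4 ^ k)" and c: "0 \<le> c"
  obtains H where "H \<in> borel_measurable borel" "AE x in lborel. (\<lambda>k. h k x) \<longlonglongrightarrow> H x"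
    "\<And>k. L2_sq (\<lambda>x. H x - h k x) \<le> ennreal (c / 4 ^ k)"
proof -
  define d where "d k x = h (Suc k) x - h k x" for k x
  have [measurable]: "d k \<in> borel_measurable borel" for k unfolding d_def[abs_def] by measurable
  have "(\<integral>\<^sup>+x. (\<Sum>k. ennreal (2 ^ k * (norm (d k x))\<^sup>2)) \<partial>lborel) = (\<Sum>k. \<integral>\<^sup>+x. ennreal (2 ^ k * (norm (d k x))\<^sup>2) \<partial>lborel)"
    by (rule nn_integral_suminf) auto
  also have "\<dots> \<le> (\<Sum>k. ennreal (c * (1 / 2) ^ k))"
  proof (intro suminf_le summableI allI)
    fix k
    have "(\<integral>\<^sup>+x. ennreal (2 ^ k * (norm (d k x))\<^sup>2) \<partial>lborel) = ennreal (2 ^ k) * L2_sq (d k)"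
      unfolding L2_sq_def by (subst nn_integral_cmult[symmetric]) (auto simp: ennreal_mult)
    also have "\<dots> \<le> ennreal (2 ^ k) * ennreal (c / 4 ^ k)"
      unfolding d_def[abs_def] by (intro mult_left_mono Cauchy) auto
    also have "\<dots> = ennreal (c * (1 / 2) ^ k)"
      unfolding pow2_mult_div_pow4[symmetric] using c by (intro ennreal_mult[symmetric]) auto
    finally show "(\<integral>\<^sup>+x. ennreal (2 ^ k * (norm (d k x))\<^sup>2) \<partial>lborel) \<le> ennreal (c * (1 / 2) ^ k)" .
  qed
  also have "\<dots> < \<infinity>"
  proof -
    have "summable (\<lambda>k. c * (1 / 2 :: real) ^ k)" by (intro summable_mult summable_geometric) simp
    moreover have "0 \<le> c * (1 / 2 :: real) ^ k" for k using c by simp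
    ultimately show ?thesis
      by (simp only: suminf_ennreal2 infinity_ennreal_def ennreal_less_top)
  qed
  finally have "AE x in lborel. (\<Sum>k. ennreal (2 ^ k * (norm (d k x))\<^sup>2)) \<noteq> \<infinity>"
    by (intro nn_integral_PInf_AE) auto
  then have conv: "AE x in lborel. convergent (\<lambda>k. h k x)"
  proof eventually_elim
    case (elim x)
    have "summable (\<lambda>k. 2 ^ k * (norm (d k x))\<^sup>2)"
      using elim summable_suminf_not_top[of "\<lambda>k. 2 ^ k * (norm (d k x))\<^sup>2"] by simp
    moreover have "summable (\<lambda>k. (1 / 2 :: real) ^ k)" by (intro summable_geometric) simp
    ultimately have "summable (\<lambda>k. 2 ^ k * (norm (d k x))\<^sup>2 + (1 / 2) ^ k)" by (rule summable_add)
    then have "summable (\<lambda>k. d k x)"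
    proof (rule summable_comparison_test'[where N=0])
      fix k :: nat
      have "norm (d k x) * 1 \<le> 2 ^ k * (norm (d k x))\<^sup>2 / 2 + 1\<^sup>2 / (2 * 2 ^ k)"
        by (rule mult_le_weighted_squares) simp
      also have "\<dots> \<le> 2 ^ k * (norm (d k x))\<^sup>2 + (1 / 2) ^ k"
        by (intro add_mono) (auto simp: power_divide field_simps)
      finally show "norm (d k x) \<le> 2 ^ k * (norm (d k x))\<^sup>2 + (1 / 2) ^ k" by simp
    qed
    then have "convergent (\<lambda>n. \<Sum>k<n. d k x)"
      by (simp add: summable_iff_convergent)
    then have "convergent (\<lambda>n. h n x - h 0 x)"
      unfolding d_def sum_lessThan_telescope[of "\<lambda>n. h n x"] .
    from convergent_add[OF this convergent_const[of "h 0 x"]] show ?case by simp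
  qed
  define H where "H x = lim (\<lambda>k. h k x)" for x
  have Hm: "H \<in> borel_measurable borel"
    unfolding H_def[abs_def] by measurable
  have lim: "AE x in lborel. (\<lambda>k. h k x) \<longlonglongrightarrow> H x"
    using conv unfolding H_def by eventually_elim (rule convergent_LIMSEQ_iff[THEN iffD1])
  have "L2_sq (\<lambda>x. H x - h k x) \<le> ennreal (c / 4 ^ k)" for k
  proof (rule L2_sq_AE_limit_le)
    show "AE x in lborel. (\<lambda>j. h j x - h k x) \<longlonglongrightarrow> H x - h k x"
      using lim by eventually_elim (intro tendsto_intros)
    show "\<forall>\<^sub>F j in sequentially. L2_sq (\<lambda>x. h j x - h k x) \<le> ennreal (c / 4 ^ k)"
      using eventually_ge_at_top[of k] by eventually_elim (rule Cauchy)
  qed measurable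
  then show ?thesis using that Hm lim by blast
qed

text \<open>Truncations of \<open>g\<close> to balls are integrable, so their transforms are honest
  integrals. The radii are chosen to leave squared tails below 4^(-k), fast enough for the
  transforms to converge almost everywhere; the pairing identity then survives as a weak limit on
  both sides.\<close>

lemma L2_fourier:
  fixes g :: "'a::euclidean_space \<Rightarrow> complex"
  assumes [measurable]: "g \<in> borel_measurable borel" and fin: "L2_sq g < \<infinity>"
  obtains G where "G \<in> borel_measurable borel" "L2_sq G \<le> ennreal ((2 * pi) ^ DIM('a)) * L2_sq g"
    "\<And>\<psi>. \<psi> \<in> schwartz \<Longrightarrow> (LINT x|lborel. G x * \<psi> x) = (LINT x|lborel. g x * fourier \<psi> x)"
proof -
  let ?C = "(2 * pi) ^ DIM('a)"
  have C: "0 < ?C" by simp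
  have "\<forall>k. \<exists>N. L2_sq (\<lambda>x. indicator (- cball 0 (real N)) x * g x) \<le> ennreal (1 / 4 ^ k)"
    using L2_truncation[OF assms] by simp
  then obtain N where N: "\<And>k. L2_sq (\<lambda>x. indicator (- cball 0 (real (N k))) x * g x) \<le> ennreal (1 / 4 ^ k)"
    by metis
  define h where "h k x = indicator (cball 0 (real (N k))) x * g x" for k x
  have [measurable]: "h k \<in> borel_measurable borel" for k
    unfolding h_def[abs_def] by (intro borel_measurable_times borel_measurable_indicator assms) auto
  have h_int: "integrable lborel (h k)" for k
    unfolding h_def[abs_def] by (intro L2_bounded_support_integrable fin emeasure_lborel_cball_finite) auto
  have h_le: "L2_sq (h k) \<le> L2_sq g" for k
    unfolding L2_sq_def h_def by (intro nn_integral_mono ennreal_leI) (auto simp: indicator_def)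
  have h_lim: "L2_sq (\<lambda>x. g x - h k x) \<le> ennreal (1 / 4 ^ k)" for k
  proof -
    have "(\<lambda>x. g x - h k x) = (\<lambda>x. indicator (- cball 0 (real (N k))) x * g x)"
      by (auto simp: h_def indicator_def)
    then show ?thesis using N by simp
  qed
  \<comment> \<open>At each point a truncation equals g or 0. Where two of them differ, one of the
    two errors is |g| itself, so the squared errors simply add up; this is the 2.\<close>
  have h_Cauchy: "L2_sq (\<lambda>x. h j x - h k x) \<le> ennreal (2 / 4 ^ k)" if "k \<le> j" for j k
  proof -
    have "L2_sq (\<lambda>x. h j x - h k x) \<le> (\<integral>\<^sup>+x. ennreal ((norm (g x - h j x))\<^sup>2) + ennreal ((norm (g x - h k x))\<^sup>2) \<partial>lborel)"
      unfolding L2_sq_def by (intro nn_integral_mono) (auto simp: h_def indicator_def norm_minus_commute)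
    also have "\<dots> = L2_sq (\<lambda>x. g x - h j x) + L2_sq (\<lambda>x. g x - h k x)"
      unfolding L2_sq_def by (rule nn_integral_add) auto
    also have "\<dots> \<le> ennreal (1 / 4 ^ j) + ennreal (1 / 4 ^ k)"
      by (intro add_mono h_lim)
    also have "\<dots> \<le> ennreal (2 / 4 ^ k)"
    proof -
      have "1 / (4::real) ^ j \<le> 1 / 4 ^ k" using that by (intro divide_left_mono power_increasing) auto
      then show ?thesis by (simp add: ennreal_leI flip: ennreal_plus)
    qed
    finally show ?thesis .
  qed
  have F_Cauchy: "L2_sq (\<lambda>\<xi>. fourier (h j) \<xi> - fourier (h k) \<xi>) \<le> ennreal (2 * ?C / 4 ^ k)" if "k \<le> j" for j k
  proof -
    have "L2_sq (\<lambda>\<xi>. fourier (h j) \<xi> - fourier (h k) \<xi>) = L2_sq (fourier (\<lambda>x. h j x - h k x))"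
      unfolding L2_sq_def fourier_diff[OF h_int h_int] ..
    also have "\<dots> \<le> ennreal ?C * L2_sq (\<lambda>x. h j x - h k x)"
      by (intro Plancherel_le Bochner_Integration.integrable_diff h_int)
    also have "\<dots> \<le> ennreal ?C * ennreal (2 / 4 ^ k)"
      by (intro mult_left_mono h_Cauchy that) auto
    also have "\<dots> = ennreal (2 * ?C / 4 ^ k)"
      by (subst ennreal_mult[symmetric]) (auto simp del: power_mult_distrib)
    finally show ?thesis .
  qed
  obtain G where [measurable]: "G \<in> borel_measurable borel"
    and lim: "AE \<xi> in lborel. (\<lambda>k. fourier (h k) \<xi>) \<longlonglongrightarrow> G \<xi>"
    and G: "\<And>k. L2_sq (\<lambda>\<xi>. G \<xi> - fourier (h k) \<xi>) \<le> ennreal (2 * ?C / 4 ^ k)"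
  proof (rule L2_Cauchy_limit[where h="\<lambda>k. fourier (h k)" and c="2 * ?C", OF _ F_Cauchy])
    show "fourier (h k) \<in> borel_measurable borel" for k by measurable
  qed auto
  have Fh: "L2_sq (fourier (h k)) \<le> ennreal ?C * L2_sq g" for k
    using order_trans[OF Plancherel_le[OF h_int] mult_left_mono[OF h_le]] by simp
  have "L2_sq G \<le> ennreal ?C * L2_sq g"
    using lim Fh by (intro L2_sq_AE_limit_le[where h="\<lambda>k. fourier (h k)"]) auto
  moreover have top: "ennreal ?C * L2_sq g < \<infinity>"
    using fin by (simp add: ennreal_mult_less_top)
  moreover have "(LINT x|lborel. G x * \<psi> x) = (LINT x|lborel. g x * fourier \<psi> x)" if \<psi>: "\<psi> \<in> schwartz" for \<psi>
  proof (rule LIMSEQ_unique)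
    have [measurable]: "\<psi> \<in> borel_measurable borel" using schwartz_borel \<psi> .
    show "(\<lambda>k. LINT x|lborel. fourier (h k) x * \<psi> x) \<longlonglongrightarrow> (LINT x|lborel. G x * \<psi> x)"
    proof (rule L2_weak_limit[where c="2 * ?C"])
      show "L2_sq (fourier (h k)) < \<infinity>" for k using Fh top by (rule order.strict_trans1)
      show "L2_sq G < \<infinity>" using calculation by (rule order.strict_trans1)
      show "L2_sq \<psi> < \<infinity>" using \<psi> by (rule schwartz_L2)
    qed (use G in auto)
    have "(\<lambda>k. LINT x|lborel. h k x * fourier \<psi> x) \<longlonglongrightarrow> (LINT x|lborel. g x * fourier \<psi> x)"
    proof (rule L2_weak_limit[where c=1])
      show "L2_sq (h k) < \<infinity>" for k using h_le fin by (rule order.strict_trans1)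
      show "L2_sq (fourier \<psi>) < \<infinity>" using \<psi> by (intro schwartz_L2 fourier_schwartz)
    qed (use h_lim fin in auto)
    then show "(\<lambda>k. LINT x|lborel. fourier (h k) x * \<psi> x) \<longlonglongrightarrow> (LINT x|lborel. g x * fourier \<psi> x)"
      using fourier_multiplication[OF h_int schwartz_integrable[OF \<psi>]] by simp
  qed
  ultimately show ?thesis using that[of G] by simp
qed

section \<open>Uniqueness of representing functions\<close>

text \<open>\<open>ennreal\<close> sends negative reals to 0, so the densities of h and -h are the
  measures of its positive and negative part. They are finite and agree on boxes, an
  intersection-stable generator, hence they coincide, which forces both parts to vanish almost
  everywhere.\<close>

lemma AE_zero_of_box_integrals:
  fixes h :: "'a::euclidean_space \<Rightarrow> real"
  assumes h: "integrable lborel h" and box: "\<And>a b. (LINT x|lborel. indicator (box a b) x * h x) = 0"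
  shows "AE x in lborel. h x = 0"
proof -
  have [measurable]: "h \<in> borel_measurable borel" using h by auto
  have h_fin: "(\<integral>\<^sup>+x. ennreal (norm (h x)) \<partial>lborel) < \<infinity>"
    using h unfolding integrable_iff_bounded by blast
  have fin: "(\<integral>\<^sup>+x. ennreal (c * h x) * indicator A x \<partial>lborel) < \<infinity>" if "\<bar>c\<bar> = 1" for A c
  proof -
    have "(\<integral>\<^sup>+x. ennreal (c * h x) * indicator A x \<partial>lborel) \<le> (\<integral>\<^sup>+x. ennreal (norm (h x)) \<partial>lborel)"
    proof (rule nn_integral_mono)
      fix x
      have "c * h x \<le> norm (h x)" using that abs_ge_self[of "c * h x"] by (simp add: abs_mult)
      then show "ennreal (c * h x) * indicator A x \<le> ennreal (norm (h x))"
        by (auto simp: indicator_def intro: ennreal_leI)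
    qed
    then show ?thesis using h_fin by (rule order.strict_trans1)
  qed
  have inj: "p = q" if "enn2real p = enn2real q" "p < \<infinity>" "q < \<infinity>" for p q
    using that ennreal_enn2real by (metis infinity_ennreal_def)
  have "density lborel (\<lambda>x. ennreal (h x)) = density lborel (\<lambda>x. ennreal (- h x))"
  proof (rule measure_eqI_generator_eq)
    let ?E = "range (\<lambda>(a, b). box a b::'a set)"
    show "Int_stable ?E"
      by (auto simp: Int_stable_def box_Int_box)
    show "?E \<subseteq> Pow UNIV" "sets (density lborel (\<lambda>x. ennreal (h x))) = sigma_sets UNIV ?E"
        "sets (density lborel (\<lambda>x. ennreal (- h x))) = sigma_sets UNIV ?E"
      by (simp_all add: borel_eq_box)
    let ?A = "\<lambda>n::nat. box (- (real n *\<^sub>R One)) (real n *\<^sub>R One) :: 'a set"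
    show "range ?A \<subseteq> ?E" "(\<Union>i. ?A i) = UNIV"
      unfolding UN_box_eq_UNIV by auto
    show "emeasure (density lborel (\<lambda>x. ennreal (h x))) (?A i) \<noteq> \<infinity>" for i
      using fin[of 1 "?A i"] by (subst emeasure_density) auto
    show "emeasure (density lborel (\<lambda>x. ennreal (h x))) X = emeasure (density lborel (\<lambda>x. ennreal (- h x))) X"
      if XE: "X \<in> ?E" for X
    proof -
      obtain a b where X: "X = box a b" using XE by auto
      have *: "ennreal (c * h x) * indicator X x = ennreal (c * (indicator X x * h x))" for c x
        by (auto simp: indicator_def)
      have int: "integrable lborel (\<lambda>x. indicator X x * h x)"
        using integrable_mult_indicator[OF _ h, of X] unfolding X by simp
      have "enn2real (\<integral>\<^sup>+x. ennreal (1 * h x) * indicator X x \<partial>lborel) =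
          enn2real (\<integral>\<^sup>+x. ennreal (-1 * h x) * indicator X x \<partial>lborel)"
        unfolding * using box[of a b] unfolding real_lebesgue_integral_def[OF int[unfolded X]] X by simp
      then have "(\<integral>\<^sup>+x. ennreal (1 * h x) * indicator X x \<partial>lborel) = (\<integral>\<^sup>+x. ennreal (-1 * h x) * indicator X x \<partial>lborel)"
        by (rule inj[OF _ fin[of 1] fin[of "-1"]]) simp_all
      then show ?thesis
        unfolding X by (simp add: emeasure_density)
    qed
  qed
  then have "AE x in lborel. ennreal (h x) = ennreal (- h x)"
    by (intro sigma_finite_measure.density_unique[OF sigma_finite_lborel]) auto
  then show ?thesis
  proof eventually_elim
    case (elim x)
    then show ?case
      by (cases "0 \<le> h x") (auto simp: ennreal_neg ennreal_eq_0_iff dest: sym)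
  qed
qed

text \<open>Smoothing the indicator of a box by Gaussians gives functions that converge to it off the
  boundary of the box, so the integral of \<open>h\<close> over every box vanishes.\<close>

lemma AE_zero_of_gaussian_integrals:
  fixes h :: "'a::euclidean_space \<Rightarrow> complex"
  assumes h: "integrable lborel h"
    and zero: "\<And>\<epsilon> y. 0 < \<epsilon> \<Longrightarrow> (LINT x|lborel. h x * of_real (gauss_hat \<epsilon> (y - x))) = 0"
  shows "AE x in lborel. h x = 0"
proof -
  let ?p = "(2 * pi) ^ DIM('a)"
  have hm [measurable]: "h \<in> borel_measurable borel" using h by auto
  obtain e :: "nat \<Rightarrow> real" where e: "\<And>k. 0 < e k" and e0: "e \<longlonglongrightarrow> 0"
    using positive_null_sequence by metis
  have box: "(LINT x|lborel. indicator (box a b) x * h x) = 0" for a b :: 'a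
  proof -
    let ?I = "indicator (box a b) :: 'a \<Rightarrow> complex"
    define u where "u k x = (LINT y|lborel. of_real (gauss_hat (e k) (y - x)) * ?I y)" for k x
    have [measurable]: "u k \<in> borel_measurable borel" for k
      unfolding u_def[abs_def] by (intro borel_measurable_lborel_integral) measurable
    have u_le: "norm (u k x) \<le> ?p" for k x
    proof -
      have "ennreal (norm (u k x)) \<le> (\<integral>\<^sup>+y. ennreal (norm (of_real (gauss_hat (e k) (y - x)) * ?I y)) \<partial>lborel)"
        unfolding u_def by (rule norm_integral_le_nn_integral)
      also have "\<dots> \<le> (\<integral>\<^sup>+y. ennreal (gauss_hat (e k) (y - x)) \<partial>lborel)"
        using gauss_hat_nonneg[OF e] by (intro nn_integral_mono ennreal_leI) (auto simp: indicator_def norm_mult)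
      also have "\<dots> = ennreal (?p)"
        by (rule nn_integral_gauss_hat[OF e])
      finally show ?thesis by simp
    qed
    have I_int: "integrable lborel ?I"
    proof -
      have "?I = (\<lambda>x. complex_of_real (indicator (box a b) x))"
        by (auto simp: indicator_def)
      moreover have "integrable lborel (indicator (box a b) :: 'a \<Rightarrow> real)"
        by (rule integrable_real_indicator) (use emeasure_lborel_box_finite in auto)
      ultimately show ?thesis by (simp only: complex_of_real_integrable_eq)
    qed
    have "(LINT x|lborel. h x * u k x) = 0" for k
    proof -
      have "(LINT x|lborel. h x * u k x) =
          (LINT y|lborel. (LINT x|lborel. h x * of_real (gauss_hat (e k) (y - x))) * ?I y)"
        unfolding u_def
      proof (rule bounded_kernel_Fubini[OF h I_int])
        show "(\<lambda>(x, y). complex_of_real (gauss_hat (e k) (y - x))) \<in> borel_measurable (borel \<Otimes>\<^sub>M borel)"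
          by measurable
        show "norm (complex_of_real (gauss_hat (e k) (y - x))) \<le> (sqrt (2 * pi) / e k) ^ DIM('a)" for x y :: 'a
          using gauss_hat_le[OF e, of k "y - x"] gauss_hat_nonneg[OF e, of k "y - x"] by simp
      qed
      then show ?thesis using zero[OF e] by simp
    qed
    moreover have "(\<lambda>k. LINT x|lborel. h x * u k x) \<longlonglongrightarrow> (LINT x|lborel. h x * (of_real (?p) * ?I x))"
    proof (rule integral_dominated_convergence[where w="\<lambda>x. norm (h x) * ?p"])
      show "integrable lborel (\<lambda>x. norm (h x) * ?p)"
        using h by (intro integrable_mult_left integrable_norm)
      show "AE x in lborel. norm (h x * u k x) \<le> norm (h x) * ?p" for k
        by (intro AE_I2) (simp only: norm_mult mult_left_mono u_le norm_ge_zero)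
      have "AE x in lborel. x \<notin> cbox a b - box a b"
        by (intro AE_not_in null_sets_cbox_Diff_box)
      then show "AE x in lborel. (\<lambda>k. h x * u k x) \<longlonglongrightarrow> h x * (of_real (?p) * ?I x)"
      proof eventually_elim
        case (elim x)
        have cont: "isCont ?I x"
        proof (cases "x \<in> box a b")
          case True
          have "\<forall>\<^sub>F y in nhds x. ?I y = 1"
            using eventually_nhds_in_open[OF open_box True] by eventually_elim simp
          then have "isCont ?I x = isCont (\<lambda>_. 1 :: complex) x"
            by (rule isCont_cong)
          then show ?thesis by simp
        next
          case False
          then have "x \<in> - cbox a b" using elim by auto
          then have "\<forall>\<^sub>F y in nhds x. y \<in> - cbox a b"
            by (intro eventually_nhds_in_open) (auto simp: open_Compl closed_cbox)
          then have "\<forall>\<^sub>F y in nhds x. ?I y = 0"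
            by eventually_elim (use box_subset_cbox in \<open>auto simp: indicator_def\<close>)
          then have "isCont ?I x = isCont (\<lambda>_. 0 :: complex) x"
            by (rule isCont_cong)
          then show ?thesis by simp
        qed
        show ?case
          unfolding u_def
          by (intro tendsto_mult tendsto_const gauss_hat_approximate_identity[OF _ _ cont e0 e, where B=1])
            (auto simp: indicator_def)
      qed
    qed measurable
    ultimately have "(LINT x|lborel. h x * (of_real (?p) * ?I x)) = 0"
      by (simp add: LIMSEQ_const_iff del: of_real_power)
    moreover have "(LINT x|lborel. h x * (of_real (?p) * ?I x)) =
        of_real (?p) * (LINT x|lborel. ?I x * h x)"
      by (subst integral_mult_right_zero[symmetric]) (simp add: mult_ac)
    ultimately show ?thesis by simp
  qed
  have I: "integrable lborel (\<lambda>x. indicator (box a b) x * h x)" for a b :: 'a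
  proof -
    have "(\<lambda>x. indicat_real (box a b) x *\<^sub>R h x) = (\<lambda>x. indicator (box a b) x * h x)"
      by (auto simp: indicator_def)
    then show ?thesis using integrable_mult_indicator[OF _ h, of "box a b"] by simp
  qed
  \<comment> \<open>Boxes determine real densities, so real and imaginary part are treated
    separately as bounded linear images of h.\<close>
  have component: "AE x in lborel. T (h x) = 0" if T: "bounded_linear T" for T :: "complex \<Rightarrow> real"
  proof (rule AE_zero_of_box_integrals)
    show "integrable lborel (\<lambda>x. T (h x))" by (rule integrable_bounded_linear[OF T h])
    fix a b :: 'a
    have "indicator (box a b) x * T (h x) = T (indicator (box a b) x * h x)" for x
      using linear_0[OF bounded_linear.linear[OF T]] by (simp add: indicator_def)
    then show "(LINT x|lborel. indicator (box a b) x * T (h x)) = 0"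
      using integral_bounded_linear[OF T I[of a b]] box[of a b] linear_0[OF bounded_linear.linear[OF T]]
      by simp
  qed
  show ?thesis
    using component[OF bounded_linear_Re] component[OF bounded_linear_Im]
    by eventually_elim (simp add: complex_eq_iff)
qed

text \<open>A function with these pairings may fail to be integrable. Multiplying it by a fixed
  positive Gaussian repairs this, and the product of that Gaussian with a shifted kernel is again a
  Gaussian, hence an admissible test function.\<close>

lemma AE_zero_of_schwartz_integrals:
  fixes h :: "'a::euclidean_space \<Rightarrow> complex"
  assumes [measurable]: "h \<in> borel_measurable borel"
    and int: "\<And>\<psi>. \<psi> \<in> schwartz \<Longrightarrow> integrable lborel (\<lambda>x. h x * \<psi> x)"
    and zero: "\<And>\<psi>. \<psi> \<in> schwartz \<Longrightarrow> (LINT x|lborel. h x * \<psi> x) = 0"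
  shows "AE x in lborel. h x = 0"
proof -
  let ?g = "\<lambda>x::'a. complex_of_real (exp (- (1 / 2) * (norm x)\<^sup>2 + x \<bullet> 0 + 0))"
  have "AE x in lborel. h x * ?g x = 0"
  proof (rule AE_zero_of_gaussian_integrals)
    show "integrable lborel (\<lambda>x. h x * ?g x)"
      by (intro int gaussian_schwartz) simp
    fix \<epsilon> :: real and y :: 'a assume e: "0 < \<epsilon>"
    define A where "A = (sqrt (2 * pi) / \<epsilon>) ^ DIM('a)"
    \<comment> \<open>The expansion of -|x|^2 / 2 - |y - x|^2 / (2 \<epsilon>^2) into the quadratic,
      linear and constant term of \<open>gaussian_schwartz\<close>.\<close>
    let ?Q = "\<lambda>x. - (1 / 2 + 1 / (2 * \<epsilon>\<^sup>2)) * (norm x)\<^sup>2 + x \<bullet> ((1 / \<epsilon>\<^sup>2) *\<^sub>R y) + (- (norm y)\<^sup>2 / (2 * \<epsilon>\<^sup>2))"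
    define \<psi> where "\<psi> x = complex_of_real (exp (?Q x))" for x
    have "\<psi> \<in> schwartz"
      unfolding \<psi>_def[abs_def] by (rule gaussian_schwartz) (simp add: add_pos_nonneg)
    moreover have *: "h x * ?g x * of_real (gauss_hat \<epsilon> (y - x)) = of_real A * (h x * \<psi> x)" for x
    proof -
      have "- (1 / 2) * (norm x)\<^sup>2 + x \<bullet> 0 + 0 + (- (norm ((1 / \<epsilon>) *\<^sub>R (y - x)))\<^sup>2 / 2) =
          ?Q x"
      proof -
        have "(norm ((1 / \<epsilon>) *\<^sub>R (y - x)))\<^sup>2 = (norm (y - x))\<^sup>2 / \<epsilon>\<^sup>2"
          by (simp only: norm_scaleR power_mult_distrib power2_abs) (simp add: power_divide)
        also have "(norm (y - x))\<^sup>2 = (norm y)\<^sup>2 - 2 * (x \<bullet> y) + (norm x)\<^sup>2"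
          by (simp add: power2_norm_eq_inner inner_diff_left inner_diff_right inner_commute)
        finally have *: "(norm ((1 / \<epsilon>) *\<^sub>R (y - x)))\<^sup>2 = ((norm y)\<^sup>2 - 2 * (x \<bullet> y) + (norm x)\<^sup>2) / \<epsilon>\<^sup>2" .
        show ?thesis unfolding * using e by (simp add: field_simps)
      qed
      then have "exp (- (1 / 2) * (norm x)\<^sup>2 + x \<bullet> 0 + 0) * gauss (1 / \<epsilon>) (y - x) =
          exp (?Q x)"
        unfolding gauss_def by (metis exp_add)
      then have "?g x * of_real (gauss (1 / \<epsilon>) (y - x)) = \<psi> x"
        unfolding \<psi>_def by (metis of_real_mult)
      then show ?thesis
        unfolding gauss_hat_def A_def[symmetric] by (simp only: of_real_mult) (simp only: mult_ac)
    qed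
    ultimately show "(LINT x|lborel. h x * ?g x * of_real (gauss_hat \<epsilon> (y - x))) = 0"
      by (simp only: * integral_mult_right_zero zero mult_zero_right)
  qed
  then show ?thesis by eventually_elim simp
qed

lemma represents_unique:
  assumes "represents g T" "represents g' T"
  shows "AE x in lborel. g x = g' x"
proof -
  have m: "g \<in> borel_measurable borel" "g' \<in> borel_measurable borel"
    and int: "\<And>\<psi>. \<psi> \<in> schwartz \<Longrightarrow> integrable lborel (\<lambda>x. g x * \<psi> x)"
      "\<And>\<psi>. \<psi> \<in> schwartz \<Longrightarrow> integrable lborel (\<lambda>x. g' x * \<psi> x)"
    and eq: "\<And>\<psi>. \<psi> \<in> schwartz \<Longrightarrow> (LINT x|lborel. g x * \<psi> x) = (LINT x|lborel. g' x * \<psi> x)"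
    using assms unfolding represents_def by auto
  have "AE x in lborel. g x - g' x = 0"
    by (rule AE_zero_of_schwartz_integrals) (use m int eq in \<open>auto simp: left_diff_distrib\<close>)
  then show ?thesis by eventually_elim simp
qed

lemma represents_distr_fun:
  "represents g T \<Longrightarrow> represents (distr_fun T) T"
  unfolding distr_fun_def by (rule someI[of "\<lambda>g. represents g T"])

lemma represents_fourier:
  fixes g :: "'a::euclidean_space \<Rightarrow> complex"
  assumes g: "represents g T" "L2_sq g < \<infinity>"
  obtains G where "represents G (distr_fourier T)" "L2_sq G \<le> ennreal ((2 * pi) ^ DIM('a)) * L2_sq g"
proof -
  have gm: "g \<in> borel_measurable borel" using g unfolding represents_def by blast
  obtain G where Gm: "G \<in> borel_measurable borel" and G: "L2_sq G \<le> ennreal ((2 * pi) ^ DIM('a)) * L2_sq g"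
    and eq: "\<And>\<psi>. \<psi> \<in> schwartz \<Longrightarrow> (LINT x|lborel. G x * \<psi> x) = (LINT x|lborel. g x * fourier \<psi> x)"
    using L2_fourier[OF gm g(2)] by blast
  have "L2_sq G < \<infinity>"
    using G g(2) by (auto intro: order.strict_trans1 simp: ennreal_mult_less_top)
  then have "represents G (distr_fourier T)"
    unfolding represents_def distr_fourier_def
    using g(1) Gm eq by (auto simp: represents_def fourier_schwartz intro: integrable_mult_L2 schwartz_borel schwartz_L2)
  then show ?thesis using that G by blast
qed

section \<open>Bernstein inequality\<close>

lemma ennpowr_ennreal: "0 \<le> a \<Longrightarrow> ennpowr (ennreal a) p = ennreal (a powr p)"
  unfolding ennpowr_def by simp

lemma ennpowr_mono:
  assumes "x \<le> y" "0 \<le> p"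
  shows "ennpowr x p \<le> ennpowr y p"
proof (cases y)
  case (real b)
  then obtain a where "x = ennreal a" "0 \<le> a" "a \<le> b"
    using assms(1) by (cases x) (auto simp: top_unique)
  then show ?thesis
    using real assms(2) by (simp add: ennpowr_ennreal ennreal_leI powr_mono2)
qed (simp add: ennpowr_def)

lemma ennpowr_cmult:
  assumes "0 < c"
  shows "ennpowr (ennreal c * x) p = ennreal (c powr p) * ennpowr x p"
proof (cases x)
  case (real a)
  then show ?thesis
    using assms by (simp add: ennpowr_ennreal ennreal_mult[symmetric] powr_mult)
next
  case top
  then show ?thesis
    using assms by (simp add: ennpowr_def ennreal_mult_top)
qed

lemma Lp_norm_real:
  assumes "1 \<le> p"
  shows "Lp_norm M (ennreal p) u = ennpowr (\<integral>\<^sup>+x. ennpowr (u x) p \<partial>M) (1 / p)"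
  unfolding Lp_norm_def using assms by simp

lemma powr_2_eq: "0 \<le> a \<Longrightarrow> a powr 2 = a\<^sup>2" for a :: real
  by (cases "a = 0") auto

lemma Lp_norm_2:
  fixes g :: "'a::euclidean_space \<Rightarrow> complex"
  shows "Lp_norm lborel 2 (\<lambda>x. ennreal (norm (g x))) = ennpowr (L2_sq g) (1 / 2)"
  using Lp_norm_real[of 2 lborel "\<lambda>x. ennreal (norm (g x))"] unfolding L2_sq_def
  by (simp add: ennpowr_ennreal powr_2_eq)

lemma ennpowr_finite_iff: "ennpowr x p < \<infinity> \<longleftrightarrow> x < \<infinity>"
  unfolding ennpowr_def by (auto simp: less_top)

lemma inv_fourier_multiplication:
  fixes f g :: "'a::euclidean_space \<Rightarrow> complex"
  assumes f: "integrable lborel f" and g: "integrable lborel g"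
  shows "(LINT x|lborel. inv_fourier f x * g x) = (LINT \<xi>|lborel. f \<xi> * inv_fourier g \<xi>)"
proof -
  let ?c = "of_real (1 / (2 * pi) ^ DIM('a)) :: complex"
  have "(LINT \<xi>|lborel. f \<xi> * (LINT x|lborel. cis (\<xi> \<bullet> x) * g x)) = (LINT x|lborel. (LINT \<xi>|lborel. f \<xi> * cis (\<xi> \<bullet> x)) * g x)"
    by (rule bounded_kernel_Fubini[OF f g, where c=1]) auto
  then have "?c * (LINT \<xi>|lborel. f \<xi> * (LINT x|lborel. cis (\<xi> \<bullet> x) * g x)) =
      ?c * (LINT x|lborel. (LINT \<xi>|lborel. f \<xi> * cis (\<xi> \<bullet> x)) * g x)" by simp
  moreover have "?c * (LINT \<xi>|lborel. f \<xi> * (LINT x|lborel. cis (\<xi> \<bullet> x) * g x)) = (LINT \<xi>|lborel. f \<xi> * inv_fourier g \<xi>)"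
    unfolding inv_fourier_def by (simp only: mult.left_commute[of _ ?c] integral_mult_right_zero)
  moreover have "?c * (LINT x|lborel. (LINT \<xi>|lborel. f \<xi> * cis (\<xi> \<bullet> x)) * g x) = (LINT x|lborel. inv_fourier f x * g x)"
    unfolding inv_fourier_def
    by (simp only: mult.assoc integral_mult_right_zero) (simp only: mult.commute[of "f _"] inner_commute)
  ultimately show ?thesis by simp
qed

text \<open>Inversion on test functions writes T \<psi> as the transform of T applied to the inverse
  transform of \<psi>; the multiplication formula moves that inverse onto G. Distributional
  inversion thereby becomes an absolutely convergent formula for a function.\<close>

lemma represents_inv_fourier:
  fixes G :: "'a::euclidean_space \<Rightarrow> complex"
  assumes G: "represents G (distr_fourier T)" and int: "integrable lborel G"
  shows "represents (inv_fourier G) T"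
  unfolding represents_def
proof (intro conjI ballI)
  have [measurable]: "G \<in> borel_measurable borel" using int by auto
  show m [measurable]: "inv_fourier G \<in> borel_measurable borel"
    unfolding inv_fourier_eq_fourier[abs_def] by measurable
  fix \<psi> :: "'a \<Rightarrow> complex" assume \<psi>: "\<psi> \<in> schwartz"
  have [measurable]: "\<psi> \<in> borel_measurable borel" using schwartz_borel \<psi> .
  obtain M where M: "norm (fourier G x) \<le> M" for x using norm_fourier_le by blast
  show "integrable lborel (\<lambda>x. inv_fourier G x * \<psi> x)"
  proof (rule Bochner_Integration.integrable_bound)
    let ?c = "of_real (1 / (2 * pi) ^ DIM('a)) :: complex"
    show "integrable lborel (\<lambda>x. norm ?c * M * norm (\<psi> x))"
      by (intro integrable_mult_right integrable_norm schwartz_integrable \<psi>)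
    show "AE x in lborel. norm (inv_fourier G x * \<psi> x) \<le> norm (norm ?c * M * norm (\<psi> x))"
    proof (rule AE_I2)
      fix x
      have "norm (inv_fourier G x * \<psi> x) \<le> norm ?c * M * norm (\<psi> x)"
        unfolding inv_fourier_eq_fourier norm_mult by (intro mult_right_mono mult_left_mono M) auto
      then show "norm (inv_fourier G x * \<psi> x) \<le> norm (norm ?c * M * norm (\<psi> x))"
        using abs_ge_self order_trans unfolding real_norm_def by blast
    qed
  qed measurable
  have "fourier (inv_fourier \<psi>) = \<psi>"
    using fourier_inv_fourier[OF \<psi>] by blast
  then have "T \<psi> = distr_fourier T (inv_fourier \<psi>)"
    unfolding distr_fourier_def by simp
  also have "\<dots> = (LINT x|lborel. G x * inv_fourier \<psi> x)"
    using G inv_fourier_schwartz[OF \<psi>] unfolding represents_def by blast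
  also have "\<dots> = (LINT x|lborel. inv_fourier G x * \<psi> x)"
    by (rule inv_fourier_multiplication[OF int schwartz_integrable[OF \<psi>], symmetric])
  finally show "T \<psi> = (LINT x|lborel. inv_fourier G x * \<psi> x)" .
qed

lemma ennreal_power2_le_imp_le:
  assumes "x\<^sup>2 \<le> (ennreal a)\<^sup>2" "0 \<le> a"
  shows "x \<le> ennreal a"
proof (cases x)
  case (real b)
  then show ?thesis
    using assms by (auto simp: ennreal_power intro!: ennreal_leI power2_le_imp_le)
next
  case top
  then show ?thesis
    using assms by (simp add: ennreal_power top_unique power2_eq_square ennreal_mult_eq_top_iff)
qed

text \<open>Three factors combine: 1 / (2 pi)^n from inversion, the root of (2 pi)^n from the
  Plancherel bound and the root of the volume of a ball from Cauchy-Schwarz. The radius is kept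
  apart.\<close>

definition Bernstein_const :: "nat \<Rightarrow> real" where
  "Bernstein_const n = sqrt (unit_ball_vol n / (2 * pi) ^ n)"

lemma Bernstein_const_pos: "0 < Bernstein_const n"
  unfolding Bernstein_const_def by simp

text \<open>Cauchy-Schwarz on \<open>cball 0 R\<close> makes G integrable. Its inverse transform is
  then a bounded function that represents T, and uniqueness identifies it with g almost
  everywhere.\<close>

lemma Bernstein_sup:
  fixes g G :: "'a::euclidean_space \<Rightarrow> complex"
  assumes g: "represents g T" and G: "represents G (distr_fourier T)"
    and le: "L2_sq G \<le> ennreal ((2 * pi) ^ DIM('a) * N\<^sup>2)" and N: "0 \<le> N"
    and supp: "AE \<xi> in lborel. G \<xi> \<noteq> 0 \<longrightarrow> norm \<xi> \<le> R" and R: "0 \<le> R"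
  shows "AE x in lborel. norm (g x) \<le> Bernstein_const DIM('a) * sqrt (R ^ DIM('a)) * N"
proof -
  let ?p = "(2 * pi) ^ DIM('a)" and ?v = "unit_ball_vol (real DIM('a))"
  have p: "0 < ?p" and v: "0 < ?v" by simp_all
  have Gm [measurable]: "G \<in> borel_measurable borel" using G unfolding represents_def by blast
  have "(\<integral>\<^sup>+\<xi>. ennreal (norm (G \<xi>)) \<partial>lborel)\<^sup>2 = (\<integral>\<^sup>+\<xi>. ennreal (norm (G \<xi>)) * indicator (cball 0 R) \<xi> \<partial>lborel)\<^sup>2"
    by (intro arg_cong[where f="\<lambda>x. x\<^sup>2"] nn_integral_cong_AE, use supp in eventually_elim) (auto simp: indicator_def)
  also have "\<dots> \<le> (\<integral>\<^sup>+\<xi>. (ennreal (norm (G \<xi>)))\<^sup>2 \<partial>lborel) * (\<integral>\<^sup>+\<xi>. (indicator (cball 0 R) \<xi> :: ennreal)\<^sup>2 \<partial>(lborel :: 'a measure))"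
    by (rule Cauchy_Schwarz_nn_integral) (auto intro!: borel_measurable_indicator)
  also have "(\<integral>\<^sup>+\<xi>. (ennreal (norm (G \<xi>)))\<^sup>2 \<partial>lborel) = L2_sq G"
    unfolding L2_sq_def by (simp add: ennreal_power)
  also have "(\<integral>\<^sup>+\<xi>. (indicator (cball 0 R) \<xi> :: ennreal)\<^sup>2 \<partial>(lborel :: 'a measure)) = emeasure lborel (cball (0 :: 'a) R)"
  proof -
    have "(\<lambda>\<xi>::'a. (indicator (cball 0 R) \<xi> :: ennreal)\<^sup>2) = indicator (cball 0 R)"
      by (auto simp: indicator_def)
    then show ?thesis by simp
  qed
  also have "\<dots> = ennreal (?v * R ^ DIM('a))"
    using R by (simp add: emeasure_cball)
  also have "L2_sq G * ennreal (?v * R ^ DIM('a)) \<le> ennreal (?p * N\<^sup>2) * ennreal (?v * R ^ DIM('a))"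
    by (intro mult_right_mono le) auto
  also have "\<dots> = ennreal ((sqrt (?p * ?v * R ^ DIM('a)) * N)\<^sup>2)"
    using R N p v by (subst ennreal_mult[symmetric]) (auto simp: power_mult_distrib mult_ac)
  finally have "(\<integral>\<^sup>+\<xi>. ennreal (norm (G \<xi>)) \<partial>lborel)\<^sup>2 \<le> (ennreal (sqrt (?p * ?v * R ^ DIM('a)) * N))\<^sup>2"
    using R N p v by (simp add: ennreal_power)
  then have L1: "(\<integral>\<^sup>+\<xi>. ennreal (norm (G \<xi>)) \<partial>lborel) \<le> ennreal (sqrt (?p * ?v * R ^ DIM('a)) * N)"
    using R N p v by (intro ennreal_power2_le_imp_le) auto
  then have int: "integrable lborel G"
    by (intro integrableI_bounded) (auto intro: order.strict_trans1)
  have "norm (inv_fourier G x) \<le> Bernstein_const DIM('a) * sqrt (R ^ DIM('a)) * N" for x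
  proof -
    have "norm (inv_fourier G x) \<le> 1 / ?p * (LINT \<xi>|lborel. norm (G \<xi>))"
    proof -
      have c: "norm (complex_of_real (1 / ?p)) = 1 / ?p"
        by (subst norm_of_real, rule abs_of_nonneg) simp
      show ?thesis
        unfolding inv_fourier_eq_fourier norm_mult c by (rule mult_left_mono[OF norm_fourier_le]) simp
    qed
    also have "\<dots> \<le> 1 / ?p * (sqrt (?p * ?v * R ^ DIM('a)) * N)"
    proof (rule mult_left_mono)
      have "ennreal (LINT \<xi>|lborel. norm (G \<xi>)) \<le> ennreal (sqrt (?p * ?v * R ^ DIM('a)) * N)"
        using L1 nn_integral_eq_integral[OF integrable_norm[OF int]] by simp
      then show "(LINT \<xi>|lborel. norm (G \<xi>)) \<le> sqrt (?p * ?v * R ^ DIM('a)) * N"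
        using N R p v by (subst (asm) ennreal_le_iff) auto
    qed simp
    also have "\<dots> = Bernstein_const DIM('a) * sqrt (R ^ DIM('a)) * N"
    proof -
      have "1 / ?p * sqrt (?p * ?v) = sqrt (?v / ?p)"
        using p v by (simp add: real_sqrt_mult real_sqrt_divide field_simps)
      moreover have "1 / ?p * (sqrt (?p * ?v * R ^ DIM('a)) * N) = (1 / ?p * sqrt (?p * ?v)) * sqrt (R ^ DIM('a)) * N"
        by (simp only: real_sqrt_mult mult_ac)
      ultimately show ?thesis unfolding Bernstein_const_def by (simp only:)
    qed
    finally show ?thesis .
  qed
  moreover have "AE x in lborel. g x = inv_fourier G x"
    by (rule represents_unique[OF g represents_inv_fourier[OF G int]])
  ultimately show ?thesis by auto
qed

text \<open>The sup bound contains the L^2 norm N itself, giving N^2 <= (K N)^(2 - r) times the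
  integral of |g|^r. As N is finite and positive, N^(2 - r) can be divided out, and the r-th root
  turns K^(2 - r) into K^(2/r - 1).\<close>

lemma interpolation_L2_Lr_Linf:
  fixes g :: "'a::euclidean_space \<Rightarrow> complex"
  assumes [measurable]: "g \<in> borel_measurable borel"
    and N: "L2_sq g = ennreal (N\<^sup>2)" "0 \<le> N"
    and sup: "AE x in lborel. norm (g x) \<le> K * N" and K: "0 < K" and r: "1 \<le> r" "r \<le> 2"
  shows "ennreal N \<le> ennreal (K powr (2 / r - 1)) * Lp_norm lborel (ennreal r) (\<lambda>x. ennreal (norm (g x)))"
proof (cases "N = 0")
  case False
  then have Np: "0 < N" using N(2) by simp
  define I where "I = (\<integral>\<^sup>+x. ennreal (norm (g x) powr r) \<partial>lborel)"
  have Lr: "Lp_norm lborel (ennreal r) (\<lambda>x. ennreal (norm (g x))) = ennpowr I (1 / r)"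
    using r unfolding I_def by (simp add: Lp_norm_real ennpowr_ennreal)
  have "L2_sq g \<le> (\<integral>\<^sup>+x. ennreal ((K * N) powr (2 - r)) * ennreal (norm (g x) powr r) \<partial>lborel)"
    unfolding L2_sq_def
  proof (rule nn_integral_mono_AE, use sup in eventually_elim)
    case (elim x)
    have "(norm (g x))\<^sup>2 = norm (g x) powr (2 - r) * norm (g x) powr r"
      by (cases "norm (g x) = 0") (simp_all add: powr_2_eq flip: powr_add)
    also have "\<dots> \<le> (K * N) powr (2 - r) * norm (g x) powr r"
      using elim r by (intro mult_right_mono powr_mono2) auto
    finally show ?case by (simp add: ennreal_mult[symmetric] ennreal_leI)
  qed
  also have "\<dots> = ennreal ((K * N) powr (2 - r)) * I"
    unfolding I_def by (rule nn_integral_cmult) auto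
  finally have le: "ennreal (N\<^sup>2) \<le> ennreal ((K * N) powr (2 - r)) * I" unfolding N(1) .
  show ?thesis
  proof (cases I)
    case (real J)
    have "N\<^sup>2 \<le> (K * N) powr (2 - r) * J"
      using le real by (simp add: ennreal_mult[symmetric])
    then have "N powr 2 \<le> K powr (2 - r) * N powr (2 - r) * J"
      using Np K by (simp add: powr_mult powr_2_eq)
    then have "N powr 2 / N powr (2 - r) \<le> K powr (2 - r) * J"
      using Np by (simp add: divide_le_eq mult_ac)
    then have "N powr r \<le> K powr (2 - r) * J"
      using powr_diff[of N 2 "2 - r"] by simp
    then have "(N powr r) powr (1 / r) \<le> (K powr (2 - r) * J) powr (1 / r)"
      using r by (intro powr_mono2) auto
    then have "N \<le> K powr (2 / r - 1) * J powr (1 / r)"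
      using r Np K real by (simp add: powr_mult powr_powr diff_divide_distrib)
    then show ?thesis
      unfolding Lr using real by (simp add: ennpowr_ennreal ennreal_mult[symmetric] ennreal_leI)
  next
    case top
    then show ?thesis unfolding Lr using K by (simp add: ennpowr_def ennreal_mult_top)
  qed
qed simp

section \<open>Littlewood--Paley blocks\<close>

lemma LP_cutoff_support:
  assumes "LP_cutoff \<phi>" "\<phi> x \<noteq> 0"
  shows "3 / 4 \<le> norm x" "norm x \<le> 8 / 3"
  using assms closure_subset[of "{\<xi>. \<phi> \<xi> \<noteq> 0}"] unfolding LP_cutoff_def by auto

lemma LP_cutoff_smooth_bounded:
  assumes "LP_cutoff \<phi>"
  shows "\<phi> \<in> smooth_bounded"
proof (rule smooth_bounded_compact_support)
  show "smooth \<phi>" using assms unfolding LP_cutoff_def by blast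
  show "bounded {x. \<phi> x \<noteq> 0}"
    using LP_cutoff_support[OF assms] unfolding bounded_iff by blast
qed

text \<open>The radii of the support have quotient (8/3) / (3/4) = 32/9 < 4, so a point in the
  support at scale q is outside the support at every scale two or more steps away.\<close>

lemma LP_cutoff_adjacent_sum:
  fixes \<xi> :: "'a::euclidean_space"
  assumes \<phi>: "LP_cutoff \<phi>" and nz: "\<phi> ((2 powi (- q)) *\<^sub>R \<xi>) \<noteq> 0"
  shows "(\<Sum>j\<in>{q - 1, q, q + 1}. \<phi> ((2 powi (- j)) *\<^sub>R \<xi>)) = 1"
proof -
  let ?x = "\<lambda>j. (2 powi (- j)) *\<^sub>R \<xi>"
  let ?c = "\<lambda>j. \<phi> (?x j)"
  define x where "x = 2 powi (- q) * norm \<xi>"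
  have x: "3 / 4 \<le> x" "x \<le> 8 / 3"
    using LP_cutoff_support[OF \<phi> nz] by (simp_all add: x_def)
  have norm_j: "norm (?x j) = 2 powi (q - j) * x" for j
    by (simp add: x_def power_int_add[symmetric] flip: mult.assoc)
  have "\<xi> \<noteq> 0" using x by (auto simp: x_def)
  then have "(?c has_sum 1) UNIV"
    using \<phi> unfolding LP_cutoff_def by blast
  moreover have "(?c has_sum 1) UNIV \<longleftrightarrow>
      (?c has_sum 1) {q - 1, q, q + 1}"
  proof (rule has_sum_cong_neutral)
    fix j assume "j \<in> UNIV - {q - 1, q, q + 1}"
    then consider "q - j \<le> -2" | "2 \<le> q - j" by force
    then show "?c j = 0"
    proof cases
      case 1
      then have "2 powi (q - j) \<le> (2 :: real) powi (-2)" by (intro power_int_increasing) auto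
      then have "2 powi (q - j) * x \<le> 2 powi (-2) * (8 / 3)" using x by (intro mult_mono) auto
      then have "norm (?x j) < 3 / 4"
        unfolding norm_j by (simp add: power_int_minus)
      then show ?thesis using LP_cutoff_support(1)[OF \<phi>, of "?x j"] by force
    next
      case 2
      then have "(2 :: real) powi 2 \<le> 2 powi (q - j)" by (intro power_int_increasing) auto
      then have "2 powi 2 * (3 / 4) \<le> 2 powi (q - j) * x" using x by (intro mult_mono) auto
      then have "8 / 3 < norm (?x j)"
        unfolding norm_j by simp
      then show ?thesis using LP_cutoff_support(2)[OF \<phi>, of "?x j"] by force
    qed
  qed auto
  ultimately have "(?c has_sum 1) {q - 1, q, q + 1}" by simp
  moreover have "(?c has_sum
      sum ?c {q - 1, q, q + 1}) {q - 1, q, q + 1}"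
    by (rule has_sum_finite) simp
  ultimately show ?thesis by (rule has_sum_unique[rotated])
qed

text \<open>Transforming the block undoes its inverse transform, by inversion on the test function.
  What remains is the cutoff acting on the test function.\<close>

lemma distr_fourier_LP_block:
  assumes "\<psi> \<in> schwartz"
  shows "distr_fourier (LP_block \<phi> q f) \<psi> =
    (SOME T. T \<in> f) (fourier (\<lambda>\<xi>. of_real (\<phi> ((2 powi (- q)) *\<^sub>R \<xi>)) * \<psi> \<xi>))"
proof -
  have "inv_fourier (fourier \<psi>) = \<psi>" using fourier_inversion[OF assms] by blast
  then show ?thesis
    by (simp add: distr_fourier_def LP_block_def distr_inv_fourier_def distr_mult_def)
qed

text \<open>Any multiplier that equals 1 on the support of \<open>\<phi> (2\<^sup>-\<^sup>q \<xi>)\<close> fixes the Fourier transform of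
  the block. Three adjacent cutoffs provide one, so no other bump functions are needed.\<close>

lemma LP_block_fourier_support:
  fixes \<phi> :: "'a::euclidean_space \<Rightarrow> real"
  assumes \<phi>: "LP_cutoff \<phi>" and G: "represents G (distr_fourier (LP_block \<phi> q f))"
  shows "AE \<xi> in lborel. G \<xi> \<noteq> 0 \<longrightarrow> 3 / 8 * 2 powr q \<le> norm \<xi> \<and> norm \<xi> \<le> 16 / 3 * 2 powr q"
proof -
  let ?S = "distr_fourier (LP_block \<phi> q f)"
  define c where "c j \<xi> = complex_of_real (\<phi> ((2 powi (- j)) *\<^sub>R \<xi>))" for j :: int and \<xi> :: 'a
  define m where "m \<xi> = c (q - 1) \<xi> + c q \<xi> + c (q + 1) \<xi>" for \<xi>
  have c_schwartz: "(\<lambda>\<xi>. c j \<xi> * \<psi> \<xi>) \<in> schwartz" if "\<psi> \<in> schwartz" for j \<psi>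
    unfolding c_def by (intro schwartz_mult that smooth_bounded_scaleR_arg LP_cutoff_smooth_bounded \<phi>)
  have m_schwartz: "(\<lambda>\<xi>. m \<xi> * \<psi> \<xi>) \<in> schwartz" if "\<psi> \<in> schwartz" for \<psi>
    using schwartz_add[OF schwartz_add[OF c_schwartz[OF that] c_schwartz[OF that]] c_schwartz[OF that], of "q - 1" q "q + 1"]
    by (simp add: m_def distrib_right)
  have cm: "c q \<xi> * m \<xi> = c q \<xi>" for \<xi>
  proof (cases "\<phi> ((2 powi (- q)) *\<^sub>R \<xi>) = 0")
    case False
    have "m \<xi> = of_real (\<Sum>j\<in>{q - 1, q, q + 1}. \<phi> ((2 powi (- j)) *\<^sub>R \<xi>))"
      by (simp add: m_def c_def)
    then show ?thesis using LP_cutoff_adjacent_sum[OF \<phi> False] by simp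
  qed (simp add: c_def)
  have S: "?S (\<lambda>\<xi>. m \<xi> * \<psi> \<xi>) = ?S \<psi>" if "\<psi> \<in> schwartz" for \<psi>
    unfolding distr_fourier_LP_block[OF that] distr_fourier_LP_block[OF m_schwartz[OF that]]
      c_def[symmetric] by (simp add: cm flip: mult.assoc)
  have Gm [measurable]: "G \<in> borel_measurable borel" using G unfolding represents_def by blast
  have [measurable]: "\<phi> \<in> borel_measurable borel"
    using smooth_bounded_differentiable[OF LP_cutoff_smooth_bounded[OF \<phi>]]
    by (intro borel_measurable_continuous_onI)
      (meson continuous_at_imp_continuous_on differentiable_imp_continuous_within)
  \<comment> \<open>Since multiplying test functions by \<open>m\<close> changes nothing, G and m G
    represent the same distribution. By uniqueness they agree almost everywhere, so G vanishes
    almost everywhere outside the support of \<open>m\<close>.\<close>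
  have mG: "represents (\<lambda>\<xi>. m \<xi> * G \<xi>) ?S"
    unfolding represents_def
  proof (intro conjI ballI)
    show "(\<lambda>\<xi>. m \<xi> * G \<xi>) \<in> borel_measurable borel"
      unfolding m_def c_def by measurable
    fix \<psi> :: "'a \<Rightarrow> complex" assume \<psi>: "\<psi> \<in> schwartz"
    have "integrable lborel (\<lambda>\<xi>. G \<xi> * (m \<xi> * \<psi> \<xi>)) \<and> ?S (\<lambda>\<xi>. m \<xi> * \<psi> \<xi>) = (LINT \<xi>|lborel. G \<xi> * (m \<xi> * \<psi> \<xi>))"
      using bspec[OF conjunct2[OF G[unfolded represents_def]] m_schwartz[OF \<psi>]] .
    then show "integrable lborel (\<lambda>\<xi>. m \<xi> * G \<xi> * \<psi> \<xi>)" "?S \<psi> = (LINT \<xi>|lborel. m \<xi> * G \<xi> * \<psi> \<xi>)"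
      unfolding S[OF \<psi>] by (simp_all add: mult_ac)
  qed
  show ?thesis
    using represents_unique[OF G mG]
  proof eventually_elim
    case (elim \<xi>)
    show ?case
    proof
      assume "G \<xi> \<noteq> 0"
      then have "m \<xi> \<noteq> 0" using elim by auto
      then obtain j where j: "j \<in> {q - 1, q, q + 1}" and "c j \<xi> \<noteq> 0"
      proof -
        have "c (q - 1) \<xi> \<noteq> 0 \<or> c q \<xi> \<noteq> 0 \<or> c (q + 1) \<xi> \<noteq> 0"
          using \<open>m \<xi> \<noteq> 0\<close> by (auto simp: m_def)
        then show ?thesis using that by blast
      qed
      then have "3 / 4 \<le> 2 powi (- j) * norm \<xi>" "2 powi (- j) * norm \<xi> \<le> 8 / 3"
        using LP_cutoff_support[OF \<phi>, of "(2 powi (- j)) *\<^sub>R \<xi>"] by (auto simp: c_def)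
      then have *: "3 / 4 * 2 powi j \<le> norm \<xi>" "norm \<xi> \<le> 8 / 3 * 2 powi j"
        by (simp_all add: power_int_minus field_simps)
      \<comment> \<open>The neighbouring scales widen the annulus by a factor 2 on either side: 3/8
        is half of 3/4, and 16/3 is twice 8/3.\<close>
      have "(2 :: real) powi (q - 1) \<le> 2 powi j" "2 powi j \<le> (2 :: real) powi (q + 1)"
        using j by (auto intro!: power_int_increasing)
      then have "(2 :: real) powi q / 2 \<le> 2 powi j" "2 powi j \<le> (2 :: real) powi q * 2"
        by (simp_all add: power_int_diff power_int_add)
      with * have "3 / 8 * 2 powi q \<le> norm \<xi>" "norm \<xi> \<le> 16 / 3 * 2 powi q"
        by linarith+
      then show "3 / 8 * 2 powr q \<le> norm \<xi> \<and> norm \<xi> \<le> 16 / 3 * 2 powr q"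
        by (simp add: powr_real_of_int')
    qed
  qed
qed

lemma distr_Lp_norm_eq:
  "represents g T \<Longrightarrow> distr_Lp_norm p T = Lp_norm lborel p (\<lambda>x. ennreal (norm (distr_fun T x)))"
  unfolding distr_Lp_norm_def distr_weighted_Lp_norm_def by auto

lemma distr_Lp_norm_finiteD: "distr_Lp_norm p T < \<infinity> \<Longrightarrow> \<exists>g. represents g T"
  unfolding distr_Lp_norm_def distr_weighted_Lp_norm_def by (auto split: if_splits)

text \<open>Packages a block of finite norm as one real number N, so that later estimates can divide
  by N and take powers of it in the reals.\<close>

lemma LP_block_L2:
  fixes \<phi> :: "'a::euclidean_space \<Rightarrow> real"
  assumes fin: "distr_Lp_norm 2 (LP_block \<phi> q f) < \<infinity>"
  obtains N where "0 \<le> N" "distr_Lp_norm 2 (LP_block \<phi> q f) = ennreal N"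
    "L2_sq (distr_fun (LP_block \<phi> q f)) = ennreal (N\<^sup>2)"
    "represents (distr_fun (LP_block \<phi> q f)) (LP_block \<phi> q f)"
    "represents (distr_fun (distr_fourier (LP_block \<phi> q f))) (distr_fourier (LP_block \<phi> q f))"
    "L2_sq (distr_fun (distr_fourier (LP_block \<phi> q f))) \<le> ennreal ((2 * pi) ^ DIM('a) * N\<^sup>2)"
proof -
  let ?S = "LP_block \<phi> q f"
  let ?G = "distr_fun (distr_fourier ?S)"
  obtain g where g: "represents g ?S" using distr_Lp_norm_finiteD[OF fin] by blast
  then have S: "represents (distr_fun ?S) ?S" by (rule represents_distr_fun)
  have eq: "distr_Lp_norm 2 ?S = ennpowr (L2_sq (distr_fun ?S)) (1 / 2)"
    unfolding distr_Lp_norm_eq[OF g] Lp_norm_2 ..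
  then have "L2_sq (distr_fun ?S) < \<infinity>" using fin by (simp only: ennpowr_finite_iff)
  then obtain a where a: "L2_sq (distr_fun ?S) = ennreal a" "0 \<le> a"
    by (cases "L2_sq (distr_fun ?S)") auto
  obtain G where G: "represents G (distr_fourier ?S)"
    and le: "L2_sq G \<le> ennreal ((2 * pi) ^ DIM('a)) * L2_sq (distr_fun ?S)"
    using represents_fourier[OF S \<open>L2_sq (distr_fun ?S) < \<infinity>\<close>] by blast
  have F: "represents (?G) (distr_fourier ?S)"
    using G by (rule represents_distr_fun)
  \<comment> \<open>The bound was obtained for a constructed representative; uniqueness carries it
    over to the one selected by \<open>distr_fun\<close>.\<close>
  have "L2_sq (?G) = L2_sq G"
    by (intro L2_sq_cong_AE represents_unique[OF F G])
  then have "L2_sq (?G) \<le> ennreal ((2 * pi) ^ DIM('a) * (sqrt a)\<^sup>2)"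
    using le a by (simp add: ennreal_mult del: power_mult_distrib)
  then show ?thesis
    using that[of "sqrt a"] S F a eq by (simp add: ennpowr_ennreal powr_half_sqrt)
qed

lemma LP_block_Bernstein:
  fixes \<phi> :: "'a::euclidean_space \<Rightarrow> real"
  assumes \<phi>: "LP_cutoff \<phi>" and r: "1 \<le> r" "r \<le> 2" and fin: "distr_Lp_norm 2 (LP_block \<phi> q f) < \<infinity>"
  shows "distr_Lp_norm 2 (LP_block \<phi> q f) \<le>
    ennreal ((Bernstein_const DIM('a) * (16 / 3) powr (DIM('a) / 2)) powr (2 / r - 1) * 2 powr (q * (DIM('a) * (1 / r - 1 / 2)))) *
      distr_Lp_norm (ennreal r) (LP_block \<phi> q f)"
proof -
  let ?S = "LP_block \<phi> q f"
  let ?G = "distr_fun (distr_fourier ?S)" and ?n = "DIM('a)"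
  obtain N where N: "0 \<le> N" "distr_Lp_norm 2 ?S = ennreal N"
    "L2_sq (distr_fun ?S) = ennreal (N\<^sup>2)" and S: "represents (distr_fun ?S) ?S"
    and F: "represents (?G) (distr_fourier ?S)"
    "L2_sq (?G) \<le> ennreal ((2 * pi) ^ ?n * N\<^sup>2)"
    using LP_block_L2[OF fin] by metis
  \<comment> \<open>The outer radius of the annulus. Its power n/2 from the sup bound, raised to 2/r
    - 1 by the interpolation, yields the factor 2^(q n (1/r - 1/2)).\<close>
  define R :: real where "R = 16 / 3 * 2 powr q"
  have "AE \<xi> in lborel. ?G \<xi> \<noteq> 0 \<longrightarrow> norm \<xi> \<le> R"
    using LP_block_fourier_support[OF \<phi> F(1)] unfolding R_def by eventually_elim auto
  then have "AE x in lborel. norm (distr_fun ?S x) \<le> (Bernstein_const ?n * sqrt (R ^ ?n)) * N"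
    using Bernstein_sup[OF S F N(1)] by (simp add: R_def)
  moreover have sq: "sqrt (R ^ ?n) = R powr (?n / 2)"
    by (simp add: R_def powr_half_sqrt[symmetric] powr_realpow[symmetric] powr_powr del: powr_half_sqrt)
  ultimately have "ennreal N \<le> ennreal ((Bernstein_const ?n * R powr (?n / 2)) powr (2 / r - 1)) *
      Lp_norm lborel (ennreal r) (\<lambda>x. ennreal (norm (distr_fun ?S x)))"
    using S N r Bernstein_const_pos[of ?n]
    by (intro interpolation_L2_Lr_Linf) (auto simp: represents_def R_def)
  moreover have "(Bernstein_const ?n * R powr (?n / 2)) powr (2 / r - 1) =
      (Bernstein_const ?n * (16 / 3) powr (?n / 2)) powr (2 / r - 1) * 2 powr (q * (?n * (1 / r - 1 / 2)))"
  proof -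
    have "?n / 2 * (2 / r - 1) = ?n * (1 / r - 1 / 2)" using r by (simp add: field_simps)
    then have "q * (?n / 2) * (2 / r - 1) = q * (?n * (1 / r - 1 / 2))" by (metis mult.assoc)
    then have "(2 powr (q * (?n / 2))) powr (2 / r - 1) = 2 powr (q * (?n * (1 / r - 1 / 2)))"
      by (simp only: powr_powr)
    moreover have "R powr (?n / 2) = (16 / 3) powr (?n / 2) * 2 powr (q * (?n / 2))"
      unfolding R_def by (simp only: powr_mult powr_powr)
    ultimately show ?thesis
      using Bernstein_const_pos[of ?n] by (simp only: powr_mult mult.assoc)
  qed
  ultimately show ?thesis
    unfolding N(2) distr_Lp_norm_eq[OF S, of "ennreal r"] by simp
qed

text \<open>On the annulus carrying the transform the weight is at most exp(-b t), so a pointwise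
  comparison suffices. The factor sqrt((2 pi)^n) is the Plancherel constant of the unnormalized
  transform.\<close>

lemma LP_block_damped_norm:
  fixes \<phi> :: "'a::euclidean_space \<Rightarrow> real"
  assumes \<phi>: "LP_cutoff \<phi>" and fin: "distr_Lp_norm 2 (LP_block \<phi> q f) < \<infinity>"
    and \<eta>: "\<And>\<xi>. 3 / 8 * 2 powr q \<le> norm \<xi> \<Longrightarrow> norm \<xi> \<le> 16 / 3 * 2 powr q \<Longrightarrow> b \<le> \<eta> \<xi>"
    and t: "0 \<le> t"
  shows "distr_weighted_Lp_norm 2 (\<lambda>\<xi>. exp (- \<eta> \<xi> * t)) (distr_fourier (LP_block \<phi> q f)) \<le>
    ennreal (sqrt ((2 * pi) ^ DIM('a)) * exp (- b * t)) * distr_Lp_norm 2 (LP_block \<phi> q f)"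
proof -
  let ?S = "LP_block \<phi> q f"
  let ?G = "distr_fun (distr_fourier ?S)" and ?p = "(2 * pi) ^ DIM('a)"
  define w where "w \<xi> = exp (- \<eta> \<xi> * t)" for \<xi>
  define E where "E = exp (- b * t)"
  have w: "\<bar>w \<xi>\<bar> \<le> E" if "3 / 8 * 2 powr q \<le> norm \<xi>" "norm \<xi> \<le> 16 / 3 * 2 powr q" for \<xi>
    using mult_right_mono[OF \<eta>[OF that] t] by (simp add: w_def E_def)
  have p: "0 < ?p" and E: "0 < E" by (simp_all add: E_def)
  obtain N where N: "0 \<le> N" "distr_Lp_norm 2 ?S = ennreal N"
    and F: "represents ?G (distr_fourier ?S)" "L2_sq ?G \<le> ennreal (?p * N\<^sup>2)"
    using LP_block_L2[OF fin] by metis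
  have [measurable]: "?G \<in> borel_measurable borel" using F(1) unfolding represents_def by blast
  have "L2_sq (\<lambda>\<xi>. ?G \<xi> * of_real (w \<xi>)) \<le> (\<integral>\<^sup>+\<xi>. ennreal (E\<^sup>2) * ennreal ((norm (?G \<xi>))\<^sup>2) \<partial>lborel)"
    unfolding L2_sq_def
  proof (rule nn_integral_mono_AE, use LP_block_fourier_support[OF \<phi> F(1)] in eventually_elim)
    case (elim \<xi>)
    have "(norm (?G \<xi> * of_real (w \<xi>)))\<^sup>2 \<le> E\<^sup>2 * (norm (?G \<xi>))\<^sup>2"
    proof (cases "?G \<xi> = 0")
      case False
      then have "\<bar>w \<xi>\<bar>\<^sup>2 \<le> E\<^sup>2" using elim w by (intro power_mono) auto
      then show ?thesis by (simp add: norm_mult power_mult_distrib mult.commute mult_right_mono)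
    qed simp
    then show ?case by (simp add: ennreal_mult[symmetric] ennreal_leI)
  qed
  also have "\<dots> = ennreal (E\<^sup>2) * L2_sq ?G"
    unfolding L2_sq_def by (rule nn_integral_cmult) auto
  also have "\<dots> \<le> ennreal (E\<^sup>2) * ennreal (?p * N\<^sup>2)"
    by (intro mult_left_mono F) auto
  also have "\<dots> = ennreal ((sqrt ?p * E * N)\<^sup>2)"
    using p by (subst ennreal_mult[symmetric]) (auto simp: power_mult_distrib mult_ac)
  finally have "ennpowr (L2_sq (\<lambda>\<xi>. ?G \<xi> * of_real (w \<xi>))) (1 / 2) \<le> ennpowr (ennreal ((sqrt ?p * E * N)\<^sup>2)) (1 / 2)"
    by (rule ennpowr_mono) simp
  also have "\<dots> = ennreal (sqrt ?p * E * N)"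
    using N p E by (simp add: ennpowr_ennreal powr_half_sqrt)
  also have "\<dots> = ennreal (sqrt ?p * E) * ennreal N"
    using N p E by (intro ennreal_mult) auto
  finally show ?thesis
    using F(1) unfolding distr_weighted_Lp_norm_def Lp_norm_2 N(2) w_def E_def by auto
qed

section \<open>Sequence norms\<close>

lemma Lp_exponent_cases:
  assumes "1 \<le> (\<alpha> :: ennreal)"
  obtains "\<alpha> = \<infinity>" | p where "\<alpha> = ennreal p" "1 \<le> p"
proof (cases \<alpha>)
  case (real p)
  then show ?thesis using that(2)[of p] assms by (simp flip: ennreal_1)
qed (use that(1) in simp)

lemma lp_norm_infinity: "lp_norm \<infinity> a = esssup (count_space UNIV) a"
  unfolding lp_norm_def Lp_norm_def by simp

lemma lp_norm_infinity_ge: "a q \<le> lp_norm \<infinity> a"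
  unfolding lp_norm_infinity using esssup_AE[where M="count_space UNIV" and f=a] by (simp add: AE_count_space)

lemma lp_norm_infinity_le: "(\<And>q. a q \<le> c) \<Longrightarrow> lp_norm \<infinity> a \<le> c"
  unfolding lp_norm_infinity by (intro esssup_I) (auto simp: AE_count_space)

lemma lp_norm_real:
  "1 \<le> p \<Longrightarrow> lp_norm (ennreal p) a = ennpowr (\<integral>\<^sup>+q. ennpowr (a q) p \<partial>count_space UNIV) (1 / p)"
  unfolding lp_norm_def by (rule Lp_norm_real)

lemma lp_norm_mono:
  assumes "1 \<le> \<alpha>" "\<And>q. a q \<le> b q"
  shows "lp_norm \<alpha> a \<le> lp_norm \<alpha> b"
  using assms(1)
proof (cases rule: Lp_exponent_cases)
  case 1
  have "a q \<le> lp_norm \<infinity> b" for q using assms(2)[of q] lp_norm_infinity_ge[of b q] by simp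
  then show ?thesis unfolding 1 by (rule lp_norm_infinity_le)
next
  case (2 p)
  then show ?thesis
    using assms(2) by (simp add: lp_norm_real ennpowr_mono nn_integral_mono)
qed

lemma lp_norm_cmult_le:
  assumes "1 \<le> \<alpha>" "0 \<le> c"
  shows "lp_norm \<alpha> (\<lambda>q. ennreal c * a q) \<le> ennreal c * lp_norm \<alpha> a"
  using assms(1)
proof (cases rule: Lp_exponent_cases)
  case 1
  have "ennreal c * a q \<le> ennreal c * lp_norm \<infinity> a" for q
    by (intro mult_left_mono lp_norm_infinity_ge) simp
  then show ?thesis unfolding 1 by (rule lp_norm_infinity_le)
next
  case (2 p)
  show ?thesis
  proof (cases "c = 0")
    case True
    then show ?thesis using 2 by (simp add: lp_norm_real ennpowr_def)
  next
    case False
    then have c: "0 < c" using assms(2) by simp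
    have "lp_norm \<alpha> (\<lambda>q. ennreal c * a q) =
        ennpowr (ennreal (c powr p) * (\<integral>\<^sup>+q. ennpowr (a q) p \<partial>count_space UNIV)) (1 / p)"
      using 2 c by (simp add: lp_norm_real ennpowr_cmult nn_integral_cmult)
    also have "\<dots> = ennreal c * lp_norm \<alpha> a"
      using 2 c by (subst ennpowr_cmult) (auto simp: lp_norm_real powr_powr)
    finally show ?thesis by simp
  qed
qed

text \<open>A weak form of Minkowski's inequality: the p-th power sums add up to at most twice the
  larger one, and 2^(1/p) <= 2 makes the constant uniform in \<alpha>.\<close>

lemma lp_norm_split_le:
  assumes "1 \<le> \<alpha>"
  shows "lp_norm \<alpha> (\<lambda>q. if P q then a q else b q) \<le> 2 * (lp_norm \<alpha> a + lp_norm \<alpha> b)"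
  using assms
proof (cases rule: Lp_exponent_cases)
  case 1
  have "(if P q then a q else b q) \<le> lp_norm \<infinity> a + lp_norm \<infinity> b" for q
    using lp_norm_infinity_ge[of a q] lp_norm_infinity_ge[of b q]
    by (auto intro: add_increasing add_increasing2)
  also have "\<And>x :: ennreal. x \<le> 2 * x" by (simp add: mult_2 add_increasing)
  finally show ?thesis unfolding 1 by (rule lp_norm_infinity_le)
next
  case (2 p)
  let ?I = "\<lambda>a. \<integral>\<^sup>+q. ennpowr (a q) p \<partial>count_space (UNIV :: int set)"
  define M where "M = max (?I a) (?I b)"
  have "?I (\<lambda>q. if P q then a q else b q) \<le> (\<integral>\<^sup>+q. ennpowr (a q) p + ennpowr (b q) p \<partial>count_space UNIV)"
    by (intro nn_integral_mono) auto
  also have "\<dots> = ?I a + ?I b" by (rule nn_integral_add) auto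
  also have "\<dots> \<le> M + M" unfolding M_def by (intro add_mono) auto
  also have "\<dots> = ennreal 2 * M" by (simp add: mult_2)
  finally have "lp_norm \<alpha> (\<lambda>q. if P q then a q else b q) \<le> ennpowr (ennreal 2 * M) (1 / p)"
    using 2 by (simp add: lp_norm_real ennpowr_mono)
  also have "\<dots> = ennreal (2 powr (1 / p)) * ennpowr M (1 / p)"
    by (rule ennpowr_cmult) simp
  also have "\<dots> \<le> 2 * (lp_norm \<alpha> a + lp_norm \<alpha> b)"
  proof (rule mult_mono)
    have "2 powr (1 / p) \<le> 2 powr (1 :: real)" using 2 by (intro powr_mono) auto
    then show "ennreal (2 powr (1 / p)) \<le> 2" by (simp add: ennreal_le_iff2 flip: ennreal_numeral)
    show "ennpowr M (1 / p) \<le> lp_norm \<alpha> a + lp_norm \<alpha> b"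
      using 2 unfolding M_def max_def by (auto simp: lp_norm_real)
  qed auto
  finally show ?thesis .
qed

abbreviation bump :: "real \<Rightarrow> real \<Rightarrow> real" where
  "bump \<delta> x \<equiv> 2 powr (- \<delta> * \<bar>x\<bar>)"

text \<open>The integers are covered by two copies of the naturals, each giving a geometric series;
  counting 0 twice does no harm for an upper bound.\<close>

lemma nn_integral_int_geometric:
  assumes "0 < \<delta>"
  shows "(\<integral>\<^sup>+q. ennreal (bump \<delta> (real_of_int q)) \<partial>count_space UNIV) < \<infinity>"
proof -
  define g where "g q = ennreal (bump \<delta> (real_of_int q))" for q :: int
  have half: "(\<integral>\<^sup>+q. g q \<partial>count_space (h ` UNIV)) < \<infinity>"
    if h: "inj h" "\<And>n. \<bar>real_of_int (h n)\<bar> = real n" for h :: "nat \<Rightarrow> int"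
  proof -
    have "(\<integral>\<^sup>+q. g q \<partial>count_space (h ` UNIV)) = (\<integral>\<^sup>+n. g (h n) \<partial>count_space UNIV)"
      using h(1) by (intro nn_integral_bij_count_space[symmetric]) (simp add: inj_on_imp_bij_betw)
    also have "\<dots> = (\<Sum>n. ennreal ((2 powr (- \<delta>)) ^ n))"
    proof -
      have "2 powr (- \<delta> * real n) = (2 powr (- \<delta>)) ^ n" for n
        by (simp add: powr_power mult.commute)
      then show ?thesis unfolding nn_integral_count_space_nat g_def h(2) by (simp only:)
    qed
    also have "\<dots> < \<infinity>"
    proof -
      have "(2 :: real) powr (- \<delta>) < 1" using assms by (simp add: powr_less_one)
      then have "summable (\<lambda>n. (2 powr (- \<delta>)) ^ n)" by (intro summable_geometric) simp
      then show ?thesis by (subst suminf_ennreal2) auto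
    qed
    finally show ?thesis .
  qed
  let ?A = "range int" and ?B = "range (\<lambda>n. - int n)"
  have UN: "q \<in> ?A \<or> q \<in> ?B" for q :: int
  proof (cases "0 \<le> q")
    case True
    then have "q = int (nat q)" by simp
    then show ?thesis by blast
  next
    case False
    then have "q = - int (nat (- q))" by simp
    then show ?thesis by blast
  qed
  have "(\<integral>\<^sup>+q. g q \<partial>count_space UNIV) \<le> (\<integral>\<^sup>+q. g q * indicator ?A q + g q * indicator ?B q \<partial>count_space UNIV)"
  proof (rule nn_integral_mono)
    fix q :: int
    show "g q \<le> g q * indicator ?A q + g q * indicator ?B q"
      using UN[of q] by (elim disjE) (simp_all add: add_increasing add_increasing2)
  qed
  also have "\<dots> = (\<integral>\<^sup>+q. g q * indicator ?A q \<partial>count_space UNIV) + (\<integral>\<^sup>+q. g q * indicator ?B q \<partial>count_space UNIV)"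
    by (rule nn_integral_add) auto
  also have "\<dots> = (\<integral>\<^sup>+q. g q \<partial>count_space ?A) + (\<integral>\<^sup>+q. g q \<partial>count_space ?B)"
    by (simp add: nn_integral_count_space_indicator)
  also have "\<dots> < \<infinity>"
    using half[of int] half[of "\<lambda>n. - int n"] by (simp add: inj_def)
  finally show ?thesis unfolding g_def .
qed

text \<open>The bump is at most 1, so its p-th power is below the bump itself, and summation over
  the integers is shift-invariant. Taking K >= 1 gives K^(1/p) <= K, hence one constant for all
  \<alpha> and all peaks; later the peak moves with t.\<close>

lemma lp_norm_geometric_bump:
  assumes \<delta>: "0 < \<delta>"
  obtains K where "0 < K"
    "\<And>\<alpha> m. 1 \<le> \<alpha> \<Longrightarrow> lp_norm \<alpha> (\<lambda>q. ennreal (bump \<delta> (real_of_int (q + m)))) \<le> ennreal K"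
proof -
  let ?b = "\<lambda>m q. ennreal (bump \<delta> (real_of_int (q + m)))"
  let ?I = "\<integral>\<^sup>+q. ennreal (bump \<delta> (real_of_int q)) \<partial>count_space UNIV"
  obtain J where J: "?I = ennreal J" "0 \<le> J"
    using nn_integral_int_geometric[OF \<delta>]
    by (cases "?I") auto
  define K where "K = max 1 J"
  have K: "1 \<le> K" "J \<le> K" unfolding K_def by auto
  have le_1: "bump \<delta> x \<le> 1" for x :: real
    using \<delta> powr_mono[of "- \<delta> * \<bar>x\<bar>" 0 2] by (simp add: mult_nonneg_nonneg less_imp_le)
  have "lp_norm \<alpha> (?b m) \<le> ennreal K" if "1 \<le> \<alpha>" for \<alpha> m
    using that
  proof (cases rule: Lp_exponent_cases)
    case 1
    then show ?thesis
      by (simp only:) (intro lp_norm_infinity_le ennreal_leI order_trans[OF le_1 K(1)])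
  next
    case (2 p)
    have "(\<integral>\<^sup>+q. ennpowr (?b m q) p \<partial>count_space UNIV) \<le>
        (\<integral>\<^sup>+q. ?b m q \<partial>count_space UNIV)"
    proof (rule nn_integral_mono)
      fix q
      have "(bump \<delta> (real_of_int (q + m))) powr p \<le> (bump \<delta> (real_of_int (q + m))) powr 1"
        using 2 le_1 by (intro powr_mono') auto
      then show "ennpowr (?b m q) p \<le> ?b m q"
        by (simp add: ennpowr_ennreal ennreal_leI)
    qed
    also have "\<dots> = ?I"
      by (rule nn_integral_bij_count_space) (rule bij_plus_right)
    also have "\<dots> \<le> ennreal K" unfolding J using K by (intro ennreal_leI)
    finally have "lp_norm \<alpha> (?b m) \<le> ennpowr (ennreal K) (1 / p)"
      using 2 by (simp add: lp_norm_real ennpowr_mono)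
    also have "\<dots> \<le> ennreal K"
      using 2 K powr_mono[of "1 / p" 1 K] by (simp add: ennpowr_ennreal ennreal_leI)
    finally show ?thesis .
  qed
  then show ?thesis using that[of K] K by simp
qed

section \<open>Decay in time\<close>

text \<open>With z = x^\<sigma> and a = p / \<sigma> the function is z^a exp(-c z), maximal at z = a
  / c. The bound used is (a / c)^a, the maximum without its factor exp(-a).\<close>

lemma powr_mult_exp_bounded:
  fixes p c \<sigma> :: real
  assumes "0 \<le> p" "0 < c" "0 < \<sigma>"
  obtains K where "0 < K" "\<And>x. 0 < x \<Longrightarrow> x powr p * exp (- c * x powr \<sigma>) \<le> K"
proof -
  define a where "a = p / \<sigma>"
  have a: "0 \<le> a" "a * \<sigma> = p" using assms by (simp_all add: a_def)
  have "x powr p * exp (- c * x powr \<sigma>) \<le> exp (a * ln (a / c))" if x: "0 < x" for x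
  proof (cases "a = 0")
    case True
    then show ?thesis using a assms x by simp
  next
    case False
    then have ap: "0 < a" using a by simp
    define z where "z = x powr \<sigma>"
    have z: "0 < z" unfolding z_def using x by simp
    \<comment> \<open>Centred at the maximum point, so that the inequality ln y <= y - 1 for y = z c
      / a produces exactly the term c z to be cancelled.\<close>
    have "ln z = ln (z * c / a) + ln (a / c)"
      using z ap assms by (simp add: ln_mult ln_div)
    also have "\<dots> \<le> (z * c / a - 1) + ln (a / c)"
      using z ap assms by (intro add_right_mono ln_le_minus_one) simp
    finally have "a * ln z \<le> a * ((z * c / a - 1) + ln (a / c))"
      using ap by (intro mult_left_mono) auto
    also have "\<dots> = c * z - a + a * ln (a / c)" using ap by (simp add: field_simps)
    finally have "a * ln z - c * z \<le> a * ln (a / c)" using ap by simp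
    moreover have "x powr p * exp (- c * x powr \<sigma>) = exp (a * ln z - c * z)"
      using x z a(2) by (simp add: z_def powr_def exp_diff exp_minus field_simps flip: exp_add a(2))
    ultimately show ?thesis by simp
  qed
  then show ?thesis using that[of "exp (a * ln (a / c))"] by simp
qed

section \<open>Lower bounds for the symbol on frequency ranges\<close>

lemma continuous_pos_annulus_lower_bound:
  fixes \<eta> :: "'a::euclidean_space \<Rightarrow> real"
  assumes cont: "continuous_on UNIV \<eta>" and pos: "\<And>\<xi>. \<xi> \<noteq> 0 \<Longrightarrow> 0 < \<eta> \<xi>" and d: "0 < d"
  obtains b where "0 < b" "\<And>\<xi>. d \<le> norm \<xi> \<Longrightarrow> norm \<xi> \<le> R \<Longrightarrow> b \<le> \<eta> \<xi>"
\<comment> \<open>The annulus is empty when R < d, which happens when the asymptotic bound already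
  covers the whole range; any positive b then serves.\<close>
proof (cases "cball 0 R - ball 0 d = ({} :: 'a set)")
  case True
  then have "\<not> (d \<le> norm \<xi> \<and> norm \<xi> \<le> R)" for \<xi> :: 'a by auto
  then show ?thesis using that[of 1] by force
next
  case False
  have "compact (cball 0 R - ball 0 d :: 'a set)" by (intro compact_diff) auto
  then obtain z where z: "z \<in> cball 0 R - ball 0 d" "\<And>y. y \<in> cball 0 R - ball 0 d \<Longrightarrow> \<eta> z \<le> \<eta> y"
    using continuous_attains_inf[OF _ False continuous_on_subset[OF cont subset_UNIV]] by blast
  then have "z \<noteq> 0" using d by auto
  then show ?thesis using that[of "\<eta> z"] z pos by auto
qed

text \<open>The asymptotic bound reaches only an unspecified radius d. On the remaining compact
  annulus \<open>\<eta>\<close> has a positive minimum b, while |\<xi>|^\<sigma> is at most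
  R^\<sigma>; this explains the constant min(a, b / R^\<sigma>). The radius R is prescribed because
  the blocks with q <= 0 extend to a definite radius.\<close>

lemma comparable_at_0_lower_bound:
  fixes \<eta> :: "'a::euclidean_space \<Rightarrow> real"
  assumes cont: "continuous_on UNIV \<eta>" and pos: "\<And>\<xi>. \<xi> \<noteq> 0 \<Longrightarrow> 0 < \<eta> \<xi>"
    and comp: "comparable (at 0) \<eta> (\<lambda>\<xi>. norm \<xi> powr \<sigma>)" and R: "0 < R" and \<sigma>: "0 < \<sigma>"
  obtains c where "0 < c" "\<And>\<xi>. \<xi> \<noteq> 0 \<Longrightarrow> norm \<xi> \<le> R \<Longrightarrow> c * norm \<xi> powr \<sigma> \<le> \<eta> \<xi>"
proof -
  obtain a C where a: "0 < a"
    and ev: "\<forall>\<^sub>F \<xi> in at 0. a * norm \<xi> powr \<sigma> \<le> \<eta> \<xi> \<and> \<eta> \<xi> \<le> C * norm \<xi> powr \<sigma>"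
    using comp unfolding comparable_def by blast
  obtain d where d: "0 < d" "\<And>\<xi>. \<xi> \<noteq> 0 \<Longrightarrow> norm \<xi> < d \<Longrightarrow> a * norm \<xi> powr \<sigma> \<le> \<eta> \<xi>"
    using ev unfolding eventually_at by auto
  obtain b where b: "0 < b" "\<And>\<xi>. d \<le> norm \<xi> \<Longrightarrow> norm \<xi> \<le> R \<Longrightarrow> b \<le> \<eta> \<xi>"
    using continuous_pos_annulus_lower_bound[OF cont pos d(1)] by metis
  define c where "c = min a (b / R powr \<sigma>)"
  have c: "0 < c" "c \<le> a" "c * R powr \<sigma> \<le> b"
    unfolding c_def using a b R by (auto simp: min_def field_simps)
  have "c * norm \<xi> powr \<sigma> \<le> \<eta> \<xi>" if \<xi>: "\<xi> \<noteq> 0" "norm \<xi> \<le> R" for \<xi>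
  proof (cases "norm \<xi> < d")
    case True
    have "c * norm \<xi> powr \<sigma> \<le> a * norm \<xi> powr \<sigma>" using c by (intro mult_right_mono) auto
    then show ?thesis using d(2)[OF \<xi>(1) True] by simp
  next
    case False
    have "c * norm \<xi> powr \<sigma> \<le> c * R powr \<sigma>" using c \<xi> \<sigma> by (intro mult_left_mono powr_mono2) auto
    then show ?thesis using c(3) b(2)[of \<xi>] False \<xi> by simp
  qed
  then show ?thesis using that c by blast
qed

text \<open>The same compactness argument from the outside: between R and the unspecified radius d
  the decreasing power is at most R^(-\<sigma>), hence min(a, b R^\<sigma>).\<close>

lemma comparable_at_infinity_lower_bound:
  fixes \<eta> :: "'a::euclidean_space \<Rightarrow> real"
  assumes cont: "continuous_on UNIV \<eta>" and pos: "\<And>\<xi>. \<xi> \<noteq> 0 \<Longrightarrow> 0 < \<eta> \<xi>"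
    and comp: "comparable at_infinity \<eta> (\<lambda>\<xi>. norm \<xi> powr (- \<sigma>))" and R: "0 < R" and \<sigma>: "0 < \<sigma>"
  obtains c where "0 < c" "\<And>\<xi>. R \<le> norm \<xi> \<Longrightarrow> c * norm \<xi> powr (- \<sigma>) \<le> \<eta> \<xi>"
proof -
  obtain a C where a: "0 < a" and ev: "\<forall>\<^sub>F \<xi> in at_infinity.
      a * norm \<xi> powr (- \<sigma>) \<le> \<eta> \<xi> \<and> \<eta> \<xi> \<le> C * norm \<xi> powr (- \<sigma>)"
    using comp unfolding comparable_def by blast
  obtain d where d: "\<And>\<xi>. d \<le> norm \<xi> \<Longrightarrow> a * norm \<xi> powr (- \<sigma>) \<le> \<eta> \<xi>"
    using ev unfolding eventually_at_infinity by auto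
  obtain b where b: "0 < b" "\<And>\<xi>. R \<le> norm \<xi> \<Longrightarrow> norm \<xi> \<le> d \<Longrightarrow> b \<le> \<eta> \<xi>"
    using continuous_pos_annulus_lower_bound[OF cont pos R] by metis
  define c where "c = min a (b * R powr \<sigma>)"
  have c: "0 < c" "c \<le> a" "c * R powr (- \<sigma>) \<le> b"
    unfolding c_def using a b R by (auto simp: min_def powr_minus field_simps)
  have "c * norm \<xi> powr (- \<sigma>) \<le> \<eta> \<xi>" if \<xi>: "R \<le> norm \<xi>" for \<xi>
  proof (cases "d \<le> norm \<xi>")
    case True
    have "c * norm \<xi> powr (- \<sigma>) \<le> a * norm \<xi> powr (- \<sigma>)" using c by (intro mult_right_mono) auto
    then show ?thesis using d[OF True] by simp
  next
    case False
    have "c * norm \<xi> powr (- \<sigma>) \<le> c * R powr (- \<sigma>)"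
      using c \<xi> \<sigma> R by (intro mult_left_mono powr_mono2') auto
    then show ?thesis using c(3) b(2)[of \<xi>] False \<xi> by simp
  qed
  then show ?thesis using that c by blast
qed

text \<open>The substitution behind both decay estimates: \<open>2\<^sup>y\<close> is \<open>2\<^sup>u\<close> rescaled by \<open>(1 + t)\<^bsup>1/\<sigma>\<^esup>\<close>, and
  replacing \<open>t\<close> by \<open>1 + t\<close> in the exponent costs only \<open>exp c\<close> because \<open>u \<le> 0\<close>.\<close>

lemma scaled_exp_decay:
  fixes u \<delta> \<sigma> c t :: real
  assumes u: "u \<le> 0" and \<sigma>: "0 < \<sigma>" and c: "0 < c" and t: "0 \<le> t"
  defines "y \<equiv> u + log 2 (1 + t) / \<sigma>"
  shows "2 powr (u * \<delta>) * exp (- c * 2 powr (u * \<sigma>) * t) \<le>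
    exp c * (1 + t) powr (- \<delta> / \<sigma>) * ((2 powr y) powr \<delta> * exp (- c * (2 powr y) powr \<sigma>))"
proof -
  define L where "L = log 2 (1 + t)"
  have L: "1 + t = 2 powr L" using t by (simp add: L_def)
  have y: "y * \<sigma> = u * \<sigma> + L" "y * \<delta> = u * \<delta> + L * \<delta> / \<sigma>"
    using \<sigma> by (simp_all add: y_def L_def field_simps)
  have "2 powr (u * \<delta>) = 2 powr (L * (- \<delta> / \<sigma>)) * 2 powr (y * \<delta>)"
    unfolding y(2) by (simp flip: powr_add)
  then have 1: "2 powr (u * \<delta>) = (1 + t) powr (- \<delta> / \<sigma>) * (2 powr y) powr \<delta>"
    unfolding L by (simp only: powr_powr)
  have "(2 powr y) powr \<sigma> = 2 powr (u * \<sigma>) * (1 + t)"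
    unfolding L by (simp only: powr_powr y(1) powr_add)
  then have "- c * 2 powr (u * \<sigma>) * t = c * 2 powr (u * \<sigma>) + - c * (2 powr y) powr \<sigma>"
    by (simp add: algebra_simps)
  moreover have "c * 2 powr (u * \<sigma>) \<le> c"
    using c u \<sigma> powr_mono[of "u * \<sigma>" 0 2] by (simp add: mult_nonpos_nonneg)
  ultimately have "exp (- c * 2 powr (u * \<sigma>) * t) \<le> exp (c + - c * (2 powr y) powr \<sigma>)" by simp
  then have "exp (- c * 2 powr (u * \<sigma>) * t) \<le> exp c * exp (- c * (2 powr y) powr \<sigma>)"
    by (simp only: exp_add)
  then have "2 powr (u * \<delta>) * exp (- c * 2 powr (u * \<sigma>) * t) \<le> 2 powr (u * \<delta>) * (exp c * exp (- c * (2 powr y) powr \<sigma>))"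
    by (intro mult_left_mono) auto
  then show ?thesis unfolding 1 by (simp only: mult_ac)
qed

text \<open>In the rescaled variable y the factor is 2^(y \<delta>) exp(-c 2^(y \<sigma>)). Left of
  y = 0 the power is itself the bump; right of it the exponential turns growth into decay. The shift
  m depends on t but not on q.\<close>

lemma low_frequency_decay:
  fixes \<delta> \<sigma> c :: real
  assumes \<delta>: "0 < \<delta>" and \<sigma>: "0 < \<sigma>" and c: "0 < c"
  obtains C where "0 < C" "\<And>t. 0 \<le> t \<Longrightarrow> \<exists>m::int. \<forall>q::int. q \<le> 0 \<longrightarrow>
    2 powr (q * \<delta>) * exp (- c * 2 powr (q * \<sigma>) * t) \<le> C * (1 + t) powr (- \<delta> / \<sigma>) * bump \<delta> (real_of_int (q + m))"
proof -
  \<comment> \<open>The exponent 2 \<delta> pays twice: one \<delta> against the growth 2^(y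
    \<delta>), the other for the decay 2^(-y \<delta>).\<close>
  obtain K where K: "0 < K" "\<And>x. 0 < x \<Longrightarrow> x powr (2 * \<delta>) * exp (- c * x powr \<sigma>) \<le> K"
    using powr_mult_exp_bounded[of "2 * \<delta>" c \<sigma>] assms by (metis less_imp_le mult_pos_pos zero_less_numeral)
  define C where "C = exp c * max 1 K * 2 powr \<delta>"
  have C: "0 < C" unfolding C_def by simp
  have "\<exists>m::int. \<forall>q::int. q \<le> 0 \<longrightarrow>
    2 powr (q * \<delta>) * exp (- c * 2 powr (q * \<sigma>) * t) \<le> C * (1 + t) powr (- \<delta> / \<sigma>) * bump \<delta> (real_of_int (q + m))"
    if t: "0 \<le> t" for t
  proof (intro exI allI impI)
    fix q :: int assume q: "q \<le> 0"
    \<comment> \<open>The peak is rounded down to an integer so that the bump becomes a shift of a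
      fixed sequence. The error is below 1, which costs the factor 2^\<delta> in
      \<open>C\<close>.\<close>
    define m where "m = \<lfloor>log 2 (1 + t) / \<sigma>\<rfloor>"
    define y where "y = q + log 2 (1 + t) / \<sigma>"
    let ?A = "(2 powr y) powr \<delta> * exp (- c * (2 powr y) powr \<sigma>)"
    have peak: "?A \<le> max 1 K * bump \<delta> y"
    proof (cases "y \<le> 0")
      case True
      have "(2 powr y) powr \<delta> = bump \<delta> y"
        using True by (simp add: powr_powr mult.commute)
      moreover have "exp (- c * (2 powr y) powr \<sigma>) \<le> max 1 K"
        using c by (intro order_trans[OF _ max.cobounded1]) simp
      ultimately show ?thesis
        by (simp only: mult.commute[of "max 1 K"] mult_left_mono powr_ge_zero)
    next
      case False
      have "(2 powr y) powr \<delta> = (2 powr y) powr (2 * \<delta>) * bump \<delta> y"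
        using False by (simp add: powr_powr algebra_simps flip: powr_add)
      then have "?A =
          ((2 powr y) powr (2 * \<delta>) * exp (- c * (2 powr y) powr \<sigma>)) * bump \<delta> y"
        by (simp only: mult_ac)
      also have "\<dots> \<le> max 1 K * bump \<delta> y"
        by (intro mult_right_mono order_trans[OF K(2) max.cobounded2]) auto
      finally show ?thesis .
    qed
    have "\<bar>real_of_int (q + m)\<bar> \<le> \<bar>y\<bar> + 1"
      unfolding y_def m_def by linarith
    then have "\<delta> * \<bar>real_of_int (q + m)\<bar> \<le> \<delta> * (\<bar>y\<bar> + 1)" using \<delta> by (intro mult_left_mono) auto
    then have "- \<delta> * \<bar>y\<bar> \<le> \<delta> + - \<delta> * \<bar>real_of_int (q + m)\<bar>" by (simp add: algebra_simps)
    then have "bump \<delta> y \<le> 2 powr (\<delta> + - \<delta> * \<bar>real_of_int (q + m)\<bar>)" by (intro powr_mono) auto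
    then have "bump \<delta> y \<le> 2 powr \<delta> * bump \<delta> (real_of_int (q + m))" by (simp only: powr_add)
    then have "max 1 K * bump \<delta> y \<le> max 1 K * (2 powr \<delta> * bump \<delta> (real_of_int (q + m)))"
      by (intro mult_left_mono) auto
    with peak have "?A \<le> max 1 K * (2 powr \<delta> * bump \<delta> (real_of_int (q + m)))"
      by (rule order_trans)
    then have "exp c * (1 + t) powr (- \<delta> / \<sigma>) * ?A \<le>
        exp c * (1 + t) powr (- \<delta> / \<sigma>) * (max 1 K * (2 powr \<delta> * bump \<delta> (real_of_int (q + m))))"
      by (intro mult_left_mono) auto
    moreover have "2 powr (q * \<delta>) * exp (- c * 2 powr (q * \<sigma>) * t) \<le>
        exp c * (1 + t) powr (- \<delta> / \<sigma>) * ?A"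
      unfolding y_def using q by (intro scaled_exp_decay \<sigma> c t) simp
    ultimately show "2 powr (q * \<delta>) * exp (- c * 2 powr (q * \<sigma>) * t) \<le>
        C * (1 + t) powr (- \<delta> / \<sigma>) * bump \<delta> (real_of_int (q + \<lfloor>log 2 (1 + t) / \<sigma>\<rfloor>))"
      unfolding C_def m_def by (simp only: mult_ac)
  qed
  then show ?thesis using that[OF C] by blast
qed

lemma high_frequency_decay:
  fixes \<beta> \<sigma> c :: real
  assumes \<beta>: "0 \<le> \<beta>" and \<sigma>: "0 < \<sigma>" and c: "0 < c"
  obtains C where "0 < C" "\<And>t q. 0 \<le> t \<Longrightarrow> 0 \<le> q \<Longrightarrow>
    2 powr (- q * \<beta>) * exp (- c * 2 powr (- q * \<sigma>) * t) \<le> C * (1 + t) powr (- \<beta> / \<sigma>)"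
proof -
  obtain K where K: "0 < K" "\<And>x. 0 < x \<Longrightarrow> x powr \<beta> * exp (- c * x powr \<sigma>) \<le> K"
    using powr_mult_exp_bounded[OF \<beta> c \<sigma>] by metis
  have "2 powr (- q * \<beta>) * exp (- c * 2 powr (- q * \<sigma>) * t) \<le> (exp c * K) * (1 + t) powr (- \<beta> / \<sigma>)"
    if t: "0 \<le> t" and q: "0 \<le> q" for t q
  proof -
    define y where "y = - q + log 2 (1 + t) / \<sigma>"
    have "2 powr (- q * \<beta>) * exp (- c * 2 powr (- q * \<sigma>) * t) \<le>
        exp c * (1 + t) powr (- \<beta> / \<sigma>) * ((2 powr y) powr \<beta> * exp (- c * (2 powr y) powr \<sigma>))"
      unfolding y_def using q by (intro scaled_exp_decay \<sigma> c t) simp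
    also have "\<dots> \<le> exp c * (1 + t) powr (- \<beta> / \<sigma>) * K"
      by (intro mult_left_mono K) auto
    finally show ?thesis by (simp only: mult_ac)
  qed
  then show ?thesis using that[of "exp c * K"] K(1) by simp
qed

section \<open>Assembly of the block estimates\<close>

lemma LP_block_L2_le_besov:
  shows "distr_Lp_norm 2 (LP_block \<phi> q f) \<le> ennreal (2 powr (q * \<rho>)) * besov_norm \<phi> (- \<rho>) 2 \<infinity> f"
proof -
  have "ennreal (2 powr (q * \<rho>)) * ennreal (2 powr (q * - \<rho>)) = 1"
    by (simp add: ennreal_mult[symmetric] flip: powr_add)
  then have "distr_Lp_norm 2 (LP_block \<phi> q f) =
      ennreal (2 powr (q * \<rho>)) * (ennreal (2 powr (q * - \<rho>)) * distr_Lp_norm 2 (LP_block \<phi> q f))"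
    by (simp only: mult.assoc[symmetric] mult_1_left)
  also have "\<dots> \<le> ennreal (2 powr (q * \<rho>)) * besov_norm \<phi> (- \<rho>) 2 \<infinity> f"
    unfolding besov_norm_def by (intro mult_left_mono lp_norm_infinity_ge) simp
  finally show ?thesis .
qed

lemma LP_block_decay:
  fixes \<phi> \<eta> :: "'a::euclidean_space \<Rightarrow> real"
  assumes \<phi>: "LP_cutoff \<phi>" and \<sigma>: "0 < \<sigma>1" "0 < \<sigma>2"
    and \<eta>: "continuous_on UNIV \<eta>" "\<And>\<xi>. \<xi> \<noteq> 0 \<Longrightarrow> 0 < \<eta> \<xi>"
      "comparable (at 0) \<eta> (\<lambda>\<xi>. norm \<xi> powr \<sigma>1)"
      "comparable at_infinity \<eta> (\<lambda>\<xi>. norm \<xi> powr (- \<sigma>2))"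
    and s: "0 < s + \<rho>" and \<alpha>: "1 \<le> \<alpha>" and r: "1 \<le> r" "r \<le> 2"
    and l: "DIM('a) * (1 / r - 1 / 2) \<le> l"
  shows "\<exists>C>0. \<forall>f. besov_norm \<phi> (- \<rho>) 2 \<infinity> f < \<infinity> \<longrightarrow> (\<forall>t\<ge>0.
    lp_norm \<alpha> (\<lambda>q. ennreal (2 powr (of_int q * s)) *
        distr_weighted_Lp_norm 2 (\<lambda>\<xi>. exp (- \<eta> \<xi> * t)) (distr_fourier (LP_block \<phi> q f)))
    \<le> ennreal C *
      (ennreal ((1 + t) powr (- (s + \<rho>) / \<sigma>1)) * besov_norm \<phi> (- \<rho>) 2 \<infinity> f +
       ennreal ((1 + t) powr (- l / \<sigma>2 + gamma_exp DIM('a) \<sigma>2 r 2)) *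
         besov_norm \<phi> (s + l) (ennreal r) \<alpha> f))"
proof -
  let ?n = "DIM('a)" and ?\<kappa> = "DIM('a) * (1 / r - 1 / 2)"
  define \<delta> where "\<delta> = s + \<rho>"
  \<comment> \<open>What remains of l after the loss in Bernstein's inequality; -\<beta> / \<sigma>2
    is precisely the claimed exponent with its \<gamma> term.\<close>
  define \<beta> where "\<beta> = l - ?\<kappa>"
  have \<delta>: "0 < \<delta>" and \<beta>: "0 \<le> \<beta>" using s l by (simp_all add: \<delta>_def \<beta>_def)
  obtain a where a: "0 < a" "\<And>\<xi>. \<xi> \<noteq> 0 \<Longrightarrow> norm \<xi> \<le> 16 / 3 \<Longrightarrow> a * norm \<xi> powr \<sigma>1 \<le> \<eta> \<xi>"
    using comparable_at_0_lower_bound[OF \<eta>(1,2,3), of "16 / 3"] \<sigma> by auto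
  obtain b where b: "0 < b" "\<And>\<xi>. 3 / 4 \<le> norm \<xi> \<Longrightarrow> b * norm \<xi> powr (- \<sigma>2) \<le> \<eta> \<xi>"
    using comparable_at_infinity_lower_bound[OF \<eta>(1,2,4), of "3 / 4"] \<sigma> by auto
  \<comment> \<open>The increasing power |\<xi>|^\<sigma>1 is smallest at the inner radius 3/8 2^q,
    the decreasing power |\<xi>|^(-\<sigma>2) at the outer radius 16/3 2^q.\<close>
  define c1 where "c1 = a * (3 / 8) powr \<sigma>1"
  define c2 where "c2 = b * (16 / 3) powr (- \<sigma>2)"
  have c: "0 < c1" "0 < c2" using a b by (simp_all add: c1_def c2_def)
  obtain C1 where C1: "0 < C1" "\<And>t. 0 \<le> t \<Longrightarrow> \<exists>m::int. \<forall>q::int. q \<le> 0 \<longrightarrow>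
    2 powr (q * \<delta>) * exp (- c1 * 2 powr (q * \<sigma>1) * t) \<le>
      C1 * (1 + t) powr (- \<delta> / \<sigma>1) * bump \<delta> (real_of_int (q + m))"
    using low_frequency_decay[OF \<delta> \<sigma>(1) c(1)] by metis
  obtain C2 where C2: "0 < C2" "\<And>t q. 0 \<le> t \<Longrightarrow> 0 \<le> q \<Longrightarrow>
    2 powr (- q * \<beta>) * exp (- c2 * 2 powr (- q * \<sigma>2) * t) \<le> C2 * (1 + t) powr (- \<beta> / \<sigma>2)"
    using high_frequency_decay[OF \<beta> \<sigma>(2) c(2)] by metis
  obtain K where K: "0 < K"
    "\<And>\<alpha> m. 1 \<le> \<alpha> \<Longrightarrow> lp_norm \<alpha> (\<lambda>q. ennreal (bump \<delta> (real_of_int (q + m)))) \<le> ennreal K"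
    using lp_norm_geometric_bump[OF \<delta>] by metis
  define P where "P = sqrt ((2 * pi) ^ ?n)"
  have P: "0 < P" unfolding P_def by simp
  define B where "B = (Bernstein_const ?n * (16 / 3) powr (?n / 2)) powr (2 / r - 1)"
  have B: "0 < B" unfolding B_def using Bernstein_const_pos[of ?n] by simp
  \<comment> \<open>The leading 2 is the constant of \<open>lp_norm_split_le\<close>; the two
    summands belong to low and high frequencies.\<close>
  define C where "C = 2 * (P * C1 * K + P * B * C2)"
  have C: "0 < C" unfolding C_def using P C1 C2 K B by (simp add: add_pos_pos)
  show ?thesis
  proof (intro exI[of _ C] conjI C allI impI)
    fix f :: "'a distr set" and t :: real
    assume fin: "besov_norm \<phi> (- \<rho>) 2 \<infinity> f < \<infinity>" and t: "0 \<le> t"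
    let ?S = "\<lambda>q. LP_block \<phi> q f" and ?N = "besov_norm \<phi> (- \<rho>) 2 \<infinity> f"
      and ?M = "besov_norm \<phi> (s + l) (ennreal r) \<alpha> f"
    let ?W = "\<lambda>q. distr_weighted_Lp_norm 2 (\<lambda>\<xi>. exp (- \<eta> \<xi> * t)) (distr_fourier (?S q))"
    define \<tau>1 where "\<tau>1 = (1 + t) powr (- \<delta> / \<sigma>1)"
    define \<tau>2 where "\<tau>2 = (1 + t) powr (- \<beta> / \<sigma>2)"
    have \<tau>: "0 \<le> \<tau>1" "0 \<le> \<tau>2" unfolding \<tau>1_def \<tau>2_def by simp_all
    obtain \<nu> where \<nu>: "?N = ennreal \<nu>" "0 \<le> \<nu>" using fin by (cases ?N) auto
    \<comment> \<open>The norm with index -\<rho> places every single block in L^2, also those with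
      q > 0; both the damping estimate and Bernstein's inequality rest on this.\<close>
    have block_fin: "distr_Lp_norm 2 (?S q) < \<infinity>" for q
      using LP_block_L2_le_besov[of \<phi> q f \<rho>] fin
      by (auto intro: order.strict_trans1 simp: ennreal_mult_less_top)
    obtain m :: int where m: "\<And>q::int. q \<le> 0 \<Longrightarrow>
      2 powr (q * \<delta>) * exp (- c1 * 2 powr (q * \<sigma>1) * t) \<le> C1 * \<tau>1 * bump \<delta> (real_of_int (q + m))"
      using C1(2)[OF t] unfolding \<tau>1_def by blast
    \<comment> \<open>In \<open>u\<close> the norm of f is pulled out as the number \<nu> and the
      dependence on q is a bump. In \<open>v\<close> the weighted r-norms are retained, so that its
      l^\<alpha> norm reproduces a Besov norm.\<close>
    define u where "u q = ennreal (P * C1 * \<tau>1 * \<nu>) * ennreal (bump \<delta> (real_of_int (q + m)))" for q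
    define v where "v q = ennreal (P * B * C2 * \<tau>2) *
      (ennreal (2 powr (of_int q * (s + l))) * distr_Lp_norm (ennreal r) (?S q))" for q
    have low: "ennreal (2 powr (of_int q * s)) * ?W q \<le> u q" if q: "q \<le> 0" for q
    proof -
      define E where "E = exp (- c1 * 2 powr (q * \<sigma>1) * t)"
      have E: "0 < E" unfolding E_def by simp
      have lower: "c1 * 2 powr (q * \<sigma>1) \<le> \<eta> \<xi>"
        if \<xi>: "3 / 8 * 2 powr q \<le> norm \<xi>" "norm \<xi> \<le> 16 / 3 * 2 powr q" for \<xi> :: 'a
      proof -
        have "2 powr real_of_int q \<le> 1" using q powr_mono[of "real_of_int q" 0 2] by simp
        then have "norm \<xi> \<le> 16 / 3" using \<xi>(2) by linarith
        moreover have "\<xi> \<noteq> 0" using \<xi>(1) by (auto simp: not_le)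
        ultimately have "a * norm \<xi> powr \<sigma>1 \<le> \<eta> \<xi>" using a(2) by blast
        moreover have "a * (3 / 8 * 2 powr q) powr \<sigma>1 \<le> a * norm \<xi> powr \<sigma>1"
          using \<xi>(1) a(1) \<sigma> by (intro mult_left_mono powr_mono2) auto
        moreover have "a * (3 / 8 * 2 powr q) powr \<sigma>1 = c1 * 2 powr (q * \<sigma>1)"
          unfolding c1_def by (simp only: powr_mult powr_powr mult.assoc)
        ultimately show ?thesis by simp
      qed
      have "?W q \<le> ennreal (P * E) * distr_Lp_norm 2 (?S q)"
        using LP_block_damped_norm[OF \<phi> block_fin lower t] by (simp add: P_def E_def)
      also have "\<dots> \<le> ennreal (P * E) * (ennreal (2 powr (q * \<rho>)) * ?N)"
        by (intro mult_left_mono LP_block_L2_le_besov) simp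
      finally have "ennreal (2 powr (of_int q * s)) * ?W q \<le>
          ennreal (2 powr (of_int q * s)) * (ennreal (P * E) * (ennreal (2 powr (q * \<rho>)) * ennreal \<nu>))"
        unfolding \<nu>(1) by (rule mult_left_mono) simp
      also have "\<dots> = ennreal (P * \<nu> * (2 powr (q * \<delta>) * E))"
      proof -
        have "2 powr (q * s) * (P * E * (2 powr (q * \<rho>) * \<nu>)) = P * \<nu> * (2 powr (q * \<delta>) * E)"
          by (simp add: \<delta>_def distrib_left powr_add)
        then show ?thesis using P E \<nu>(2) by (simp add: ennreal_mult[symmetric])
      qed
      also have "\<dots> \<le> ennreal (P * \<nu> * (C1 * \<tau>1 * bump \<delta> (real_of_int (q + m))))"
        using m[OF q] P \<nu>(2) unfolding E_def by (intro ennreal_leI mult_left_mono) auto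
      also have "\<dots> = u q"
        unfolding u_def using P C1 \<tau> \<nu>(2) by (subst ennreal_mult[symmetric]) (auto simp: mult_ac)
      finally show ?thesis .
    qed
    have high: "ennreal (2 powr (of_int q * s)) * ?W q \<le> v q" if q: "\<not> q \<le> 0" for q
    proof -
      let ?L = "distr_Lp_norm (ennreal r) (?S q)"
      define E where "E = exp (- c2 * 2 powr (- q * \<sigma>2) * t)"
      have E: "0 < E" unfolding E_def by simp
      have lower: "c2 * 2 powr (- q * \<sigma>2) \<le> \<eta> \<xi>"
        if \<xi>: "3 / 8 * 2 powr q \<le> norm \<xi>" "norm \<xi> \<le> 16 / 3 * 2 powr q" for \<xi> :: 'a
      proof -
        have "2 \<le> 2 powr real_of_int q" using q powr_mono[of 1 "real_of_int q" 2] by simp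
        then have \<xi>34: "3 / 4 \<le> norm \<xi>" using \<xi>(1) by linarith
        then have "b * norm \<xi> powr (- \<sigma>2) \<le> \<eta> \<xi>" by (rule b(2))
        moreover have "b * (16 / 3 * 2 powr q) powr (- \<sigma>2) \<le> b * norm \<xi> powr (- \<sigma>2)"
          using \<xi>(2) \<xi>34 b(1) \<sigma> by (intro mult_left_mono powr_mono2') auto
        moreover have "b * (16 / 3 * 2 powr q) powr (- \<sigma>2) = c2 * 2 powr (- q * \<sigma>2)"
          unfolding c2_def by (simp only: powr_mult powr_powr mult.assoc) simp
        ultimately show ?thesis by simp
      qed
      have "?W q \<le> ennreal (P * E) * distr_Lp_norm 2 (?S q)"
        using LP_block_damped_norm[OF \<phi> block_fin lower t] by (simp add: P_def E_def)
      also have "\<dots> \<le> ennreal (P * E) * (ennreal (B * 2 powr (q * ?\<kappa>)) * ?L)"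
        unfolding B_def by (intro mult_left_mono LP_block_Bernstein \<phi> r block_fin) simp
      finally have "ennreal (2 powr (of_int q * s)) * ?W q \<le>
          ennreal (2 powr (of_int q * s)) * (ennreal (P * E) * (ennreal (B * 2 powr (q * ?\<kappa>)) * ?L))"
        by (rule mult_left_mono) simp
      also have "\<dots> = ennreal (P * B * (2 powr (- q * \<beta>) * E) * 2 powr (q * (s + l))) * ?L"
      proof -
        \<comment> \<open>The regularity s is completed to s + l; the surplus 2^(-q \<beta>) is what
          the exponential converts into decay in t.\<close>
        have "q * s + q * ?\<kappa> = - q * \<beta> + q * (s + l)"
          by (simp add: \<beta>_def algebra_simps)
        then have "2 powr (q * s) * 2 powr (q * ?\<kappa>) = 2 powr (- q * \<beta>) * 2 powr (q * (s + l))"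
          by (simp only: powr_add[symmetric])
        then have eq: "2 powr (q * s) * (P * E * (B * 2 powr (q * ?\<kappa>))) =
            P * B * (2 powr (- q * \<beta>) * E) * 2 powr (q * (s + l))"
          by (simp add: mult_ac)
        show ?thesis
          unfolding eq[symmetric] using P E B by (simp add: ennreal_mult mult.assoc)
      qed
      also have "\<dots> \<le> ennreal (P * B * (C2 * \<tau>2) * 2 powr (q * (s + l))) * ?L"
      proof (intro mult_right_mono ennreal_leI)
        have "2 powr (- q * \<beta>) * E \<le> C2 * \<tau>2"
          using C2(2)[OF t, of q] q unfolding E_def \<tau>2_def by simp
        then show "P * B * (2 powr (- q * \<beta>) * E) \<le> P * B * (C2 * \<tau>2)"
          using P B by (intro mult_left_mono) auto
      qed auto
      also have "\<dots> = v q"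
        unfolding v_def using P B C2 \<tau> by (simp add: ennreal_mult[symmetric] mult.assoc[symmetric])
      finally show ?thesis .
    qed
    have "lp_norm \<alpha> (\<lambda>q. ennreal (2 powr (of_int q * s)) * ?W q) \<le> lp_norm \<alpha> (\<lambda>q. if q \<le> 0 then u q else v q)"
      using low high by (intro lp_norm_mono \<alpha>) auto
    also have "\<dots> \<le> 2 * (lp_norm \<alpha> u + lp_norm \<alpha> v)"
      by (rule lp_norm_split_le[OF \<alpha>])
    also have "\<dots> \<le> 2 * (ennreal (P * C1 * \<tau>1 * \<nu>) * ennreal K + ennreal (P * B * C2 * \<tau>2) * ?M)"
    proof (intro mult_left_mono add_mono)
      have "lp_norm \<alpha> u \<le> ennreal (P * C1 * \<tau>1 * \<nu>) * lp_norm \<alpha> (\<lambda>q. ennreal (bump \<delta> (real_of_int (q + m))))"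
        unfolding u_def using P C1 \<tau> \<nu>(2) by (intro lp_norm_cmult_le \<alpha>) auto
      also have "\<dots> \<le> ennreal (P * C1 * \<tau>1 * \<nu>) * ennreal K"
        by (intro mult_left_mono K \<alpha>) simp
      finally show "lp_norm \<alpha> u \<le> ennreal (P * C1 * \<tau>1 * \<nu>) * ennreal K" .
      show "lp_norm \<alpha> v \<le> ennreal (P * B * C2 * \<tau>2) * ?M"
        unfolding v_def besov_norm_def using P B C2 \<tau> by (intro lp_norm_cmult_le \<alpha>) auto
    qed auto
    also have "\<dots> \<le> ennreal C * (ennreal \<tau>1 * ?N + ennreal \<tau>2 * ?M)"
    proof -
      have "2 * (P * C1 * \<tau>1 * \<nu> * K) \<le> C * \<tau>1 * \<nu>"
        unfolding C_def using P C1 C2 B \<tau> \<nu>(2) by (simp add: algebra_simps)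
      then have "2 * (ennreal (P * C1 * \<tau>1 * \<nu>) * ennreal K) \<le> ennreal C * (ennreal \<tau>1 * ?N)"
        using P C1 K C \<tau> \<nu>(2) unfolding \<nu>(1)
        by (simp add: ennreal_mult[symmetric] ennreal_leI mult.assoc flip: ennreal_numeral)
      moreover have "2 * (P * B * C2 * \<tau>2) \<le> C * \<tau>2"
        unfolding C_def using P C1 K \<tau> by (simp add: algebra_simps)
      then have "ennreal (2 * (P * B * C2 * \<tau>2)) * ?M \<le> ennreal (C * \<tau>2) * ?M"
        by (intro mult_right_mono ennreal_leI) auto
      then have "2 * (ennreal (P * B * C2 * \<tau>2) * ?M) \<le> ennreal C * (ennreal \<tau>2 * ?M)"
        using P B C2 C \<tau> by (simp add: ennreal_mult mult.assoc)
      ultimately show ?thesis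
        unfolding distrib_left by (rule add_mono)
    qed
    also have "\<tau>2 = (1 + t) powr (- l / \<sigma>2 + gamma_exp ?n \<sigma>2 r 2)"
    proof -
      have "- \<beta> / \<sigma>2 = - l / \<sigma>2 + gamma_exp ?n \<sigma>2 r 2"
        unfolding \<beta>_def gamma_exp_def using \<sigma>(2) by (simp add: field_simps)
      then show ?thesis unfolding \<tau>2_def by simp
    qed
    finally show "lp_norm \<alpha> (\<lambda>q. ennreal (2 powr (of_int q * s)) * ?W q) \<le> ennreal C *
        (ennreal ((1 + t) powr (- (s + \<rho>) / \<sigma>1)) * ?N +
         ennreal ((1 + t) powr (- l / \<sigma>2 + gamma_exp ?n \<sigma>2 r 2)) * ?M)"
      unfolding \<tau>1_def \<delta>_def .
  qed
qed

theorem theorem1p1: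
  fixes \<phi> \<eta> :: "real ^ 'n \<Rightarrow> real"
    and \<sigma>\<^sub>1 \<sigma>\<^sub>2 s \<rho> r l :: real
    and \<alpha> :: ennreal
  assumes "LP_cutoff \<phi>"
    and "0 < \<sigma>\<^sub>1" and "0 < \<sigma>\<^sub>2"
    and "continuous_on UNIV \<eta>"
    and "\<And>\<xi>. \<xi> \<noteq> 0 \<Longrightarrow> 0 < \<eta> \<xi>"
    and "comparable (at 0) \<eta> (\<lambda>\<xi>. norm \<xi> powr \<sigma>\<^sub>1)"
    and "comparable at_infinity \<eta> (\<lambda>\<xi>. norm \<xi> powr (- \<sigma>\<^sub>2))"
    and "0 < s + \<rho>"
    and "1 \<le> \<alpha>"
    and "1 \<le> r" and "r \<le> 2"
    and "real CARD('n) * (1 / r - 1 / 2) < l \<or> (r = 2 \<and> 0 \<le> l)"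
  shows "\<exists>C>0. \<forall>f \<in> besov_space \<phi> (s + l) (ennreal r) \<alpha> \<inter> besov_space \<phi> (- \<rho>) 2 \<infinity>. \<forall>t\<ge>0.
     lp_norm \<alpha> (\<lambda>q. ennreal (2 powr (of_int q * s)) *
         distr_weighted_Lp_norm 2 (\<lambda>\<xi>. exp (- \<eta> \<xi> * t)) (distr_fourier (LP_block \<phi> q f)))
     \<le> ennreal C *
        (ennreal ((1 + t) powr (- (s + \<rho>) / \<sigma>\<^sub>1)) * besov_norm \<phi> (- \<rho>) 2 \<infinity> f +
         ennreal ((1 + t) powr (- l / \<sigma>\<^sub>2 + gamma_exp CARD('n) \<sigma>\<^sub>2 r 2)) *
           besov_norm \<phi> (s + l) (ennreal r) \<alpha> f)"
proof -
  have dim: "DIM(real ^ 'n) = CARD('n)" by simp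
  \<comment> \<open>For r = 2 the threshold n (1/r - 1/2) is 0, so the strict inequality and the
    endpoint case merge into one weak inequality.\<close>
  have l: "DIM(real ^ 'n) * (1 / r - 1 / 2) \<le> l" using assms(12) unfolding dim by auto
  show ?thesis
    by (rule ex_forward[OF LP_block_decay[OF assms(1-4) _ assms(6-11) l, unfolded dim]])
      (auto simp: besov_space_def assms(5))
qed

end
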